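(* Let $F=\alpha+\beta$ be a Randers metric on an $n$-dimensional manifold $M$. If $F$ is of weakly isotropic scalar curvature, i.e. there exist a $1$-form $\theta=\theta_i(x)y^i$ and a scalar function $\mu=\mu(x)$ on $M$ such that $$\mathbf{r}=n(n-1)\left[\frac{\theta}{F}+\mu(x)\right],$$ then $F$ is of isotropic $S$-curvature, i.e. there is a scalar function $c=c(x)$ on $M$ such that $\mathbf{S}(x,y)=(n+1)c(x)F(x,y)$.
   Context: A Randers metric on a smooth manifold $M$ is a Finsler metric of the form $F=\alpha+\beta$, where $\alpha=\sqrt{a_{ij}(x)y^iy^j}$ is a Riemannian metric and $\beta=b_i(x)y^i$ is a $1$-form with $\|\beta_x\|_\alpha<1$ for all $x\in M$. Here $(x^i,y^i)$ are the standard local coordinates on $TM$, $y=y^i\frac{\partial}{\partial x^i}\in T_xM$. For a Finsler metric $F$ on an $n$-dimensional manifold $M$, put $g_{ij}:=\frac12[F^2]_{y^iy^j}$ and $(g^{ij}):=(g_{ij})^{-1}$. All quantities below are considered for $y\neq 0$. The geodesic coefficients are $$G^k=\tfrac14 g^{kl}\{[F^2]_{x^my^l}y^m-[F^2]_{x^l}\}.$$ The Riemann curvature is $$R^i_{\ k}=2G^i_{x^k}-G^i_{x^jy^k}y^j+2G^jG^i_{y^jy^k}-G^i_{y^j}G^j_{y^k}.$$ The Ricci curvature is $\mathbf{Ric}(x,y):=R^m_{\ m}(x,y)$, the (Akbar-Zadeh) Ricci curvature tensor is $\mathbf{Ric}_{ij}:=\frac12\mathbf{Ric}_{y^iy^j}$,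 and the scalar curvature is $\mathbf{r}:=g^{ij}\mathbf{Ric}_{ij}$ (a function of $(x,y)$). The $S$-curvature is $$\mathbf{S}(x,y)=\frac{\partial G^m}{\partial y^m}-y^m\frac{\partial}{\partial x^m}\left[\ln\sigma_{BH}(x)\right],$$ where $$\sigma_{BH}(x)=\frac{\mathrm{Vol}(\mathbf{B}^n(1))}{\mathrm{Vol}\{(y^i)\in\mathbf{R}^n \mid F(x,y^i\frac{\partial}{\partial x^i})<1\}}$$ is the Busemann–Hausdorff volume coefficient, with Vol the Euclidean volume and $\mathbf{B}^n(1)$ the Euclidean unit ball. *)

theory Defs
  imports "HOL-Analysis.Analysis"
begin

section \<open>Smooth functions on open subsets of Euclidean space\<close>

definition partial :: "'n \<Rightarrow> (real^'n \<Rightarrow> real) \<Rightarrow> real^'n \<Rightarrow> real" where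
  "partial i f x = deriv (\<lambda>t. f (x + t *\<^sub>R axis i 1)) 0"

primrec C_on :: "nat \<Rightarrow> (real^'n) set \<Rightarrow> (real^'n \<Rightarrow> real) \<Rightarrow> bool" where
  "C_on 0 S f \<longleftrightarrow> continuous_on S f"
| "C_on (Suc k) S f \<longleftrightarrow>
     (\<forall>x\<in>S. f differentiable (at x)) \<and> (\<forall>i. C_on k S (partial i f))"

definition smooth_on :: "(real^'n) set \<Rightarrow> (real^'n \<Rightarrow> real) \<Rightarrow> bool" where
  "smooth_on S f \<longleftrightarrow> open S \<and> (\<forall>k. C_on k S f)"


section \<open>Smooth manifolds\<close>

text \<open>
  A chart is a pair of its domain and its coordinate map; the values of the coordinate map
  outside the domain are irrelevant. The dimension of the manifold is \<open>CARD('n)\<close>.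
\<close>

type_synonym ('m, 'n) chart = "'m set \<times> ('m \<Rightarrow> real^'n)"

definition chart_inv :: "('m, 'n) chart \<Rightarrow> real^'n \<Rightarrow> 'm" where
  "chart_inv c = inv_into (fst c) (snd c)"

definition transition :: "('m, 'n) chart \<Rightarrow> ('m, 'n) chart \<Rightarrow> real^'n \<Rightarrow> real^'n" where
  "transition c d = snd d \<circ> chart_inv c"

definition is_chart :: "'m topology \<Rightarrow> ('m, 'n::finite) chart \<Rightarrow> bool" where
  "is_chart X c \<longleftrightarrow> openin X (fst c) \<and> open (snd c ` fst c) \<and>
     homeomorphic_map (subtopology X (fst c)) (top_of_set (snd c ` fst c)) (snd c)"

definition smooth_atlas :: "'m topology \<Rightarrow> ('m, 'n::finite) chart set \<Rightarrow> bool" where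
  "smooth_atlas X A \<longleftrightarrow>
     (\<forall>c\<in>A. is_chart X c) \<and> (\<Union>c\<in>A. fst c) = topspace X \<and>
     (\<forall>c\<in>A. \<forall>d\<in>A. \<forall>i. smooth_on (snd c ` (fst c \<inter> fst d)) (\<lambda>x. transition c d x $ i))"

definition smooth_manifold :: "'m topology \<Rightarrow> ('m, 'n::finite) chart set \<Rightarrow> bool" where
  "smooth_manifold X A \<longleftrightarrow> Hausdorff_space X \<and> second_countable X \<and> smooth_atlas X A"

definition smooth_function ::
    "('m, 'n::finite) chart set \<Rightarrow> ('m \<Rightarrow> real) \<Rightarrow> bool" where
  "smooth_function A f \<longleftrightarrow> (\<forall>c\<in>A. smooth_on (snd c ` fst c) (f \<circ> chart_inv c))"


section \<open>Tangent vectors and tensor fields\<close>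

text \<open>
  A tangent vector at \<open>p\<close> assigns to every chart around \<open>p\<close> its components
  in that chart, which are related by the Jacobians of the coordinate changes. Its value on all
  other charts is fixed to be 0, so that equality of tangent vectors is equality of functions.
\<close>

type_synonym ('m, 'n) tvec = "('m, 'n) chart \<Rightarrow> real^'n"

definition tangent_space :: "('m, 'n::finite) chart set \<Rightarrow> 'm \<Rightarrow> ('m, 'n) tvec set" where
  "tangent_space A p = {v.
     (\<forall>c\<in>A. \<forall>d\<in>A. p \<in> fst c \<inter> fst d \<longrightarrow>
        v d = frechet_derivative (transition c d) (at (snd c p)) (v c)) \<and>
     (\<forall>c. \<not> (c \<in> A \<and> p \<in> fst c) \<longrightarrow> v c = 0)}"

text \<open>The tangent vector \<open>y\<^sup>i \<partial>/\<partial>x\<^sup>i\<close> at \<open>p\<close> in the coordinates of the chart \<open>c\<close>.\<close>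

definition tvec_of ::
    "('m, 'n::finite) chart set \<Rightarrow> ('m, 'n) chart \<Rightarrow> 'm \<Rightarrow> real^'n \<Rightarrow> ('m, 'n) tvec" where
  "tvec_of A c p y = (\<lambda>d. if d \<in> A \<and> p \<in> fst d
     then frechet_derivative (transition c d) (at (snd c p)) y else 0)"

definition one_form ::
    "('m, 'n::finite) chart set \<Rightarrow> 'm topology \<Rightarrow> ('m \<Rightarrow> ('m, 'n) tvec \<Rightarrow> real) \<Rightarrow> bool" where
  "one_form A X \<theta> \<longleftrightarrow>
     (\<forall>p\<in>topspace X. \<forall>u\<in>tangent_space A p. \<forall>v\<in>tangent_space A p. \<forall>s.
        \<theta> p (\<lambda>c. s *\<^sub>R u c + v c) = s * \<theta> p u + \<theta> p v) \<and>
     (\<forall>c\<in>A. \<forall>i. smooth_on (snd c ` fst c)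
        (\<lambda>x. \<theta> (chart_inv c x) (tvec_of A c (chart_inv c x) (axis i 1))))"

definition riemannian_metric ::
    "('m, 'n::finite) chart set \<Rightarrow> 'm topology \<Rightarrow>
     ('m \<Rightarrow> ('m, 'n) tvec \<Rightarrow> ('m, 'n) tvec \<Rightarrow> real) \<Rightarrow> bool" where
  "riemannian_metric A X a \<longleftrightarrow>
     (\<forall>p\<in>topspace X. \<forall>u\<in>tangent_space A p. \<forall>v\<in>tangent_space A p. a p u v = a p v u) \<and>
     (\<forall>p\<in>topspace X. \<forall>u\<in>tangent_space A p. \<forall>v\<in>tangent_space A p. \<forall>w\<in>tangent_space A p. \<forall>s.
        a p (\<lambda>c. s *\<^sub>R u c + v c) w = s * a p u w + a p v w) \<and>
     (\<forall>p\<in>topspace X. \<forall>u\<in>tangent_space A p. u \<noteq> (\<lambda>_. 0) \<longrightarrow> a p u u > 0) \<and>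
     (\<forall>c\<in>A. \<forall>i j. smooth_on (snd c ` fst c)
        (\<lambda>x. a (chart_inv c x) (tvec_of A c (chart_inv c x) (axis i 1))
                              (tvec_of A c (chart_inv c x) (axis j 1))))"


section \<open>Randers metrics\<close>

definition dual_norm ::
    "('m, 'n::finite) chart set \<Rightarrow> ('m \<Rightarrow> ('m, 'n) tvec \<Rightarrow> ('m, 'n) tvec \<Rightarrow> real) \<Rightarrow>
     ('m \<Rightarrow> ('m, 'n) tvec \<Rightarrow> real) \<Rightarrow> 'm \<Rightarrow> real" where
  "dual_norm A a \<beta> p = (SUP v \<in> tangent_space A p - {\<lambda>_. 0}. \<beta> p v / sqrt (a p v v))"

text \<open>
  The Finsler property of \<open>F\<close> (positivity, homogeneity, smoothness off the zero section,
  strong convexity) is not listed: it follows from the bound on the norm of \<open>\<beta>\<close>.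
\<close>

definition randers_metric ::
    "('m, 'n::finite) chart set \<Rightarrow> 'm topology \<Rightarrow> ('m \<Rightarrow> ('m, 'n) tvec \<Rightarrow> real) \<Rightarrow> bool" where
  "randers_metric A X F \<longleftrightarrow> (\<exists>a \<beta>.
     riemannian_metric A X a \<and> one_form A X \<beta> \<and>
     (\<forall>p\<in>topspace X. dual_norm A a \<beta> p < 1) \<and>
     (\<forall>p\<in>topspace X. \<forall>v\<in>tangent_space A p. F p v = sqrt (a p v v) + \<beta> p v))"


section \<open>Finsler geometry in local coordinates\<close>

text \<open>
  Here \<open>L x y\<close> is the coordinate expression of a Finsler metric at the point with
  coordinates \<open>x\<close>, evaluated on the vector with components \<open>y\<close>.
\<close>

type_synonym 'n local_fun = "real^'n \<Rightarrow> real^'n \<Rightarrow> real"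

definition Dx :: "'n::finite \<Rightarrow> 'n local_fun \<Rightarrow> 'n local_fun" where
  "Dx i H = (\<lambda>x y. partial i (\<lambda>z. H z y) x)"

definition Dy :: "'n::finite \<Rightarrow> 'n local_fun \<Rightarrow> 'n local_fun" where
  "Dy i H = (\<lambda>x y. partial i (H x) y)"

definition sq :: "'n::finite local_fun \<Rightarrow> 'n local_fun" where
  "sq L = (\<lambda>x y. (L x y)\<^sup>2)"

definition fund_tensor :: "'n::finite local_fun \<Rightarrow> real^'n \<Rightarrow> real^'n \<Rightarrow> real^'n^'n" where
  "fund_tensor L x y = (\<chi> i j. 1/2 * Dy j (Dy i (sq L)) x y)"

definition fund_inv :: "'n::finite local_fun \<Rightarrow> real^'n \<Rightarrow> real^'n \<Rightarrow> real^'n^'n" where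
  "fund_inv L x y = matrix_inv (fund_tensor L x y)"

definition geodesic_coeff :: "'n::finite local_fun \<Rightarrow> 'n \<Rightarrow> 'n local_fun" where
  "geodesic_coeff L k = (\<lambda>x y. 1/4 * (\<Sum>l\<in>UNIV. fund_inv L x y $ k $ l *
     ((\<Sum>m\<in>UNIV. Dy l (Dx m (sq L)) x y * y $ m) - Dx l (sq L) x y)))"

definition riemann_curv :: "'n::finite local_fun \<Rightarrow> 'n \<Rightarrow> 'n \<Rightarrow> 'n local_fun" where
  "riemann_curv L i k = (let G = geodesic_coeff L in (\<lambda>x y.
     2 * Dx k (G i) x y
     - (\<Sum>j\<in>UNIV. Dy k (Dx j (G i)) x y * y $ j)
     + 2 * (\<Sum>j\<in>UNIV. G j x y * Dy k (Dy j (G i)) x y)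
     - (\<Sum>j\<in>UNIV. Dy j (G i) x y * Dy k (G j) x y)))"

definition ricci_curv :: "'n::finite local_fun \<Rightarrow> 'n local_fun" where
  "ricci_curv L = (\<lambda>x y. \<Sum>m\<in>UNIV. riemann_curv L m m x y)"

definition ricci_tensor :: "'n::finite local_fun \<Rightarrow> 'n \<Rightarrow> 'n \<Rightarrow> 'n local_fun" where
  "ricci_tensor L i j = (\<lambda>x y. 1/2 * Dy j (Dy i (ricci_curv L)) x y)"

definition scalar_curv :: "'n::finite local_fun \<Rightarrow> 'n local_fun" where
  "scalar_curv L = (\<lambda>x y.
     \<Sum>i\<in>UNIV. \<Sum>j\<in>UNIV. fund_inv L x y $ i $ j * ricci_tensor L i j x y)"

definition sigma_BH :: "'n::finite local_fun \<Rightarrow> real^'n \<Rightarrow> real" where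
  "sigma_BH L x =
     measure lborel (ball (0 :: real^'n) 1) / measure lborel {y :: real^'n. L x y < 1}"

definition S_curv :: "'n::finite local_fun \<Rightarrow> 'n local_fun" where
  "S_curv L = (\<lambda>x y. (\<Sum>m\<in>UNIV. Dy m (geodesic_coeff L m) x y)
     - (\<Sum>m\<in>UNIV. y $ m * partial m (\<lambda>z. ln (sigma_BH L z)) x))"


section \<open>Curvature conditions on the manifold\<close>

definition local_metric ::
    "('m, 'n::finite) chart set \<Rightarrow> ('m \<Rightarrow> ('m, 'n) tvec \<Rightarrow> real) \<Rightarrow> ('m, 'n) chart \<Rightarrow>
     'n local_fun" where
  "local_metric A F c = (\<lambda>x y. F (chart_inv c x) (tvec_of A c (chart_inv c x) y))"

definition weakly_isotropic_scalar_curvature ::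
    "('m, 'n::finite) chart set \<Rightarrow> 'm topology \<Rightarrow> ('m \<Rightarrow> ('m, 'n) tvec \<Rightarrow> real) \<Rightarrow> bool" where
  "weakly_isotropic_scalar_curvature A X F \<longleftrightarrow> (\<exists>\<theta> \<mu>.
     one_form A X \<theta> \<and> smooth_function A \<mu> \<and>
     (\<forall>c\<in>A. \<forall>p\<in>fst c. \<forall>v\<in>tangent_space A p - {\<lambda>_. 0}.
        scalar_curv (local_metric A F c) (snd c p) (v c) =
          real CARD('n) * (real CARD('n) - 1) * (\<theta> p v / F p v + \<mu> p)))"

definition isotropic_S_curvature ::
    "('m, 'n::finite) chart set \<Rightarrow> ('m \<Rightarrow> ('m, 'n) tvec \<Rightarrow> real) \<Rightarrow> bool" where
  "isotropic_S_curvature A F \<longleftrightarrow> (\<exists>\<kappa>.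
     smooth_function A \<kappa> \<and>
     (\<forall>c\<in>A. \<forall>p\<in>fst c. \<forall>v\<in>tangent_space A p - {\<lambda>_. 0}.
        S_curv (local_metric A F c) (snd c p) (v c) = (real CARD('n) + 1) * \<kappa> p * F p v))"

end

theory Submission
  imports Defs "HOL-Computational_Algebra.Polynomial" "HOL-Computational_Algebra.Fundamental_Theorem_Algebra"
begin

text \<open>
  In a chart, the geodesic coefficients are \<open>G\<^sup>k = P y\<^sup>k + R\<^sup>k\<close> with \<open>P = e\<^sub>0\<^sub>0 / (2F)\<close> and \<open>R\<^sup>k\<close>
  polynomial in \<open>y\<close>, \<open>\<alpha>\<close>, \<open>1/\<alpha>\<close>. As \<open>F\<close> is constant along geodesics, the Ricci curvature equals
  \<open>3(n-1)/4 \<cdot> e\<^sub>0\<^sub>0\<^sup>2 / F\<^sup>2\<close> up to a term with a simple pole along \<open>F = 0\<close>, and contracting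
  its Hessian with the inverse fundamental tensor gives a pole of order 5 with coefficient
  \<open>9(n-1)/2 \<cdot> e\<^sub>0\<^sub>0\<^sup>2 (\<beta> + b\<^sup>2 \<alpha>)\<close>. A weakly isotropic scalar curvature has at most a simple pole, so
  \<open>e\<^sub>0\<^sub>0\<^sup>2\<close> vanishes on the complex cone \<open>F = 0\<close>, whence \<open>e\<^sub>0\<^sub>0 = 2c (\<alpha>\<^sup>2 - \<beta>\<^sup>2)\<close>. Together with the
  Busemann-Hausdorff volume, computed from the ellipsoid \<open>F < 1\<close>, this is equivalent to
  \<open>S = (n+1) c F\<close>. A Lie derivative formula for \<open>e\<^sub>0\<^sub>0\<close> shows that \<open>c\<close> does not depend on the chart.
\<close>

section \<open>Calculus of smooth functions\<close>

text \<open>On \<open>F = 0\<close> one has \<open>\<beta> = -\<alpha>\<close>, so the leading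
  coefficient \<open>\<beta> + b^2 \<alpha>\<close> becomes \<open>-(1 - b^2) \<alpha>\<close>,
  which \<open>b^2 < 1\<close> keeps from vanishing. Its factor \<open>n - 1\<close> is harmless: in
  dimension one any two vectors are proportional, and so are the values of two quadratic forms.
  Vanishing on the complex cone is made precise on real lines \<open>u + t v\<close>. There every
  expression has the form \<open>(p + sqrt A q) / A^k\<close> with polynomials \<open>p\<close>,
  \<open>q\<close> in \<open>t\<close>, and since \<open>A\<close> is no square, an equation between
  such expressions splits into two polynomial equations. A nonreal root \<open>w\<close> of
  \<open>\<alpha>^2 - \<beta>^2\<close> along the line must then be a root of \<open>e_00\<close>,
  and a real quadratic is determined up to a factor by one nonreal root. The obstacle is a point
  where \<open>\<beta>\<close> vanishes: then \<open>\<alpha>\<close> vanishes at \<open>w\<close>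
  as well, and the powers of \<open>1/\<alpha>\<close> that the remainder may contain absorb
  everything. Continuity in \<open>x\<close> closes this gap. All tensors are written in partial
  derivatives of one chart, so the factor \<open>c\<close> is at first attached to a chart.\<close>

lemma sum_of_bool:
  fixes c :: "'k::finite \<Rightarrow> real"
  shows "(\<Sum>m\<in>UNIV. of_bool (l = m) * c m) = c l" "(\<Sum>m\<in>UNIV. of_bool (m = l) * c m) = c l"
    "(\<Sum>m\<in>UNIV. c m * of_bool (l = m)) = c l" "(\<Sum>m\<in>UNIV. c m * of_bool (m = l)) = c l"
proof -
  have "(\<Sum>m\<in>UNIV. of_bool (l = m) * c m) = (\<Sum>m\<in>UNIV. if m = l then c m else 0)"
    by (rule sum.cong) auto
  thus "(\<Sum>m\<in>UNIV. of_bool (l = m) * c m) = c l" by simp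
  thus "(\<Sum>m\<in>UNIV. of_bool (m = l) * c m) = c l" "(\<Sum>m\<in>UNIV. c m * of_bool (l = m)) = c l"
    "(\<Sum>m\<in>UNIV. c m * of_bool (m = l)) = c l" by (simp_all add: eq_commute mult.commute)
qed

lemma axis_of_bool: "axis i (1::real) $ k = of_bool (k = i)"
  by (simp add: axis_def)

lemma partial_has_derivative:
  assumes "(f has_derivative f') (at x)"
  shows "partial i f x = f' (axis i 1)"
proof -
  have "((\<lambda>t::real. x + t *\<^sub>R axis i 1) has_derivative (\<lambda>t. t *\<^sub>R axis i 1)) (at 0)"
    by (auto intro!: derivative_eq_intros)
  moreover have "(f has_derivative f') (at (x + 0 *\<^sub>R axis i 1))"
    using assms by simp
  ultimately have "((\<lambda>t. f (x + t *\<^sub>R axis i 1)) has_derivative (\<lambda>t. f' (t *\<^sub>R axis i 1))) (at 0)"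
    using has_derivative_compose by blast
  moreover have "f' (t *\<^sub>R axis i 1) = f' (axis i 1) * t" for t
    using linear_cmul[OF has_derivative_linear[OF assms]] by simp
  ultimately show ?thesis
    unfolding partial_def by (intro DERIV_imp_deriv) (simp add: has_field_derivative_def)
qed

lemma partial_cong:
  assumes "open S" "x \<in> S" "\<And>z. z \<in> S \<Longrightarrow> f z = g z"
  shows "partial i f x = partial i g x"
  unfolding partial_def
proof (rule deriv_cong_ev)
  have "open ((\<lambda>t::real. x + t *\<^sub>R axis i 1) -` S)"
    using assms(1) by (intro open_vimage continuous_intros)
  hence "\<forall>\<^sub>F t in nhds 0. x + t *\<^sub>R axis i 1 \<in> S"
    using assms(2) eventually_nhds_in_open by fastforce
  thus "\<forall>\<^sub>F t in nhds 0. f (x + t *\<^sub>R axis i 1) = g (x + t *\<^sub>R axis i 1)"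
    by eventually_elim (use assms in auto)
qed simp

lemma has_derivative_partial:
  fixes f :: "real^'n::finite \<Rightarrow> real"
  assumes "f differentiable (at x)"
  shows "(f has_derivative (\<lambda>h. \<Sum>i\<in>UNIV. h $ i * partial i f x)) (at x)"
proof -
  obtain f' where f': "(f has_derivative f') (at x)"
    using assms by (auto simp: differentiable_def)
  have "f' h = (\<Sum>i\<in>UNIV. h $ i * partial i f x)" for h
  proof -
    have "f' h = f' (\<Sum>i\<in>UNIV. h $ i *\<^sub>R axis i 1)"
      by (simp add: basis_expansion[of h, unfolded scalar_mult_eq_scaleR])
    also have "\<dots> = (\<Sum>i\<in>UNIV. h $ i * f' (axis i 1))"
      using has_derivative_linear[OF f'] by (simp add: linear_sum linear_cmul)
    finally show ?thesis
      by (simp add: partial_has_derivative[OF f'])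
  qed
  hence "f' = (\<lambda>h. \<Sum>i\<in>UNIV. h $ i * partial i f x)" by blast
  thus ?thesis using f' by simp
qed

lemma differentiable_cong_open:
  assumes "f differentiable (at x)" "open S" "x \<in> S" "\<And>z. z \<in> S \<Longrightarrow> f z = g z"
  shows "g differentiable (at x)"
proof -
  obtain f' where "(f has_derivative f') (at x)"
    using assms by (auto simp: differentiable_def)
  hence "(g has_derivative f') (at x)"
    by (rule has_derivative_transform_within_open) (use assms in auto)
  thus ?thesis by (auto simp: differentiable_def)
qed

lemma partial_const [simp]: "partial i (\<lambda>_. c) x = 0"
  by (simp add: partial_def)

lemma partial_coord: "partial i (\<lambda>y. y $ j) x = of_bool (i = j)"
  by (subst partial_has_derivative[OF bounded_linear.has_derivative[OF bounded_linear_vec_nth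
      has_derivative_ident]])
     (simp add: axis_def)

lemma partial_add:
  fixes f :: "real^'n::finite \<Rightarrow> real"
  assumes "f differentiable (at x)" "g differentiable (at x)"
  shows "partial i (\<lambda>x. f x + g x) x = partial i f x + partial i g x"
proof -
  from assms obtain f' g' where "(f has_derivative f') (at x)" "(g has_derivative g') (at x)"
    by (auto simp: differentiable_def)
  thus ?thesis
    by (auto simp: partial_has_derivative partial_has_derivative[OF has_derivative_add])
qed

lemma partial_mult:
  fixes f :: "real^'n::finite \<Rightarrow> real"
  assumes "f differentiable (at x)" "g differentiable (at x)"
  shows "partial i (\<lambda>x. f x * g x) x = partial i f x * g x + f x * partial i g x"
proof -
  from assms obtain f' g' where "(f has_derivative f') (at x)" "(g has_derivative g') (at x)"
    by (auto simp: differentiable_def)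
  thus ?thesis
    by (auto simp: partial_has_derivative partial_has_derivative[OF has_derivative_mult])
qed

lemma partial_cmult:
  fixes f :: "real^'n::finite \<Rightarrow> real"
  assumes "f differentiable (at x)"
  shows "partial i (\<lambda>x. c * f x) x = c * partial i f x"
  using partial_mult[of "\<lambda>_. c" x f i] assms by simp

lemma partial_diff:
  fixes f :: "real^'n::finite \<Rightarrow> real"
  assumes "f differentiable (at x)" "g differentiable (at x)"
  shows "partial i (\<lambda>x. f x - g x) x = partial i f x - partial i g x"
  using partial_add[of f x "\<lambda>x. -1 * g x" i] partial_cmult[of g x i "-1"] assms
  by (simp add: differentiable_minus)

lemma partial_sum:
  fixes f :: "'b \<Rightarrow> real^'n::finite \<Rightarrow> real"
  assumes "\<And>j. j \<in> J \<Longrightarrow> f j differentiable (at x)" "finite J"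
  shows "partial i (\<lambda>x. \<Sum>j\<in>J. f j x) x = (\<Sum>j\<in>J. partial i (f j) x)"
  using assms(2,1)
  by (induction J rule: finite_induct) (auto simp: partial_add differentiable_sum)

lemma partial_chain:
  fixes f :: "real^'n::finite \<Rightarrow> real"
  assumes "(g has_field_derivative d) (at (f x))" "f differentiable (at x)"
  shows "partial i (\<lambda>x. g (f x)) x = d * partial i f x"
    and "(\<lambda>x. g (f x)) differentiable (at x)"
proof -
  from assms obtain f' where f': "(f has_derivative f') (at x)"
    by (auto simp: differentiable_def)
  have "((\<lambda>x. g (f x)) has_derivative (\<lambda>h. d * f' h)) (at x)"
    using has_derivative_compose[OF f'] assms(1) by (simp add: has_field_derivative_def)
  thus "partial i (\<lambda>x. g (f x)) x = d * partial i f x" "(\<lambda>x. g (f x)) differentiable (at x)"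
    using partial_has_derivative[of _ _ x i] f' by (fastforce simp: differentiable_def)+
qed

lemma partial_inverse:
  fixes f :: "real^'n::finite \<Rightarrow> real"
  assumes "f differentiable (at x)" "f x \<noteq> 0"
  shows "partial i (\<lambda>x. 1 / f x) x = - partial i f x / (f x)\<^sup>2"
    and "(\<lambda>x. 1 / f x) differentiable (at x)"
proof -
  have "((\<lambda>u. 1 / u) has_field_derivative (- 1 / (f x)\<^sup>2)) (at (f x))"
    using assms by (auto intro!: derivative_eq_intros simp: power2_eq_square)
  from partial_chain[OF this assms(1)] show "partial i (\<lambda>x. 1 / f x) x = - partial i f x / (f x)\<^sup>2"
    "(\<lambda>x. 1 / f x) differentiable (at x)" by auto
qed

lemma C_on_Suc_imp: "C_on (Suc k) S f \<Longrightarrow> C_on k S f"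
proof (induction k arbitrary: f)
  case 0
  thus ?case
    by (auto simp: differentiable_imp_continuous_within differentiable_at_withinI
        continuous_on_eq_continuous_within)
next
  case (Suc k)
  thus ?case by (auto simp del: C_on.simps simp: C_on.simps(2))
qed

text \<open>\<open>partial\<close> only looks at a neighbourhood of the point. The closure
  properties below are all proved by applying this to the formula that the sum, product or quotient
  rule gives for \<open>partial i\<close>.\<close>

lemma C_on_cong:
  assumes "open S"
  shows "C_on k S f \<Longrightarrow> (\<And>x. x \<in> S \<Longrightarrow> f x = g x) \<Longrightarrow> C_on k S g"
proof (induction k arbitrary: f g)
  case 0 thus ?case by (auto cong: continuous_on_cong)
next
  case (Suc k)
  have "C_on k S (partial i g)" for i
    by (rule Suc.IH[of "partial i f"]) (use Suc.prems assms in \<open>auto intro: partial_cong\<close>)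
  moreover have "g differentiable (at x)" if "x \<in> S" for x
    using Suc.prems assms that by (auto intro: differentiable_cong_open)
  ultimately show ?case by simp
qed

lemma C_on_const: "C_on k S (\<lambda>_. c)"
proof (induction k arbitrary: c)
  case (Suc k)
  have "partial i (\<lambda>_. c) = (\<lambda>_. 0)" for i :: 'a
    by (rule ext) simp
  thus ?case using Suc by simp
qed simp

lemma C_on_add:
  assumes "open S"
  shows "C_on k S f \<Longrightarrow> C_on k S g \<Longrightarrow> C_on k S (\<lambda>x. f x + g x)"
proof (induction k arbitrary: f g)
  case (Suc k)
  have "C_on k S (partial i (\<lambda>x. f x + g x))" for i
    by (rule C_on_cong[OF assms Suc.IH[of "partial i f" "partial i g"]])
       (use Suc.prems in \<open>auto simp: partial_add\<close>)
  thus ?case using Suc.prems by auto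
qed (auto intro: continuous_on_add)

lemma C_on_mult:
  assumes "open S"
  shows "C_on k S f \<Longrightarrow> C_on k S g \<Longrightarrow> C_on k S (\<lambda>x. f x * g x)"
proof (induction k arbitrary: f g)
  case (Suc k)
  have "C_on k S (partial i (\<lambda>x. f x * g x))" for i
    by (rule C_on_cong[OF assms C_on_add[OF assms, OF Suc.IH[of "partial i f" g] Suc.IH[of f "partial i g"]]])
       (use Suc.prems C_on_Suc_imp in \<open>auto simp: partial_mult\<close>)
  thus ?case using Suc.prems by auto
qed (auto intro: continuous_on_mult)

lemma C_on_inverse:
  assumes "open S"
  shows "C_on k S f \<Longrightarrow> (\<And>x. x \<in> S \<Longrightarrow> f x \<noteq> 0) \<Longrightarrow> C_on k S (\<lambda>x. 1 / f x)"
proof (induction k arbitrary: f)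
  case (Suc k)
  have 1: "C_on k S (\<lambda>x. 1 / f x)"
    using Suc C_on_Suc_imp by blast
  have "C_on k S (partial i (\<lambda>x. 1 / f x))" for i
    by (rule C_on_cong[OF assms C_on_mult[OF assms C_on_mult[OF assms C_on_const[of _ _ "-1"], of _
        "partial i f"]
          C_on_mult[OF assms 1 1]]])
       (use Suc.prems in \<open>auto simp: partial_inverse power2_eq_square\<close>)
  thus ?case using Suc.prems by (auto intro: partial_inverse)
qed (auto intro!: continuous_intros)

lemma smooth_on_open: "smooth_on S f \<Longrightarrow> open S"
  by (simp add: smooth_on_def)

lemma smooth_on_differentiable: "smooth_on S f \<Longrightarrow> x \<in> S \<Longrightarrow> f differentiable (at x)"
  unfolding smooth_on_def using C_on.simps(2)[of 0 S f] by auto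

lemma smooth_on_continuous: "smooth_on S f \<Longrightarrow> continuous_on S f"
  unfolding smooth_on_def using C_on.simps(1)[of S f] by blast

lemma smooth_on_cong: "smooth_on S f \<Longrightarrow> (\<And>x. x \<in> S \<Longrightarrow> f x = g x) \<Longrightarrow> smooth_on S g"
  unfolding smooth_on_def using C_on_cong by blast

lemma smooth_on_partial: "smooth_on S f \<Longrightarrow> smooth_on S (partial i f)"
  unfolding smooth_on_def using C_on.simps(2) by blast

lemma smooth_on_const: "open S \<Longrightarrow> smooth_on S (\<lambda>_. c)"
  unfolding smooth_on_def using C_on_const by blast

lemma smooth_on_add: "smooth_on S f \<Longrightarrow> smooth_on S g \<Longrightarrow> smooth_on S (\<lambda>x. f x + g x)"
  unfolding smooth_on_def using C_on_add by blast

lemma smooth_on_mult: "smooth_on S f \<Longrightarrow> smooth_on S g \<Longrightarrow> smooth_on S (\<lambda>x. f x * g x)"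
  unfolding smooth_on_def using C_on_mult by blast

lemma smooth_on_diff: "smooth_on S f \<Longrightarrow> smooth_on S g \<Longrightarrow> smooth_on S (\<lambda>x. f x - g x)"
  using smooth_on_add[of S f "\<lambda>x. -1 * g x"] smooth_on_mult[OF smooth_on_const, of S g "-1"]
  by (auto dest: smooth_on_open)

lemma smooth_on_divide:
  "smooth_on S f \<Longrightarrow> smooth_on S g \<Longrightarrow> (\<And>x. x \<in> S \<Longrightarrow> g x \<noteq> 0) \<Longrightarrow> smooth_on S (\<lambda>x. f x / g x)"
  using smooth_on_mult[of S f "\<lambda>x. 1 / g x"] C_on_inverse[of S _ g] unfolding smooth_on_def by simp

lemma smooth_on_sum:
  assumes "\<And>j. j \<in> J \<Longrightarrow> smooth_on S (f j)" "open S"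
  shows "smooth_on S (\<lambda>x. \<Sum>j\<in>J. f j x)"
  using assms by (induction J rule: infinite_finite_induct) (auto intro: smooth_on_const smooth_on_add)

lemma smooth_on_prod:
  assumes "\<And>j. j \<in> J \<Longrightarrow> smooth_on S (f j)" "open S"
  shows "smooth_on S (\<lambda>x. \<Prod>j\<in>J. f j x)"
  using assms by (induction J rule: infinite_finite_induct) (auto intro: smooth_on_const smooth_on_mult)

lemma smooth_on_det:
  fixes A :: "real^'n::finite \<Rightarrow> real^'m::finite^'m"
  assumes "\<And>i j. smooth_on S (\<lambda>x. A x $ i $ j)" "open S"
  shows "smooth_on S (\<lambda>x. det (A x))"
  unfolding det_def using assms by (intro smooth_on_sum smooth_on_mult smooth_on_const smooth_on_prod)

section \<open>Smoothness of the inverse of a matrix of smooth functions\<close>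

lemma invertible_matrix_inv:
  fixes A :: "real^'n::finite^'n"
  assumes "invertible A"
  shows "A ** matrix_inv A = mat 1" "matrix_inv A ** A = mat 1"
  using someI_ex[OF assms[unfolded invertible_def]] by (auto simp: matrix_inv_def)

lemma matrix_inv_eq:
  fixes A :: "real^'n::finite^'n"
  assumes "A ** B = mat 1"
  shows "matrix_inv A = B"
proof -
  have "invertible A"
    using assms matrix_left_right_inverse[of A B] by (auto simp: invertible_def)
  hence "matrix_inv A = matrix_inv A ** (A ** B)"
    using assms by simp
  also have "\<dots> = B"
    by (simp add: matrix_mul_assoc invertible_matrix_inv \<open>invertible A\<close>)
  finally show ?thesis .
qed

text \<open>By Cramer's rule an entry of the inverse is a quotient of two determinants, the
  numerator having column \<open>k\<close> replaced by a unit vector.\<close>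

lemma smooth_on_matrix_inv:
  fixes A :: "real^'n::finite \<Rightarrow> real^'m::finite^'m"
  assumes A: "\<And>i j. smooth_on S (\<lambda>x. A x $ i $ j)" and S: "open S"
    and inv: "\<And>x. x \<in> S \<Longrightarrow> invertible (A x)"
  shows "smooth_on S (\<lambda>x. matrix_inv (A x) $ k $ l)"
proof (rule smooth_on_cong)
  let ?B = "\<lambda>x. \<chi> i j. if j = k then axis l 1 $ i else A x $ i $ j"
  have "smooth_on S (\<lambda>x. ?B x $ i $ j)" for i j
    using A S by (cases "j = k") (auto intro: smooth_on_const)
  thus "smooth_on S (\<lambda>x. det (?B x) / det (A x))"
    using A S inv by (intro smooth_on_divide smooth_on_det) (auto simp: invertible_det_nz)
  fix x assume "x \<in> S"
  hence *: "invertible (A x)" by (rule inv)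
  have "A x *v (matrix_inv (A x) *v axis l 1) = axis l 1"
    using * by (simp add: matrix_vector_mul_assoc invertible_matrix_inv)
  hence "matrix_inv (A x) *v axis l 1 = (\<chi> k. det (\<chi> i j. if j
      = k then axis l 1 $ i else A x $ i $ j) / det (A x))"
    using * by (subst (asm) cramer) (auto simp: invertible_det_nz)
  hence "(matrix_inv (A x) *v axis l 1) $ k = det (?B x) / det (A x)"
    by simp
  thus "det (?B x) / det (A x) = matrix_inv (A x) $ k $ l"
    by (simp add: matrix_vector_mult_basis column_def)
qed

section \<open>Randers metrics in a chart\<close>

text \<open>The coordinate components of \<open>\<alpha>^2\<close> and \<open>\<beta>\<close> in one
  chart. The bound on the norm of \<open>\<beta>\<close> is stated as
  \<open>|\<beta>| < \<alpha>\<close> on nonzero vectors, the form in which positivity of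
  \<open>F\<close> and of \<open>\<alpha>^2 - \<beta>^2\<close> is read off.\<close>

locale randers_chart =
  fixes U :: "(real^'n::finite) set"
    and a :: "real^'n \<Rightarrow> real^'n^'n"
    and b :: "real^'n \<Rightarrow> real^'n"
  assumes open_U: "open U"
    and smooth_a: "smooth_on U (\<lambda>x. a x $ i $ j)"
    and smooth_b: "smooth_on U (\<lambda>x. b x $ i)"
    and sym_a: "x \<in> U \<Longrightarrow> a x $ i $ j = a x $ j $ i"
    and pos_a: "x \<in> U \<Longrightarrow> y \<noteq> 0 \<Longrightarrow> 0 < (\<Sum>i\<in>UNIV. \<Sum>j\<in>UNIV. a x $ i $ j * y $ i * y $ j)"
    and beta_less: "x \<in> U \<Longrightarrow> y \<noteq> 0 \<Longrightarrow>
      \<bar>\<Sum>i\<in>UNIV. b x $ i * y $ i\<bar> < sqrt (\<Sum>i\<in>UNIV. \<Sum>j\<in>UNIV. a x $ i $ j * y $ i * y $ j)"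
begin

definition A2 :: "'n local_fun" where
  "A2 x y = (\<Sum>i\<in>UNIV. \<Sum>j\<in>UNIV. a x $ i $ j * y $ i * y $ j)"

definition al :: "'n local_fun" where "al x y = sqrt (A2 x y)"

definition be :: "'n local_fun" where "be x y = (\<Sum>i\<in>UNIV. b x $ i * y $ i)"

definition F :: "'n local_fun" where "F x y = al x y + be x y"

text \<open>The reciprocals have names because they serve as generators of \<open>pol\<close>; with
  \<open>al * ial = 1\<close> and \<open>F * iF = 1\<close> the later identities become polynomial
  ones.\<close>

definition ial :: "'n local_fun" where "ial x y = 1 / al x y"

definition iF :: "'n local_fun" where "iF x y = 1 / F x y"

lemma A2_pos: "x \<in> U \<Longrightarrow> y \<noteq> 0 \<Longrightarrow> 0 < A2 x y"
  by (simp add: A2_def pos_a)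

lemma al_pos: "x \<in> U \<Longrightarrow> y \<noteq> 0 \<Longrightarrow> 0 < al x y"
  by (simp add: al_def A2_pos)

lemma al_sq: "x \<in> U \<Longrightarrow> (al x y)\<^sup>2 = A2 x y"
  using A2_pos[of x y] by (cases "y = 0") (auto simp: al_def A2_def)

lemma abs_be_less: "x \<in> U \<Longrightarrow> y \<noteq> 0 \<Longrightarrow> \<bar>be x y\<bar> < al x y"
  using beta_less by (simp add: be_def al_def A2_def)

lemma al_ial: "x \<in> U \<Longrightarrow> y \<noteq> 0 \<Longrightarrow> al x y * ial x y = 1"
  using al_pos by (simp add: ial_def less_imp_neq[symmetric])

lemma F_pos: "x \<in> U \<Longrightarrow> y \<noteq> 0 \<Longrightarrow> 0 < F x y"
  using abs_be_less[of x y] by (simp add: F_def)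

lemma F_iF: "x \<in> U \<Longrightarrow> y \<noteq> 0 \<Longrightarrow> F x y * iF x y = 1"
  using F_pos by (simp add: iF_def less_imp_neq[symmetric])

text \<open>
  Functions of \<open>(x, y)\<close> that are homogeneous of degree \<open>d\<close> in \<open>y\<close> and become polynomial in
  \<open>y\<close>, \<open>\<alpha>\<close> and \<open>1/\<alpha>\<close> after multiplication by \<open>F\<^sup>k\<close>: the argument of the theorem is a
  comparison of pole orders along the complex cone \<open>F = 0\<close>.
\<close>

inductive pol :: "nat \<Rightarrow> int \<Rightarrow> 'n local_fun \<Rightarrow> bool" where
  pol_coef: "smooth_on U f \<Longrightarrow> pol 0 0 (\<lambda>x y. f x)"
| pol_coord: "pol 0 1 (\<lambda>x y. y $ i)"
| pol_al: "pol 0 1 (\<lambda>x y. al x y)"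
| pol_inv_al: "pol 0 (-1) (\<lambda>x y. ial x y)"
| pol_inv_F: "pol 1 (-1) (\<lambda>x y. iF x y)"
| pol_zero: "pol 0 d (\<lambda>x y. 0)"
| pol_plus: "pol k d H \<Longrightarrow> pol k d K \<Longrightarrow> pol k d (\<lambda>x y. H x y + K x y)"
| pol_mult: "pol k d H \<Longrightarrow> pol l e K \<Longrightarrow> pol (k + l) (d + e) (\<lambda>x y. H x y * K x y)"
| pol_le: "pol k d H \<Longrightarrow> k \<le> l \<Longrightarrow> pol l d H"
| pol_cong: "pol k d H \<Longrightarrow> (\<And>x y. x \<in> U \<Longrightarrow> y \<noteq> 0 \<Longrightarrow> H x y = K x y) \<Longrightarrow> pol k d K"

section \<open>Derivatives of the generators and of functions with poles along
  \<open>F = 0\<close>\<close>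

lemma coord_differentiable: "(\<lambda>y. y $ i) differentiable (at (y::real^'n))"
  by (simp add: bounded_linear_imp_differentiable bounded_linear_vec_nth)

lemma A2_diff_x: "x \<in> U \<Longrightarrow> (\<lambda>z. A2 z y) differentiable (at x)"
  unfolding A2_def
  by (intro differentiable_sum differentiable_mult differentiable_const ballI)
     (auto intro: smooth_on_differentiable[OF smooth_a])

lemma A2_diff_y: "A2 x differentiable (at y)"
  unfolding A2_def[abs_def]
  by (intro differentiable_sum differentiable_mult differentiable_const ballI coord_differentiable) auto

lemma be_diff_x: "x \<in> U \<Longrightarrow> (\<lambda>z. be z y) differentiable (at x)"
  unfolding be_def
  by (intro differentiable_sum differentiable_mult differentiable_const ballI)
     (auto intro: smooth_on_differentiable[OF smooth_b])

lemma be_diff_y: "be x differentiable (at y)"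
  unfolding be_def[abs_def]
  by (intro differentiable_sum differentiable_mult differentiable_const ballI coord_differentiable) auto

lemma al_diff:
  assumes "x \<in> U" "y \<noteq> 0"
  shows "(\<lambda>z. al z y) differentiable (at x)" "al x differentiable (at y)"
    and "Dx i al x y = Dx i A2 x y * (1/2) * ial x y"
    and "Dy i al x y = Dy i A2 x y * (1/2) * ial x y"
proof -
  have d: "(sqrt has_field_derivative (1 / (2 * al x y))) (at (A2 x y))"
    using A2_pos[OF assms] by (auto intro!: derivative_eq_intros simp: al_def field_simps)
  have d1: "(sqrt has_field_derivative (1 / (2 * al x y))) (at ((\<lambda>z. A2 z y) x))" using d by simp
  show "(\<lambda>z. al z y) differentiable (at x)" "al x differentiable (at y)"
    "Dx i al x y = Dx i A2 x y * (1/2) * ial x y"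
    "Dy i al x y = Dy i A2 x y * (1/2) * ial x y"
    using partial_chain[OF d A2_diff_y] partial_chain[OF d1 A2_diff_x[OF assms(1)]]
    by (simp_all add: Dx_def Dy_def ial_def al_def[abs_def])
qed

lemma F_diff:
  assumes "x \<in> U" "y \<noteq> 0"
  shows "(\<lambda>z. F z y) differentiable (at x)" "F x differentiable (at y)"
    and "Dx i F x y = Dx i al x y + Dx i be x y"
    and "Dy i F x y = Dy i al x y + Dy i be x y"
  using al_diff[OF assms] be_diff_x[OF assms(1)] be_diff_y[of x y]
  unfolding F_def[abs_def] Dx_def Dy_def
  by (auto simp: partial_add intro!: differentiable_add)

lemma pol_differentiable:
  assumes "pol k d H" "x \<in> U" "y \<noteq> 0"
  shows "(\<lambda>z. H z y) differentiable (at x) \<and> H x differentiable (at y)"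
  using assms
proof (induction rule: pol.induct)
  case (pol_coef f)
  thus ?case by (simp add: smooth_on_differentiable)
next
  case (pol_coord i)
  thus ?case by (simp add: coord_differentiable)
next
  case pol_al
  thus ?case by (simp add: al_diff)
next
  case pol_inv_al
  thus ?case using al_diff al_pos
      by (auto intro!: partial_inverse(2) simp: ial_def[abs_def] less_imp_neq[symmetric])
next
  case pol_inv_F
  thus ?case using F_diff F_pos
      by (auto intro!: partial_inverse(2) simp: iF_def[abs_def] less_imp_neq[symmetric])
next
  case (pol_cong k d H K)
  have "(\<lambda>z. K z y) differentiable (at x)"
    by (rule differentiable_cong_open[of "\<lambda>z. H z y" _ U]) (use pol_cong open_U in auto)
  moreover have "K x differentiable (at y)"
    by (rule differentiable_cong_open[of "H x" _ "- {0}"]) (use pol_cong in auto)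
  ultimately show ?case by blast
qed auto

lemmas pol_diff_x = pol_differentiable[THEN conjunct1]
lemmas pol_diff_y = pol_differentiable[THEN conjunct2]

lemma D_cong:
  assumes "\<And>x y. x \<in> U \<Longrightarrow> y \<noteq> 0 \<Longrightarrow> H x y = K x y" "x \<in> U" "y \<noteq> 0"
  shows Dx_cong: "Dx i H x y = Dx i K x y" and Dy_cong: "Dy i H x y = Dy i K x y"
  unfolding Dx_def Dy_def
  using partial_cong[of U x "\<lambda>z. H z y" "\<lambda>z. K z y"] partial_cong[of "- {0}" y "H x" "K x"] assms open_U
  by auto

lemma D_add:
  assumes "pol k d H" "pol l e K" "x \<in> U" "y \<noteq> 0"
  shows Dx_add: "Dx i (\<lambda>x y. H x y + K x y) x y = Dx i H x y + Dx i K x y"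
    and Dy_add: "Dy i (\<lambda>x y. H x y + K x y) x y = Dy i H x y + Dy i K x y"
  using assms by (auto simp: Dx_def Dy_def pol_diff_x pol_diff_y partial_add)

lemma D_mult:
  assumes "pol k d H" "pol l e K" "x \<in> U" "y \<noteq> 0"
  shows Dx_mult: "Dx i (\<lambda>x y. H x y * K x y) x y = Dx i H x y * K x y + H x y * Dx i K x y"
    and Dy_mult: "Dy i (\<lambda>x y. H x y * K x y) x y = Dy i H x y * K x y + H x y * Dy i K x y"
  using assms by (auto simp: Dx_def Dy_def pol_diff_x pol_diff_y partial_mult)

lemma D_inv_al:
  assumes "x \<in> U" "y \<noteq> 0"
  shows Dx_inv_al: "Dx i (\<lambda>x y. ial x y) x y = Dx i al x y * (-1) * ial x y * ial x y"
    and Dy_inv_al: "Dy i (\<lambda>x y. ial x y) x y = Dy i al x y * (-1) * ial x y * ial x y"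
  using assms al_diff[OF assms] al_pos[OF assms]
  by (simp_all add: ial_def[abs_def] Dx_def Dy_def partial_inverse power2_eq_square)

lemma D_inv_F:
  assumes "x \<in> U" "y \<noteq> 0"
  shows Dx_inv_F: "Dx i (\<lambda>x y. iF x y) x y = Dx i F x y * (-1) * iF x y * iF x y"
    and Dy_inv_F: "Dy i (\<lambda>x y. iF x y) x y = Dy i F x y * (-1) * iF x y * iF x y"
  using assms F_diff[OF assms] F_pos[OF assms]
  by (simp_all add: iF_def[abs_def] Dx_def Dy_def partial_inverse power2_eq_square)

lemma Dx_coef: "Dx i (\<lambda>x y. f x) x y = partial i f x" and Dy_coef: "Dy i (\<lambda>x y. f x) x y = 0"
  by (simp_all add: Dx_def Dy_def)

lemma Dx_coord: "Dx i (\<lambda>x y. y $ j) x y = 0" and Dy_coord: "Dy i (\<lambda>x y. y $ j) x y = of_bool (i = j)"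
  by (simp_all add: Dx_def Dy_def partial_coord)

lemma pol_const: "pol 0 0 (\<lambda>x y. c)"
  by (rule pol_coef) (simp add: smooth_on_const open_U)

lemma pol_add: "pol k d H \<Longrightarrow> pol l e K \<Longrightarrow> d = e \<Longrightarrow> pol (max k l) d (\<lambda>x y. H x y + K x y)"
  by (rule pol_plus; rule pol_le) auto

lemma pol_cmult: "pol k d H \<Longrightarrow> pol k d (\<lambda>x y. c * H x y)"
  using pol_mult[OF pol_const] by simp

lemma pol_minus: "pol k d H \<Longrightarrow> pol k d (\<lambda>x y. - H x y)"
  using pol_cmult[of k d H "-1"] by simp

lemma pol_diff: "pol k d H \<Longrightarrow> pol l e K \<Longrightarrow> d = e \<Longrightarrow> pol (max k l) d (\<lambda>x y. H x y - K x y)"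
  using pol_add[of k d H l e "\<lambda>x y. - K x y"] pol_minus by simp

lemma pol_sum:
  "(\<And>j. j \<in> J \<Longrightarrow> pol k d (H j)) \<Longrightarrow> pol k d (\<lambda>x y. \<Sum>j\<in>J. H j x y)"
  by (induction J rule: infinite_finite_induct) (auto intro: pol_le[OF pol_zero] pol_plus)

lemma pol_deg: "pol k d H \<Longrightarrow> k \<le> l \<Longrightarrow> d = e \<Longrightarrow> pol l e H"
  using pol_le by blast

lemma pol_smooth_a: "pol 0 0 (\<lambda>x y. a x $ i $ j)"
  by (rule pol_coef[OF smooth_a])

lemma pol_smooth_b: "pol 0 0 (\<lambda>x y. b x $ i)"
  by (rule pol_coef[OF smooth_b])

lemma pol_be: "pol 0 1 (\<lambda>x y. be x y)"
proof -
  have "pol 0 (0 + 1) (\<lambda>x y. be x y)"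
    unfolding be_def by (intro pol_sum) (use pol_mult[OF pol_smooth_b pol_coord] in simp)
  thus ?thesis by simp
qed

lemma pol_F: "pol 0 1 (\<lambda>x y. F x y)"
  using pol_plus[OF pol_al pol_be] by (simp add: F_def)

lemma D_sum:
  assumes "\<And>j. j \<in> J \<Longrightarrow> pol k d (H j)" "finite J" "x \<in> U" "y \<noteq> 0"
  shows Dx_sum: "Dx i (\<lambda>x y. \<Sum>j\<in>J. H j x y) x y = (\<Sum>j\<in>J. Dx i (H j) x y)"
    and Dy_sum: "Dy i (\<lambda>x y. \<Sum>j\<in>J. H j x y) x y = (\<Sum>j\<in>J. Dy i (H j) x y)"
  using assms
      by (auto simp: Dx_def Dy_def intro!: partial_sum pol_diff_x[OF assms(1)] pol_diff_y[OF assms(1)])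

lemma A2_Dx: "x \<in> U \<Longrightarrow> y \<noteq> 0 \<Longrightarrow>
    Dx m A2 x y = (\<Sum>i\<in>UNIV. \<Sum>j\<in>UNIV. partial m (\<lambda>z. a z $ i $ j) x * y $ i * y $ j)"
  unfolding A2_def[abs_def]
  by (subst Dx_sum[OF pol_sum[OF pol_mult[OF pol_mult[OF pol_smooth_a pol_coord] pol_coord]]]; simp?)
     (subst Dx_sum[OF pol_mult[OF pol_mult[OF pol_smooth_a pol_coord] pol_coord]];
      simp add: Dx_mult[OF pol_mult[OF pol_smooth_a pol_coord] pol_coord] Dx_mult[OF pol_smooth_a pol_coord]
        Dx_coef Dx_coord)

text \<open>No symmetry of \<open>c\<close> is assumed because the array \<open>C\<close> of
  Christoffel type, to which this is applied later, is not symmetric in its last two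
  indices.\<close>

lemma quad_Dy:
  assumes "\<And>i j. smooth_on U (\<lambda>x. c x i j)" "x \<in> U" "y \<noteq> 0"
  shows "Dy m (\<lambda>x y. \<Sum>i\<in>UNIV. \<Sum>j\<in>UNIV. c x i j * y $ i * y $ j) x y
       = (\<Sum>j\<in>UNIV. (c x m j + c x j m) * y $ j)"
proof -
  note p = pol_mult[OF pol_coef[OF assms(1)] pol_coord]
  have "Dy m (\<lambda>x y. \<Sum>i\<in>UNIV. \<Sum>j\<in>UNIV. c x i j * y $ i * y $ j) x y
      = (\<Sum>i\<in>UNIV. \<Sum>j\<in>UNIV. c x i j * of_bool (m = i) * y $ j + c x i j * y $ i * of_bool (m = j))"
    by (subst Dy_sum[OF pol_sum[OF pol_mult[OF p pol_coord]]]; (simp add: assms)?)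
       (subst Dy_sum[OF pol_mult[OF p pol_coord]];
        simp add: Dy_mult[OF p pol_coord] Dy_mult[OF pol_coef[OF assms(1)] pol_coord] Dy_coef Dy_coord assms)
  also have "\<dots> = (\<Sum>i\<in>UNIV. \<Sum>j\<in>UNIV. c x i j * of_bool (m = i) * y $ j) + (\<Sum>i\<in>UNIV. c x i m * y $ i)"
    by (simp add: sum.distrib of_bool_def if_distrib[of "\<lambda>u. _ * u"] cong: if_cong)
  also have "(\<Sum>i\<in>UNIV. \<Sum>j\<in>UNIV. c x i j * of_bool (m = i) * y $ j) = (\<Sum>j\<in>UNIV. c x m j * y $ j)"
    by (subst sum.swap) (simp add: of_bool_def if_distrib if_distribR cong: if_cong)
  finally show ?thesis by (simp add: sum.distrib distrib_right)
qed

lemma lin_Dy: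
  assumes "\<And>i. smooth_on U (\<lambda>x. c x i)" "x \<in> U" "y \<noteq> 0"
  shows "Dy m (\<lambda>x y. \<Sum>i\<in>UNIV. c x i * y $ i) x y = c x m"
  by (subst Dy_sum[OF pol_mult[OF pol_coef[OF assms(1)] pol_coord]])
     (simp_all add: Dy_mult[OF pol_coef[OF assms(1)] pol_coord] assms Dy_coef Dy_coord
       of_bool_def if_distrib[of "\<lambda>u. _ * u"] cong: if_cong)

lemma pol_Dx_A2: "pol 0 2 (Dx m A2)"
proof (rule pol_cong)
  show "pol 0 2 (\<lambda>x y. \<Sum>i\<in>UNIV. \<Sum>j\<in>UNIV. partial m (\<lambda>z. a z $ i $ j) x * y $ i * y $ j)"
    by (intro pol_sum pol_deg[OF pol_mult[OF pol_mult[OF pol_coef[OF smooth_on_partial[OF smooth_a]]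
        pol_coord] pol_coord]])
       simp_all
qed (simp add: A2_Dx)

lemma A2_Dy: "x \<in> U \<Longrightarrow> y \<noteq> 0 \<Longrightarrow> Dy m A2 x y = 2 * (\<Sum>j\<in>UNIV. a x $ m $ j * y $ j)"
  unfolding A2_def[abs_def] by (subst quad_Dy) (auto simp: smooth_a sym_a[of x _ m] sum_distrib_left mult_ac)

lemma pol_Dy_A2: "pol 0 1 (Dy m A2)"
proof (rule pol_cong)
  show "pol 0 1 (\<lambda>x y. 2 * (\<Sum>j\<in>UNIV. a x $ m $ j * y $ j))"
    by (intro pol_cmult pol_sum pol_deg[OF pol_mult[OF pol_smooth_a pol_coord]]) simp_all
qed (simp add: A2_Dy)

lemma be_Dx: "x \<in> U \<Longrightarrow> y \<noteq> 0 \<Longrightarrow> Dx m be x y = (\<Sum>i\<in>UNIV. partial m (\<lambda>z. b z $ i) x * y $ i)"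
  unfolding be_def[abs_def]
  by (subst Dx_sum[OF pol_mult[OF pol_smooth_b pol_coord]])
     (simp_all add: Dx_mult[OF pol_smooth_b pol_coord] Dx_coef Dx_coord)

lemma be_Dy: "x \<in> U \<Longrightarrow> y \<noteq> 0 \<Longrightarrow> Dy m be x y = b x $ m"
  unfolding be_def[abs_def] by (rule lin_Dy) (auto simp: smooth_b)

lemma pol_Dx_be: "pol 0 1 (Dx m be)"
proof (rule pol_cong)
  show "pol 0 1 (\<lambda>x y. \<Sum>i\<in>UNIV. partial m (\<lambda>z. b z $ i) x * y $ i)"
    by (intro pol_sum pol_deg[OF pol_mult[OF pol_coef[OF smooth_on_partial[OF smooth_b]] pol_coord]]) simp_all
qed (simp add: be_Dx)

lemma pol_Dy_be: "pol 0 0 (Dy m be)"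
  by (rule pol_cong[OF pol_smooth_b[of m]]) (simp add: be_Dy)

lemma pol_Dx_al: "pol 0 1 (Dx m al)"
  by (rule pol_cong[OF pol_deg[OF pol_mult[OF pol_mult[OF pol_Dx_A2 pol_const[of "1/2"]] pol_inv_al]]])
     (auto simp: al_diff)

lemma pol_Dy_al: "pol 0 0 (Dy m al)"
  by (rule pol_cong[OF pol_deg[OF pol_mult[OF pol_mult[OF pol_Dy_A2 pol_const[of "1/2"]] pol_inv_al]]])
     (auto simp: al_diff)

lemma pol_Dx_F: "pol 0 1 (Dx m F)"
  by (rule pol_cong[OF pol_add[OF pol_Dx_al pol_Dx_be, simplified]]) (auto simp: F_diff)

lemma pol_Dy_F: "pol 0 0 (Dy m F)"
  by (rule pol_cong[OF pol_add[OF pol_Dy_al pol_Dy_be, simplified]]) (auto simp: F_diff)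

text \<open>The effect of one derivative on the pole order: \<open>1/F^k\<close> goes to order
  \<open>k + 1\<close>, but a function without a pole acquires none. The fixed point 0 is essential,
  since otherwise every derivative of \<open>Rm\<close> would count as a pole.\<close>

definition step :: "nat \<Rightarrow> nat" where "step k = (if k = 0 then 0 else Suc k)"

lemma step_le: "k + step l \<le> step (k + l)" "step k + l \<le> step (k + l)" "k \<le> l \<Longrightarrow> step k \<le> step l"
  by (auto simp: step_def)

text \<open>Poles grow only through the generator \<open>iF\<close>, whose derivative is
  \<open>- F' iF^2\<close>. In each term of the product rule a single factor is differentiated, so
  \<open>step_le\<close> bounds the order of the sum.\<close>

lemma pol_D:
  "pol k d H \<Longrightarrow> pol (step k) d (Dx i H) \<and> pol (step k) (d - 1) (Dy i H)"
proof (induction rule: pol.induct)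
  case (pol_coef f)
  have "pol 0 0 (Dx i (\<lambda>x y. f x))"
    by (rule pol_cong[OF pol.pol_coef[OF smooth_on_partial[OF pol_coef]]]) (auto simp: Dx_coef)
  moreover have "pol 0 (0 - 1) (Dy i (\<lambda>x y. f x))"
    by (rule pol_cong[OF pol_zero]) (auto simp: Dy_coef)
  ultimately show ?case by (simp add: step_def)
next
  case (pol_coord j)
  have "pol 0 1 (Dx i (\<lambda>x y. y $ j))"
    by (rule pol_cong[OF pol_zero]) (auto simp: Dx_coord)
  moreover have "pol 0 0 (Dy i (\<lambda>x y. y $ j))"
    by (rule pol_cong[OF pol_const]) (auto simp: Dy_coord)
  ultimately show ?case by (simp add: step_def)
next
  case pol_al
  show ?case using pol_Dx_al pol_Dy_al by (simp add: step_def)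
next
  case pol_inv_al
  note 1 = pol_mult[OF pol_mult[OF pol_mult[OF _ pol_const[of "-1"]] pol.pol_inv_al] pol.pol_inv_al]
  have "pol 0 (-1) (Dx i (\<lambda>x y. ial x y))"
    by (rule pol_cong[OF pol_deg[OF 1[OF pol_Dx_al]]]) (auto simp: Dx_inv_al)
  moreover have "pol 0 (-2) (Dy i (\<lambda>x y. ial x y))"
    by (rule pol_cong[OF pol_deg[OF 1[OF pol_Dy_al]]]) (auto simp: Dy_inv_al)
  ultimately show ?case by (simp add: step_def)
next
  case pol_inv_F
  note 1 = pol_mult[OF pol_mult[OF pol_mult[OF _ pol_const[of "-1"]] pol.pol_inv_F] pol.pol_inv_F]
  have "pol 2 (-1) (Dx i (\<lambda>x y. iF x y))"
    by (rule pol_cong[OF pol_deg[OF 1[OF pol_Dx_F]]]) (auto simp: Dx_inv_F)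
  moreover have "pol 2 (-2) (Dy i (\<lambda>x y. iF x y))"
    by (rule pol_cong[OF pol_deg[OF 1[OF pol_Dy_F]]]) (auto simp: Dy_inv_F)
  ultimately show ?case by (simp add: step_def eval_nat_numeral)
next
  case (pol_zero d)
  show ?case
    by (auto simp: step_def Dx_coef Dy_coef intro: pol_cong[OF pol.pol_zero])
next
  case (pol_plus k d H K)
  hence "pol (step k) d (\<lambda>x y. Dx i H x y + Dx i K x y)" "pol (step k) (d - 1) (\<lambda>x y. Dy i H x y
      + Dy i K x y)"
    by (auto intro: pol.pol_plus)
  thus ?case using pol_plus.hyps
    by (auto simp: Dx_add Dy_add intro: pol_cong)
next
  case (pol_mult k d H l e K)
  have "pol (step (k + l)) (d + e) (\<lambda>x y. Dx i H x y * K x y + H x y * Dx i K x y)"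
    using pol_mult
        by (intro pol.pol_plus; intro pol_le[OF pol.pol_mult step_le(1)] pol_le[OF pol.pol_mult
        step_le(2)]) auto
  moreover have "pol (step (k + l)) (d + e - 1) (\<lambda>x y. Dy i H x y * K x y + H x y * Dy i K x y)"
    using pol_mult step_le(1)[of k l] step_le(2)[of k l]
    by (intro pol.pol_plus pol_deg[OF pol.pol_mult, of "step k" "d - 1" "Dy i H" l e K]
        pol_deg[OF pol.pol_mult, of k d H "step l" "e - 1" "Dy i K"]) auto
  ultimately show ?case using pol_mult.hyps
    by (auto simp: Dx_mult Dy_mult intro: pol_cong)
next
  case (pol_le k d H l)
  thus ?case using step_le(3) by (auto intro: pol.pol_le)
next
  case (pol_cong k d H K)
  thus ?case using D_cong[of H K] by (auto intro: pol.pol_cong)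
qed

lemma pol0_Dx: "pol 0 d H \<Longrightarrow> pol 0 d (Dx i H)" and pol0_Dy: "pol 0 d H \<Longrightarrow> pol 0 (d - 1) (Dy i H)"
  using pol_D[of 0 d H i] by (auto simp: step_def)

lemma pol_Dx: "pol k d H \<Longrightarrow> pol (Suc k) d (Dx i H)" and pol_Dy: "pol k d H \<Longrightarrow> pol (Suc k) (d - 1) (Dy i H)"
  using pol_D[of k d H i] by (auto simp: step_def split: if_splits intro: pol_le)

section \<open>Euler's relation for homogeneous functions\<close>

lemma euler_A2: "x \<in> U \<Longrightarrow> y \<noteq> 0 \<Longrightarrow> (\<Sum>i\<in>UNIV. y $ i * Dy i A2 x y) = 2 * A2 x y"
  by (simp add: A2_Dy) (simp add: A2_def sum_distrib_left mult_ac)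

lemma euler_be: "x \<in> U \<Longrightarrow> y \<noteq> 0 \<Longrightarrow> (\<Sum>i\<in>UNIV. y $ i * Dy i be x y) = be x y"
  by (simp add: be_Dy) (simp add: be_def mult_ac)

lemma euler_al:
  assumes "x \<in> U" "y \<noteq> 0"
  shows "(\<Sum>i\<in>UNIV. y $ i * Dy i al x y) = al x y"
proof -
  have "(\<Sum>i\<in>UNIV. y $ i * Dy i al x y) = (\<Sum>i\<in>UNIV. y $ i * Dy i A2 x y) * (1/2) * ial x y"
    using assms by (simp add: al_diff sum_distrib_left mult_ac sum_divide_distrib)
  also have "\<dots> = al x y"
    using assms al_ial[OF assms] by (simp add: euler_A2 al_sq[symmetric] power2_eq_square mult.assoc)
  finally show ?thesis .
qed

lemma euler_F: "x \<in> U \<Longrightarrow> y \<noteq> 0 \<Longrightarrow> (\<Sum>i\<in>UNIV. y $ i * Dy i F x y) = F x y"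
  by (simp add: F_diff distrib_left sum.distrib euler_al euler_be) (simp add: F_def)

text \<open>This is what the degree index of \<open>pol\<close> is for: it is additive in products,
  and the relation only has to be checked on the generators.\<close>

lemma euler:
  assumes "pol k d H" "x \<in> U" "y \<noteq> 0"
  shows "(\<Sum>i\<in>UNIV. y $ i * Dy i H x y) = of_int d * H x y"
  using assms
proof (induction rule: pol.induct)
  case (pol_coord j)
  thus ?case by (simp add: Dy_coord of_bool_def if_distrib[of "\<lambda>u. _ * u"] cong: if_cong)
next
  case pol_al
  thus ?case by (simp add: euler_al)
next
  case pol_inv_al
  have "(\<Sum>i\<in>UNIV. y $ i * Dy i (\<lambda>x y. ial x y) x y)
      = (\<Sum>i\<in>UNIV. y $ i * Dy i al x y) * (-1) * ial x y * ial x y"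
    by (simp only: Dy_inv_al[OF pol_inv_al] sum_distrib_right mult.assoc)
  thus ?case using pol_inv_al by (simp add: euler_al al_ial)
next
  case pol_inv_F
  have "(\<Sum>i\<in>UNIV. y $ i * Dy i (\<lambda>x y. iF x y) x y)
      = (\<Sum>i\<in>UNIV. y $ i * Dy i F x y) * (-1) * iF x y * iF x y"
    by (simp only: Dy_inv_F[OF pol_inv_F] sum_distrib_right mult.assoc)
  thus ?case using pol_inv_F by (simp add: euler_F F_iF)
next
  case (pol_plus k d H K)
  thus ?case by (simp add: Dy_add[OF pol_plus.hyps] distrib_left sum.distrib)
next
  case (pol_mult k d H l e K)
  have "(\<Sum>i\<in>UNIV. y $ i * Dy i (\<lambda>x y. H x y * K x y) x y) =
      (\<Sum>i\<in>UNIV. y $ i * Dy i H x y) * K x y + H x y * (\<Sum>i\<in>UNIV. y $ i * Dy i K x y)"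
    using pol_mult.prems
    by (simp add: Dy_mult[OF pol_mult.hyps] distrib_left sum.distrib sum_distrib_left sum_distrib_right
        mult_ac)
  thus ?case using pol_mult by (simp add: algebra_simps)
next
  case (pol_cong k d H K)
  have "Dy i K x y = Dy i H x y" for i
    by (rule Dy_cong[symmetric]) (use pol_cong in auto)
  thus ?case using pol_cong by simp
qed (simp_all add: Dy_coef)

text \<open>Here the sum runs over the index of the inner derivative. Differentiating Euler's
  relation gives this directly, so that second derivatives in \<open>y\<close> need not be
  interchanged.\<close>

lemma euler_Dy:
  assumes "pol k d H" "x \<in> U" "y \<noteq> 0"
  shows "(\<Sum>i\<in>UNIV. y $ i * Dy j (Dy i H) x y) = of_int (d - 1) * Dy j H x y"
proof -
  have "Dy j (\<lambda>x y. \<Sum>i\<in>UNIV. y $ i * Dy i H x y) x y = Dy j (\<lambda>x y. of_int d * H x y) x y"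
    by (rule Dy_cong) (use euler assms in auto)
  also have "\<dots> = of_int d * Dy j H x y"
    using Dy_mult[OF pol_const assms(1) assms(2,3)] by (simp add: Dy_coef)
  finally have "of_int d * Dy j H x y = (\<Sum>i\<in>UNIV. of_bool (j = i) * Dy i H x y + y $ i * Dy j (Dy i H) x y)"
    by (subst (asm) Dy_sum[OF pol_mult[OF pol_coord pol_Dy[OF assms(1)]]])
       (simp_all add: assms Dy_mult[OF pol_coord pol_Dy[OF assms(1)]] Dy_coord)
  thus ?thesis
    by (simp add: sum.distrib of_bool_def if_distribR if_distrib[of "\<lambda>u. _ * u"] algebra_simps cong: if_cong)
qed

end

text \<open>One entry of the product of the fundamental tensor with its claimed inverse, after its
  rows have been contracted with \<open>a^{-1}\<close>, \<open>b^k\<close> and \<open>y^k\<close>.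
  With \<open>I\<close> and \<open>J\<close> for \<open>1/\<alpha>\<close> and \<open>1/F\<close> it
  is a polynomial consequence of the three assumptions.\<close>

lemma inverse_metric_identity:
  fixes A I J F \<beta> b2 Y b y V \<delta> :: real
  assumes AI: "A * I = 1" and FJ: "F * J = 1" and F: "F = A + \<beta>"
  shows "A * J * (F * (I * \<delta> - Y * I ^ 3 * y) + (Y * I + b) * (y * I + V))
    - A * J ^ 2 * (y * (F * (I * b - Y * I ^ 3 * \<beta>) + (Y * I + b) * (\<beta> * I + b2)) + V * ((Y * I + b) * F))
    + (b2 * A + \<beta>) * J ^ 3 * y * ((Y * I + b) * F) = \<delta>"
  using assms by algebra

section \<open>The fundamental tensor of a Randers metric and its inverse\<close>

context randers_chart begin

definition ai :: "real^'n \<Rightarrow> real^'n^'n" where "ai x = matrix_inv (a x)"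

definition da :: "'n \<Rightarrow> real^'n \<Rightarrow> 'n \<Rightarrow> 'n \<Rightarrow> real" where
  "da m x i j = partial m (\<lambda>z. a z $ i $ j) x"

definition db :: "'n \<Rightarrow> real^'n \<Rightarrow> 'n \<Rightarrow> real" where
  "db m x i = partial m (\<lambda>z. b z $ i) x"

text \<open>Raising an index with the metric \<open>a\<close>. In index notation \<open>V\<close> is
  \<open>b^k\<close>, \<open>b2\<close> is the squared norm of \<open>\<beta>\<close>,
  \<open>Y i\<close> is the lowered \<open>y_i\<close>, and \<open>f i\<close> is the derivative of
  \<open>F\<close> by \<open>y^i\<close>.\<close>

definition up :: "real^'n \<Rightarrow> ('n \<Rightarrow> real) \<Rightarrow> 'n \<Rightarrow> real" where
  "up x c k = (\<Sum>l\<in>UNIV. ai x $ k $ l * c l)"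

definition V :: "real^'n \<Rightarrow> 'n \<Rightarrow> real" where "V x = up x (\<lambda>l. b x $ l)"

definition b2 :: "real^'n \<Rightarrow> real" where "b2 x = (\<Sum>k\<in>UNIV. b x $ k * V x k)"

definition Y :: "'n \<Rightarrow> 'n local_fun" where "Y i x y = (\<Sum>j\<in>UNIV. a x $ i $ j * y $ j)"

definition f :: "'n \<Rightarrow> 'n local_fun" where "f i x y = Y i x y * ial x y + b x $ i"

lemma invertible_a: "x \<in> U \<Longrightarrow> invertible (a x)"
  unfolding invertible_left_inverse matrix_left_invertible_ker
proof (intro allI impI)
  fix y assume x: "x \<in> U" and "a x *v y = 0"
  hence "(\<Sum>j\<in>UNIV. a x $ i $ j * y $ j) = 0" for i
    by (simp add: vec_eq_iff matrix_vector_mult_def)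
  hence "A2 x y = 0"
    unfolding A2_def by (simp add: mult.assoc mult.left_commute[of _ "y $ _"] flip: sum_distrib_left)
  thus "y = 0" using A2_pos[OF x, of y] by fastforce
qed

lemma ai_right: "x \<in> U \<Longrightarrow> (\<Sum>k\<in>UNIV. a x $ i $ k * ai x $ k $ j) = of_bool (i = j)"
  using invertible_matrix_inv(1)[OF invertible_a, of x]
  by (simp add: ai_def matrix_matrix_mult_def vec_eq_iff mat_def of_bool_def)

lemma ai_sym: assumes "x \<in> U" shows "ai x $ i $ j = ai x $ j $ i"
proof -
  have "transpose (a x) = a x"
    by (simp add: transpose_def vec_eq_iff sym_a[OF assms])
  hence "transpose (ai x) ** a x = mat 1"
    using arg_cong[OF invertible_matrix_inv(1)[OF invertible_a[OF assms]], of transpose]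
    by (simp add: matrix_transpose_mul ai_def transpose_mat)
  hence "ai x = transpose (ai x)"
    unfolding ai_def using matrix_inv_eq[of "a x"] matrix_left_right_inverse by blast
  from arg_cong[OF this, of "\<lambda>M. M $ i $ j"] show ?thesis by (simp add: transpose_def)
qed

lemma ai_left: "x \<in> U \<Longrightarrow> (\<Sum>k\<in>UNIV. ai x $ i $ k * a x $ k $ j) = of_bool (i = j)"
  using invertible_matrix_inv(2)[OF invertible_a, of x]
  by (simp add: ai_def matrix_matrix_mult_def vec_eq_iff mat_def of_bool_def)

lemma a_up: assumes "x \<in> U" shows "(\<Sum>k\<in>UNIV. a x $ l $ k * up x c k) = c l"
proof -
  have "(\<Sum>k\<in>UNIV. a x $ l $ k * up x c k) = (\<Sum>m\<in>UNIV. (\<Sum>k\<in>UNIV. a x $ l $ k * ai x $ k $ m) * c m)"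
    unfolding up_def by (simp add: sum_distrib_left sum_distrib_right mult_ac) (rule sum.swap)
  thus ?thesis using assms by (simp add: ai_right sum_of_bool)
qed

lemma up_pair: assumes "x \<in> U" shows "(\<Sum>k\<in>UNIV. e k * up x c k) = (\<Sum>k\<in>UNIV. up x e k * c k)"
  unfolding up_def
  by (simp add: sum_distrib_left sum_distrib_right mult_ac) 
     (subst sum.swap, simp add: ai_sym[OF assms, of _ "_"] cong: sum.cong_simp)

lemma up_Y: assumes "x \<in> U" shows "up x (\<lambda>l. Y l x y) k = y $ k"
proof -
  have "up x (\<lambda>l. Y l x y) k = (\<Sum>m\<in>UNIV. (\<Sum>l\<in>UNIV. ai x $ k $ l * a x $ l $ m) * y $ m)"
    unfolding up_def Y_def by (simp add: sum_distrib_left sum_distrib_right mult_ac) (rule sum.swap)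
  thus ?thesis using assms by (simp add: ai_left sum_of_bool)
qed

lemma Y_up: "x \<in> U \<Longrightarrow> (\<Sum>k\<in>UNIV. Y k x y * up x c k) = (\<Sum>k\<in>UNIV. y $ k * c k)"
  by (simp add: up_pair up_Y)

lemma b_up: "x \<in> U \<Longrightarrow> (\<Sum>k\<in>UNIV. b x $ k * up x c k) = (\<Sum>k\<in>UNIV. V x k * c k)"
  by (simp add: up_pair V_def)

lemma Y_y: "(\<Sum>k\<in>UNIV. Y k x y * y $ k) = A2 x y"
  unfolding Y_def A2_def by (simp add: sum_distrib_left sum_distrib_right mult_ac)

lemma b_y: "(\<Sum>k\<in>UNIV. b x $ k * y $ k) = be x y"
  by (simp add: be_def)

lemma V_Y: "x \<in> U \<Longrightarrow> (\<Sum>k\<in>UNIV. Y k x y * V x k) = be x y"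
  unfolding V_def by (simp add: Y_up be_def mult.commute)

lemma smooth_ai: "smooth_on U (\<lambda>x. ai x $ i $ j)"
  unfolding ai_def using smooth_a open_U invertible_a by (rule smooth_on_matrix_inv)

lemma smooth_up: "(\<And>l. smooth_on U (\<lambda>x. c x l)) \<Longrightarrow> smooth_on U (\<lambda>x. up x (c x) k)"
  unfolding up_def by (intro smooth_on_sum smooth_on_mult smooth_ai open_U)

lemma smooth_V: "smooth_on U (\<lambda>x. V x k)"
  unfolding V_def by (intro smooth_up smooth_b)

lemma smooth_b2: "smooth_on U b2"
  unfolding b2_def[abs_def] by (intro smooth_on_sum smooth_on_mult smooth_b smooth_V open_U)

lemma smooth_da: "smooth_on U (\<lambda>x. da m x i j)"
  unfolding da_def by (intro smooth_on_partial smooth_a)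

lemma smooth_db: "smooth_on U (\<lambda>x. db m x i)"
  unfolding db_def by (intro smooth_on_partial smooth_b)

lemma da_sym: "x \<in> U \<Longrightarrow> da m x i j = da m x j i"
  unfolding da_def by (rule partial_cong[OF open_U]) (auto simp: sym_a)

lemma pol_lin: "(\<And>i. smooth_on U (\<lambda>x. c x i)) \<Longrightarrow> pol 0 1 (\<lambda>x y. \<Sum>i\<in>UNIV. c x i * y $ i)"
  by (intro pol_sum pol_deg[OF pol_mult[OF pol_coef pol_coord]]) simp_all

lemma pol_quad: "(\<And>i j. smooth_on U (\<lambda>x. c x i j)) \<Longrightarrow>
    pol 0 2 (\<lambda>x y. \<Sum>i\<in>UNIV. \<Sum>j\<in>UNIV. c x i j * y $ i * y $ j)"
  by (intro pol_sum pol_deg[OF pol_mult[OF pol_mult[OF pol_coef pol_coord] pol_coord]]) simp_all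

lemma pol_Y: "pol 0 1 (\<lambda>x y. Y i x y)"
  unfolding Y_def by (intro pol_lin smooth_a)

lemma pol_f: "pol 0 0 (\<lambda>x y. f i x y)"
  unfolding f_def using pol_add[OF pol_mult[OF pol_Y pol_inv_al] pol_smooth_b] by simp

lemma Dy_Y: "x \<in> U \<Longrightarrow> y \<noteq> 0 \<Longrightarrow> Dy j (Y i) x y = a x $ i $ j"
  unfolding Y_def[abs_def] by (intro lin_Dy) (auto simp: smooth_a)

lemma Dy_al: "x \<in> U \<Longrightarrow> y \<noteq> 0 \<Longrightarrow> Dy i al x y = Y i x y * ial x y"
  by (simp add: al_diff A2_Dy Y_def)

lemma Dy_F: "x \<in> U \<Longrightarrow> y \<noteq> 0 \<Longrightarrow> Dy i F x y = f i x y"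
  by (simp add: F_diff Dy_al be_Dy f_def)

lemma Dy_f:
  assumes "x \<in> U" "y \<noteq> 0"
  shows "Dy j (f i) x y = a x $ i $ j * ial x y - Y i x y * Y j x y * ial x y ^ 3"
  unfolding f_def[abs_def] using assms
  by (simp add: Dy_add[OF pol_mult[OF pol_Y pol_inv_al] pol_smooth_b] Dy_mult[OF pol_Y pol_inv_al]
      Dy_coef Dy_Y Dy_inv_al Dy_al power3_eq_cube)

lemma fund_tensor_eq:
  assumes L: "\<forall>x\<in>U. \<forall>y. L x y = F x y" and xy: "x \<in> U" "y \<noteq> 0"
  shows "fund_tensor L x y $ i $ j =
    F x y * (a x $ i $ j * ial x y - Y i x y * Y j x y * ial x y ^ 3) + f i x y * f j x y"
proof -
  have 1: "Dy i (sq L) x y = 2 * (F x y * f i x y)" if "x \<in> U" "y \<noteq> 0" for x y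
  proof -
    have "Dy i (sq L) x y = Dy i (\<lambda>x y. F x y * F x y) x y"
      by (rule Dy_cong) (auto simp: that L sq_def power2_eq_square)
    thus ?thesis using that by (simp add: Dy_mult[OF pol_F pol_F] Dy_F)
  qed
  have "Dy j (Dy i (sq L)) x y = Dy j (\<lambda>x y. 2 * (F x y * f i x y)) x y"
    by (rule Dy_cong) (use 1 xy in auto)
  also have "\<dots> = 2 * (F x y * Dy j (f i) x y + f i x y * f j x y)"
    using xy by (simp add: Dy_mult[OF pol_const pol_mult[OF pol_F pol_f]] Dy_mult[OF pol_F pol_f] Dy_F
        Dy_coef)
  finally show ?thesis using xy by (simp add: fund_tensor_def Dy_f)
qed

text \<open>The fundamental tensor is \<open>(F/\<alpha>) a\<close> plus products of
  \<open>Y\<close> and \<open>b\<close>, so a row sees a vector \<open>w\<close> only through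
  \<open>a w\<close>, \<open>Y w\<close> and \<open>b w\<close>. This serves twice: for the inverse
  matrix, and for the spray with \<open>w = G\<close>.\<close>

lemma g_row:
  assumes L: "\<forall>x\<in>U. \<forall>y. L x y = F x y" and xy: "x \<in> U" "y \<noteq> 0"
  shows "(\<Sum>j\<in>UNIV. fund_tensor L x y $ i $ j * w j) =
    F x y * (ial x y * (\<Sum>j\<in>UNIV. a x $ i $ j * w j)
      - Y i x y * ial x y ^ 3 * (\<Sum>j\<in>UNIV. Y j x y * w j))
    + f i x y * ((\<Sum>j\<in>UNIV. Y j x y * w j) * ial x y + (\<Sum>j\<in>UNIV. b x $ j * w j))"
proof -
  have "fund_tensor L x y $ i $ j * w j = F x y * ial x y * (a x $ i $ j * w j)
      - F x y * Y i x y * ial x y ^ 3 * (Y j x y * w j)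
      + f i x y * ial x y * (Y j x y * w j) + f i x y * (b x $ j * w j)" for j
    unfolding fund_tensor_eq[of L, OF assms] f_def[of j] by (simp add: algebra_simps)
  thus ?thesis
    by (simp add: sum.distrib sum_subtractf flip: sum_distrib_left) (simp add: algebra_simps)
qed

text \<open>The classical inverse of a Randers fundamental tensor. The perturbation of
  \<open>(F/\<alpha>) a\<close> is spanned by the covectors \<open>Y\<close> and \<open>b\<close>,
  hence that of the inverse by the raised vectors \<open>y\<close> and \<open>V\<close>.\<close>

definition gi :: "'n \<Rightarrow> 'n \<Rightarrow> 'n local_fun" where
  "gi j k x y = al x y * iF x y * ai x $ j $ k
     - al x y * iF x y ^ 2 * (V x j * y $ k + y $ j * V x k)
     + (b2 x * al x y + be x y) * iF x y ^ 3 * y $ j * y $ k"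

lemma g_gi:
  assumes L: "\<forall>x\<in>U. \<forall>y. L x y = F x y" and xy: "x \<in> U" "y \<noteq> 0"
  shows "fund_tensor L x y ** (\<chi> j k. gi j k x y) = mat 1"
proof -
  note S = g_row[of L, OF assms]
  let ?g = "fund_tensor L x y"
  have al: "al x y \<noteq> 0" and F: "F x y \<noteq> 0" using al_pos[OF xy] F_pos[OF xy] by auto
  have aik: "ai x $ j $ k = up x (\<lambda>l. of_bool (l = k)) j" for j k
    by (simp add: up_def sum_of_bool)
  have 1: "(\<Sum>j\<in>UNIV. ?g $ i $ j * ai x $ j $ k) =
    F x y * (ial x y * of_bool (i = k) - Y i x y * ial x y ^ 3 * y $ k)
      + f i x y * (y $ k * ial x y + V x k)" for i k
    unfolding S aik by (simp add: a_up Y_up b_up xy(1) sum_of_bool)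
  have 2: "(\<Sum>j\<in>UNIV. ?g $ i $ j * V x j) =
    F x y * (ial x y * b x $ i - Y i x y * ial x y ^ 3 * be x y)
      + f i x y * (be x y * ial x y + b2 x)" for i
    unfolding S using xy(1) a_up[OF xy(1), of i "\<lambda>l. b x $ l"] by (simp add: V_Y flip: V_def b2_def)
  have 3: "(\<Sum>j\<in>UNIV. ?g $ i $ j * y $ j) = f i x y * F x y" for i
    unfolding S Y_y b_y using al
    by (simp add: ial_def
        flip: Y_def al_sq[OF xy(1)]) (simp add: F_def field_simps power2_eq_square power3_eq_cube)
  have "(\<Sum>j\<in>UNIV. ?g $ i $ j * gi j k x y) = of_bool (i = k)" for i k
  proof -
    have "(\<Sum>j\<in>UNIV. ?g $ i $ j * gi j k x y) =
      al x y * iF x y * (\<Sum>j\<in>UNIV. ?g $ i $ j * ai x $ j $ k)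
      - al x y * iF x y ^ 2 * (y $ k * (\<Sum>j\<in>UNIV. ?g $ i $ j * V x j) + V x k * (\<Sum>j\<in>UNIV. ?g $ i $ j * y $ j))
      + (b2 x * al x y + be x y) * iF x y ^ 3 * y $ k * (\<Sum>j\<in>UNIV. ?g $ i $ j * y $ j)"
      unfolding gi_def
          by (simp add: sum_distrib_left sum_distrib_right algebra_simps sum.distrib sum_subtractf)
    also have "\<dots> = of_bool (i = k)"
      unfolding 1 2 3 f_def by (rule inverse_metric_identity[OF al_ial[OF xy] F_iF[OF xy] F_def])
    finally show ?thesis .
  qed
  thus ?thesis
    by (simp add: matrix_matrix_mult_def vec_eq_iff mat_def)
qed

lemma fund_inv_eq:
  assumes L: "\<forall>x\<in>U. \<forall>y. L x y = F x y" and xy: "x \<in> U" "y \<noteq> 0"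
  shows "fund_inv L x y $ j $ k = gi j k x y"
  unfolding fund_inv_def matrix_inv_eq[OF g_gi[OF assms]] by simp

lemma fund_inv_apply:
  assumes L: "\<forall>x\<in>U. \<forall>y. L x y = F x y" and xy: "x \<in> U" "y \<noteq> 0"
  shows "(\<Sum>l\<in>UNIV. fund_inv L x y $ k $ l * (\<Sum>m\<in>UNIV. fund_tensor L x y $ l $ m * w m)) = w k"
proof -
  have "fund_inv L x y ** fund_tensor L x y = mat 1"
    unfolding fund_inv_def matrix_inv_eq[OF g_gi[OF assms]]
    using g_gi[OF assms] matrix_left_right_inverse by blast
  hence "fund_inv L x y *v (fund_tensor L x y *v (\<chi> m. w m)) = (\<chi> m. w m)"
    by (simp add: matrix_vector_mul_assoc)
  thus ?thesis by (simp add: matrix_vector_mult_def vec_eq_iff)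
qed

end

text \<open>The equation \<open>[F^2]_{x^m y^l} y^m - [F^2]_{x^l} = 4 g_{lk} G^k\<close> with its
  sums abbreviated: \<open>T0\<close> and \<open>B0\<close> are the derivatives of
  \<open>\<alpha>^2\<close> and \<open>\<beta>\<close> along \<open>y\<close>, \<open>E\<close> is
  half of \<open>e_00\<close>, and \<open>E * J\<close> is \<open>P0\<close>. The known spray of a
  Randers metric is thus verified rather than derived.\<close>

lemma spray_identity:
  fixes A :: real
  assumes "A * I = 1" "F * J = 1" "F = A + \<beta>" "2 * E = B0 - 2 * \<kappa> + 2 * \<beta> * s0" "f = Y * I + b"
    "cl = 2 * W - T" "2 * sl = db0 - B"
  shows "2 * f * (T0 * I / 2 + B0) + 2 * F * (W * I - T0 * Y * I ^ 3 / 2 + db0) - 2 * F * (T * (1/2) * I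
      + B) =
    4 * (F * (I * ((E * J) * Y + cl / 4 - s0 * Y + A * sl)
         - Y * I ^ 3 * ((E * J) * A ^ 2 + T0 / 4 - s0 * A ^ 2))
       + f * (((E * J) * A ^ 2 + T0 / 4 - s0 * A ^ 2) * I + ((E * J) * \<beta> + \<kappa> - s0 * \<beta> + A * s0)))"
  using assms by algebra

lemma antisym_sum:
  fixes c :: "'k::finite \<Rightarrow> 'k \<Rightarrow> real"
  assumes "\<And>i j. c i j = - c j i"
  shows "(\<Sum>i\<in>UNIV. \<Sum>j\<in>UNIV. c i j) = 0"
proof -
  have "(\<Sum>i\<in>UNIV. \<Sum>j\<in>UNIV. c i j) = (\<Sum>j\<in>UNIV. \<Sum>i\<in>UNIV. c i j)" by (rule sum.swap)
  also have "\<dots> = - (\<Sum>j\<in>UNIV. \<Sum>i\<in>UNIV. c j i)"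
    unfolding sum_negf[symmetric] by (intro sum.cong refl assms)
  finally show ?thesis by simp
qed

section \<open>The geodesic coefficients\<close>

context randers_chart begin

text \<open>Contracted with \<open>y^i y^j\<close> this is twice the Christoffel symbol of the first
  kind. As only that contraction counts, the two terms in which \<open>a\<close> carries the index
  \<open>l\<close> are merged into one.\<close>

definition C :: "'n \<Rightarrow> real^'n \<Rightarrow> 'n \<Rightarrow> 'n \<Rightarrow> real" where
  "C l x i j = 2 * da j x l i - da l x i j"

definition cal :: "'n \<Rightarrow> 'n local_fun" where
  "cal l x y = (\<Sum>i\<in>UNIV. \<Sum>j\<in>UNIV. C l x i j * y $ i * y $ j)"

text \<open>
  In the usual notation, \<open>Ga k\<close> are the geodesic coefficients of \<open>\<alpha>\<close>, while \<open>sl l\<close>, \<open>sig k\<close>, \<open>s0\<close>, \<open>ee\<close>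
  are \<open>s\<^sub>l\<^sub>0\<close>, \<open>s\<^sup>k\<^sub>0\<close>, \<open>s\<^sub>0\<close> and \<open>e\<^sub>0\<^sub>0 = r\<^sub>0\<^sub>0 + 2 \<beta> s\<^sub>0\<close>.
\<close>

definition Ga :: "'n \<Rightarrow> 'n local_fun" where
  "Ga k x y = 1/4 * up x (\<lambda>l. cal l x y) k"

definition sl :: "'n \<Rightarrow> 'n local_fun" where
  "sl l x y = (\<Sum>m\<in>UNIV. ((db m x l - db l x m) / 2) * y $ m)"

definition sig :: "'n \<Rightarrow> 'n local_fun" where
  "sig k x y = up x (\<lambda>l. sl l x y) k"

definition s0 :: "'n local_fun" where
  "s0 x y = (\<Sum>k\<in>UNIV. V x k * sl k x y)"

text \<open>Unsymmetrized components of \<open>e_00\<close>: the first two terms are the covariant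
  derivative of \<open>\<beta>\<close>, the last one is \<open>2 b_i s_j\<close>. An explicit
  coefficient array makes \<open>e_00\<close> visibly a quadratic form, to be restricted to lines
  and polarized later.\<close>

definition EE :: "real^'n \<Rightarrow> 'n \<Rightarrow> 'n \<Rightarrow> real" where
  "EE x i j = db j x i - 1/2 * (\<Sum>k\<in>UNIV. V x k * C k x i j)
     + b x $ i * (\<Sum>k\<in>UNIV. V x k * (db j x k - db k x j))"

definition ee :: "'n local_fun" where
  "ee x y = (\<Sum>i\<in>UNIV. \<Sum>j\<in>UNIV. EE x i j * y $ i * y $ j)"

definition P0 :: "'n local_fun" where
  "P0 x y = 1/2 * ee x y * iF x y"

definition Rm :: "'n \<Rightarrow> 'n local_fun" where
  "Rm k x y = Ga k x y - s0 x y * y $ k + al x y * sig k x y"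

definition G :: "'n \<Rightarrow> 'n local_fun" where
  "G k x y = P0 x y * y $ k + Rm k x y"

lemma ee_eq: "ee x y = (\<Sum>i\<in>UNIV. \<Sum>j\<in>UNIV. db j x i * y $ i * y $ j)
    - 1/2 * (\<Sum>k\<in>UNIV. V x k * cal k x y) + 2 * be x y * s0 x y"
proof -
  have 1: "(\<Sum>k\<in>UNIV. V x k * cal k x y) = (\<Sum>i\<in>UNIV. \<Sum>j\<in>UNIV. (\<Sum>k\<in>UNIV. V x k * C k x i j) * y $ i * y $ j)"
    unfolding cal_def
    by (simp add: sum_distrib_left sum_distrib_right mult_ac) (subst sum.swap, rule sum.cong[OF refl],
        rule sum.swap)
  have 2: "2 * s0 x y = (\<Sum>j\<in>UNIV. (\<Sum>k\<in>UNIV. V x k * (db j x k - db k x j)) * y $ j)"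
    unfolding s0_def sl_def
    by (simp add: sum_distrib_left sum_distrib_right mult_ac) (rule sum.swap)
  have "2 * be x y * s0 x y = be x y * (2 * s0 x y)" by simp
  also have "\<dots> = (\<Sum>i\<in>UNIV. \<Sum>j\<in>UNIV. b x $ i * (\<Sum>k\<in>UNIV. V x k * (db j x k - db k x j)) * y $ i * y $ j)"
    unfolding 2 be_def sum_product by (intro sum.cong refl) (simp add: mult_ac)
  finally have 3: "2 * be x y * s0 x y = \<dots>" .
  have "EE x i j * y $ i * y $ j = db j x i * y $ i * y $ j
      - 1/2 * ((\<Sum>k\<in>UNIV. V x k * C k x i j) * y $ i * y $ j)
      + b x $ i * (\<Sum>k\<in>UNIV. V x k * (db j x k - db k x j)) * y $ i * y $ j" for i j
    unfolding EE_def by (simp add: algebra_simps)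
  thus ?thesis unfolding 1 3 ee_def
    by (simp only: sum.distrib sum_subtractf flip: sum_distrib_left)
qed

lemma Dx_F: "x \<in> U \<Longrightarrow> y \<noteq> 0 \<Longrightarrow> Dx m F x y = Dx m A2 x y * (1/2) * ial x y + (\<Sum>i\<in>UNIV. db m x i * y $ i)"
  by (simp add: F_diff al_diff be_Dx db_def)

lemma Dy_Dx_F:
  assumes "x \<in> U" "y \<noteq> 0"
  shows "Dy l (Dx m F) x y = (\<Sum>k\<in>UNIV. da m x l k * y $ k) * ial x y
      - Dx m A2 x y * Y l x y * ial x y ^ 3 / 2 + db m x l"
proof -
  note p = pol_mult[OF pol_mult[OF pol_Dx_A2 pol_const[of "1/2"]] pol_inv_al]
  have lin: "pol 0 1 (\<lambda>x y. \<Sum>i\<in>UNIV. db m x i * y $ i)"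
    by (intro pol_lin smooth_db)
  have "Dy l (Dx m A2) x y = Dy l (\<lambda>x y. \<Sum>i\<in>UNIV. \<Sum>j\<in>UNIV. da m x i j * y $ i * y $ j) x y"
    by (rule Dy_cong) (use assms in \<open>auto simp: A2_Dx da_def\<close>)
  also have "\<dots> = 2 * (\<Sum>k\<in>UNIV. da m x l k * y $ k)"
    using assms by (subst quad_Dy) (auto simp: smooth_da da_sym[of x m _ l] sum_distrib_left mult_ac)
  finally have 1: "Dy l (Dx m A2) x y = 2 * (\<Sum>k\<in>UNIV. da m x l k * y $ k)" .
  have "Dy l (Dx m F) x y = Dy l (\<lambda>x y. Dx m A2 x y * (1/2) * ial x y + (\<Sum>i\<in>UNIV. db m x i * y $ i)) x y"
    by (rule Dy_cong) (use assms in \<open>auto simp: Dx_F\<close>)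
  also have "\<dots> = Dy l (Dx m A2) x y * (1/2) * ial x y + Dx m A2 x y * (1/2) * Dy l ial x y + db m x l"
    unfolding Dy_add[OF p lin assms] Dy_mult[OF pol_mult[OF pol_Dx_A2 pol_const] pol_inv_al assms]
        Dy_mult[OF pol_Dx_A2 pol_const assms] Dy_coef lin_Dy[OF smooth_db assms] by simp
  also have "\<dots> = (\<Sum>k\<in>UNIV. da m x l k * y $ k) * ial x y - Dx m A2 x y * Y l x y * ial x y ^ 3 / 2 + db m x l"
    using assms by (simp add: 1 Dy_inv_al Dy_al power3_eq_cube)
  finally show ?thesis .
qed

lemma y_sl: "(\<Sum>l\<in>UNIV. y $ l * sl l x y) = 0"
  unfolding sl_def sum_distrib_left by (rule antisym_sum) (simp add: field_simps)

lemma cal_eq: "cal l x y = 2 * (\<Sum>m\<in>UNIV. y $ m * (\<Sum>k\<in>UNIV. da m x l k * y $ k))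
    - (\<Sum>i\<in>UNIV. \<Sum>j\<in>UNIV. da l x i j * y $ i * y $ j)"
proof -
  have "(\<Sum>i\<in>UNIV. \<Sum>j\<in>UNIV. 2 * da j x l i * y $ i * y $ j)
      = 2 * (\<Sum>m\<in>UNIV. y $ m * (\<Sum>k\<in>UNIV. da m x l k * y $ k))"
    by (subst sum.swap) (simp add: sum_distrib_left mult_ac)
  thus ?thesis unfolding cal_def C_def by (simp add: left_diff_distrib sum_subtractf)
qed

lemma y_cal: "x \<in> U \<Longrightarrow> y \<noteq> 0 \<Longrightarrow> (\<Sum>l\<in>UNIV. y $ l * cal l x y) = (\<Sum>m\<in>UNIV. y $ m * Dx m A2 x y)"
proof -
  assume xy: "x \<in> U" "y \<noteq> 0"
  have "(\<Sum>l\<in>UNIV. y $ l * (\<Sum>m\<in>UNIV. y $ m * (\<Sum>k\<in>UNIV. da m x l k * y $ k)))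
      = (\<Sum>m\<in>UNIV. y $ m * (\<Sum>l\<in>UNIV. \<Sum>k\<in>UNIV. da m x l k * y $ l * y $ k))"
    by (simp add: sum_distrib_left) (subst sum.swap, intro sum.cong refl, simp add: mult_ac)
  thus ?thesis using xy
    by (simp add: cal_eq right_diff_distrib sum_subtractf A2_Dx
        flip: da_def) (simp add: mult.left_commute[of _ 2] flip: sum_distrib_left)
qed

lemma Dx_F_y:
  assumes xy: "x \<in> U" "y \<noteq> 0"
  shows "(\<Sum>m\<in>UNIV. Dx m F x y * y $ m) = (\<Sum>m\<in>UNIV. y $ m * Dx m A2 x y) * ial x y / 2
    + (\<Sum>i\<in>UNIV. \<Sum>j\<in>UNIV. db j x i * y $ i * y $ j)" (is "_ = _ + ?B0")
proof -
  have "(\<Sum>m\<in>UNIV. (\<Sum>i\<in>UNIV. db m x i * y $ i) * y $ m) = ?B0"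
    by (simp add: sum_distrib_right) (rule sum.swap)
  moreover have "Dx m F x y * y $ m = (y $ m * Dx m A2 x y) * (ial x y / 2)
      + (\<Sum>i\<in>UNIV. db m x i * y $ i) * y $ m" for m
    using xy by (simp add: Dx_F algebra_simps)
  ultimately show ?thesis
    by (simp add: sum.distrib flip: sum_distrib_right sum_divide_distrib)
qed

text \<open>Exactly the three contractions that \<open>g_row\<close> requires. The raised indices
  inside \<open>G\<close> cancel against \<open>a\<close>, and in \<open>Y_G\<close> the summand
  \<open>\<alpha> s^k_0\<close> disappears because \<open>s_{ij}\<close> is antisymmetric.\<close>

lemma G_contract:
  assumes xy: "x \<in> U" "y \<noteq> 0"
  shows a_G: "(\<Sum>k\<in>UNIV. a x $ l $ k * G k x y) =
      P0 x y * Y l x y + cal l x y / 4 - s0 x y * Y l x y + al x y * sl l x y"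
    and Y_G: "(\<Sum>k\<in>UNIV. Y k x y * G k x y) =
      P0 x y * (al x y)\<^sup>2 + (\<Sum>m\<in>UNIV. y $ m * Dx m A2 x y) / 4 - s0 x y * (al x y)\<^sup>2"
    and b_G: "(\<Sum>k\<in>UNIV. b x $ k * G k x y) =
      P0 x y * be x y + (\<Sum>k\<in>UNIV. V x k * cal k x y) / 4 - s0 x y * be x y + al x y * s0 x y"
proof -
  have aGa: "(\<Sum>k\<in>UNIV. a x $ l $ k * Ga k x y) = cal l x y / 4" for l
    unfolding Ga_def using a_up[OF xy(1)] by (simp flip: sum_divide_distrib)
  have YGa: "(\<Sum>k\<in>UNIV. Y k x y * Ga k x y) = (\<Sum>m\<in>UNIV. y $ m * Dx m A2 x y) / 4"
    unfolding Ga_def using Y_up[OF xy(1)] y_cal[OF xy] by (simp flip: sum_divide_distrib)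
  have bGa: "(\<Sum>k\<in>UNIV. b x $ k * Ga k x y) = (\<Sum>k\<in>UNIV. V x k * cal k x y) / 4"
    unfolding Ga_def using b_up[OF xy(1)] by (simp flip: sum_divide_distrib)
  have aS: "(\<Sum>k\<in>UNIV. a x $ l $ k * sig k x y) = sl l x y" for l
    unfolding sig_def by (rule a_up[OF xy(1)])
  have YS: "(\<Sum>k\<in>UNIV. Y k x y * sig k x y) = 0"
    unfolding sig_def using Y_up[OF xy(1)] y_sl by simp
  have bS: "(\<Sum>k\<in>UNIV. b x $ k * sig k x y) = s0 x y"
    unfolding sig_def s0_def by (rule b_up[OF xy(1)])
  have lin: "(\<Sum>k\<in>UNIV. e k * G k x y) = P0 x y * (\<Sum>k\<in>UNIV. e k * y $ k) + (\<Sum>k\<in>UNIV. e k * Ga k x y)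
     - s0 x y * (\<Sum>k\<in>UNIV. e k * y $ k) + al x y * (\<Sum>k\<in>UNIV. e k * sig k x y)" for e
    unfolding G_def Rm_def by (simp add: algebra_simps sum.distrib sum_subtractf sum_distrib_left)
  show "(\<Sum>k\<in>UNIV. a x $ l $ k * G k x y) =
      P0 x y * Y l x y + cal l x y / 4 - s0 x y * Y l x y + al x y * sl l x y"
    unfolding lin aGa aS by (simp flip: Y_def)
  show "(\<Sum>k\<in>UNIV. Y k x y * G k x y) =
      P0 x y * (al x y)\<^sup>2 + (\<Sum>m\<in>UNIV. y $ m * Dx m A2 x y) / 4 - s0 x y * (al x y)\<^sup>2"
    unfolding lin YGa YS Y_y by (simp add: al_sq[OF xy(1)])
  show "(\<Sum>k\<in>UNIV. b x $ k * G k x y) =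
      P0 x y * be x y + (\<Sum>k\<in>UNIV. V x k * cal k x y) / 4 - s0 x y * be x y + al x y * s0 x y"
    unfolding lin bGa bS b_y by simp
qed

text \<open>Geodesics satisfy \<open>x'' = -2 G(x, x')\<close>, so the two sides say
  \<open>dF/dt = 0\<close>. In the Ricci curvature this trades the derivatives of \<open>F\<close>
  by \<open>x\<close> for \<open>e_00\<close> and derivatives by \<open>y\<close>.\<close>

lemma F_along_geodesics:
  assumes xy: "x \<in> U" "y \<noteq> 0"
  shows "(\<Sum>m\<in>UNIV. Dx m F x y * y $ m) = 2 * (\<Sum>k\<in>UNIV. f k x y * G k x y)"
proof -
  have "(\<Sum>k\<in>UNIV. f k x y * G k x y) = (\<Sum>k\<in>UNIV. Y k x y * G k x y) * ial x y + (\<Sum>k\<in>UNIV. b x $ k * G k x y)"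
    unfolding f_def
        by (simp add: distrib_left distrib_right sum.distrib sum_distrib_left sum_distrib_right mult_ac)
  moreover have "(al x y)\<^sup>2 * ial x y = al x y"
    using al_ial[OF xy] by (simp add: power2_eq_square mult.assoc)
  moreover have "P0 x y * (al x y + be x y) = ee x y / 2"
    using F_iF[OF xy] unfolding P0_def F_def by algebra
  ultimately show ?thesis
    unfolding Dx_F_y[OF xy] Y_G[OF xy] b_G[OF xy]
    by (simp add: ee_eq left_diff_distrib distrib_left distrib_right mult.assoc)
      (simp add: algebra_simps)
qed

lemma geodesic_coeff_eq:
  assumes L: "\<forall>x\<in>U. \<forall>y. L x y = F x y" and xy: "x \<in> U" "y \<noteq> 0"
  shows "geodesic_coeff L k x y = G k x y"
proof -
  have D: "Dx m (sq L) x y = 2 * (F x y * Dx m F x y)" if "x \<in> U" "y \<noteq> 0" for m x y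
  proof -
    have "Dx m (sq L) x y = Dx m (\<lambda>x y. F x y * F x y) x y"
      by (rule Dx_cong) (auto simp: that L sq_def power2_eq_square)
    thus ?thesis using that by (simp add: Dx_mult[OF pol_F pol_F])
  qed
  have DD: "Dy l (Dx m (sq L)) x y = 2 * (f l x y * Dx m F x y + F x y * Dy l (Dx m F) x y)" for l m
  proof -
    have "Dy l (Dx m (sq L)) x y = Dy l (\<lambda>x y. 2 * (F x y * Dx m F x y)) x y"
      by (rule Dy_cong) (use D xy in auto)
    thus ?thesis using xy
      by (simp add: Dy_mult[OF pol_const pol_mult[OF pol_F pol_Dx_F]] Dy_mult[OF pol_F pol_Dx_F] Dy_F Dy_coef)
  qed
  let ?T0 = "\<Sum>m\<in>UNIV. y $ m * Dx m A2 x y"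
  let ?B0 = "\<Sum>i\<in>UNIV. \<Sum>j\<in>UNIV. db j x i * y $ i * y $ j"
  let ?W = "\<lambda>l. \<Sum>m\<in>UNIV. y $ m * (\<Sum>k\<in>UNIV. da m x l k * y $ k)"
  let ?\<kappa> = "(\<Sum>k\<in>UNIV. V x k * cal k x y) / 4"
  have FF: "(\<Sum>m\<in>UNIV. Dy l (Dx m F) x y * y $ m) = ?W l * ial x y - ?T0 * Y l x y * ial x y ^ 3 / 2
      + (\<Sum>m\<in>UNIV. db m x l * y $ m)" for l
  proof -
    have "Dy l (Dx m F) x y * y $ m = (y $ m * (\<Sum>k\<in>UNIV. da m x l k * y $ k)) * ial x y
        - (y $ m * Dx m A2 x y) * (Y l x y * ial x y ^ 3 / 2) + db m x l * y $ m" for m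
      using xy by (simp add: Dy_Dx_F algebra_simps)
    thus ?thesis
      by (simp add: sum.distrib sum_subtractf flip: sum_distrib_right sum_divide_distrib)
  qed
  have c: "(\<Sum>m\<in>UNIV. Dy l (Dx m (sq L)) x y * y $ m) - Dx l (sq L) x y =
      2 * f l x y * (?T0 * ial x y / 2 + ?B0) + 2 * F x y * (?W l * ial x y - ?T0 * Y l x y * ial x y ^ 3 / 2
      + (\<Sum>m\<in>UNIV. db m x l * y $ m)) - 2 * F x y * (Dx l A2 x y * (1/2) * ial x y
          + (\<Sum>i\<in>UNIV. db l x i * y $ i))" for l
    unfolding Dx_F_y[OF xy, symmetric] FF[symmetric] using xy Dx_F[OF xy, of l, symmetric]
    by (simp add: DD D distrib_left distrib_right sum.distrib sum_distrib_left mult_ac)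
  have P: "P0 x y = (ee x y / 2) * iF x y" by (simp add: P0_def)
  have "(\<Sum>m\<in>UNIV. Dy l (Dx m (sq L)) x y * y $ m) - Dx l (sq L) x y =
      4 * (\<Sum>k\<in>UNIV. fund_tensor L x y $ l $ k * G k x y)" for l
    unfolding c g_row[OF assms] G_contract[OF xy] P
  proof (rule spray_identity[OF al_ial[OF xy] F_iF[OF xy] F_def _ f_def])
    show "2 * (ee x y / 2) = ?B0 - 2 * ?\<kappa> + 2 * be x y * s0 x y"
      by (simp add: ee_eq)
    show "cal l x y = 2 * ?W l - Dx l A2 x y"
      using xy by (simp add: cal_eq A2_Dx da_def)
    show "2 * sl l x y = (\<Sum>m\<in>UNIV. db m x l * y $ m) - (\<Sum>i\<in>UNIV. db l x i * y $ i)"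
      by (simp add: sl_def sum_distrib_left left_diff_distrib diff_divide_distrib flip: sum_subtractf)
  qed
  thus ?thesis
    unfolding geodesic_coeff_def by (simp add: mult.left_commute[of _ 4] fund_inv_apply[OF assms]
        flip: sum_distrib_left)
qed

end

text \<open>Here \<open>J\<close> is \<open>1/F\<close>, \<open>e\<close> is \<open>e_00\<close>,
  and \<open>R\<close> is the sum of \<open>F_{y^j} R^j\<close>. The first two lines contribute
  \<open>(n - 1) e R J^2\<close>, the other two its negative, so no mixed term remains at order two.
  What is left there is \<open>(n - 1)/2\<close> from the derivatives of \<open>P\<close> and
  \<open>(n - 1)/4\<close> from \<open>P^2\<close>, together the factor
  \<open>3 (n - 1)/4\<close>.\<close>

lemma ricci_identity:
  fixes P :: real
  assumes "P = 1/2 * e * J"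
  shows "2 * (1/2 * (J * X - e * J ^ 2 * (e + 2 * R)) + r1)
      - ((n + 1) * (1/2 * (J * X - e * J ^ 2 * (e + 2 * R))) + r2)
      + 2 * ((n + 1) * (P\<^sup>2 + 1/2 * (J * Z - e * J ^ 2 * R)) + r3)
      - ((n + 3) * P\<^sup>2 + 4 * (1/2 * (J * Z - e * J ^ 2 * R)) + 2 * r5 + r6)
    = 3 * (n - 1) / 4 * e\<^sup>2 * J\<^sup>2
      + ((n - 1) / 2 * (J * (2 * Z - X)) + 2 * r1 - r2 + 2 * r3 - 2 * r5 - r6)"
  unfolding assms by (simp add: field_simps power2_eq_square)

section \<open>The Ricci curvature and its double pole\<close>

context randers_chart begin

lemma pol_up: "(\<And>l. pol k d (c l)) \<Longrightarrow> pol k d (\<lambda>x y. up x (\<lambda>l. c l x y) i)"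
  unfolding up_def by (intro pol_sum pol_deg[OF pol_mult[OF pol_coef[OF smooth_ai]]]) auto

lemma smooth_C: "smooth_on U (\<lambda>x. C l x i j)"
  unfolding C_def by (intro smooth_on_diff smooth_on_mult smooth_on_const smooth_da open_U)

lemma pol_cal: "pol 0 2 (\<lambda>x y. cal l x y)"
  unfolding cal_def by (intro pol_quad smooth_C)

lemma pol_Ga: "pol 0 2 (\<lambda>x y. Ga k x y)"
  unfolding Ga_def by (intro pol_cmult pol_up pol_cal)

lemma smooth_sl: "smooth_on U (\<lambda>x. (db m x l - db l x m) / 2)"
  using smooth_on_mult[OF smooth_on_const[OF open_U, of "1/2"] smooth_on_diff[OF smooth_db smooth_db, of m
      l l m]]
  by simp

lemma pol_sl: "pol 0 1 (\<lambda>x y. sl l x y)"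
  unfolding sl_def by (intro pol_lin smooth_sl)

lemma pol_sig: "pol 0 1 (\<lambda>x y. sig k x y)"
  unfolding sig_def by (intro pol_up pol_sl)

lemma pol_s0: "pol 0 1 (\<lambda>x y. s0 x y)"
  unfolding s0_def by (intro pol_sum pol_deg[OF pol_mult[OF pol_coef[OF smooth_V] pol_sl]]) auto

lemma smooth_EE: "smooth_on U (\<lambda>x. EE x i j)"
  unfolding EE_def
  by (intro smooth_on_add smooth_on_diff smooth_on_mult smooth_on_sum smooth_on_const smooth_C
      smooth_db smooth_b smooth_V open_U)

lemma pol_ee: "pol 0 2 (\<lambda>x y. ee x y)"
  unfolding ee_def by (intro pol_quad smooth_EE)

lemma pol_P0: "pol 1 1 (\<lambda>x y. P0 x y)"
  unfolding P0_def by (rule pol_deg[OF pol_mult[OF pol_cmult[OF pol_ee] pol_inv_F]]) simp_all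

lemma pol_Rm: "pol 0 2 (\<lambda>x y. Rm k x y)"
  unfolding Rm_def
  by (rule pol_deg[OF pol_add[OF pol_diff[OF pol_Ga pol_mult[OF pol_s0 pol_coord]] pol_mult[OF pol_al
      pol_sig]]]) simp_all

lemma pol_Py: "pol 1 2 (\<lambda>x y. P0 x y * y $ k)"
  using pol_mult[OF pol_P0 pol_coord] by simp

lemma pol_G: "pol 1 2 (\<lambda>x y. G k x y)"
  unfolding G_def using pol_add[OF pol_Py pol_Rm] by simp

lemma Dx_G: "x \<in> U \<Longrightarrow> y \<noteq> 0 \<Longrightarrow> Dx j (G m) x y = Dx j P0 x y * y $ m + Dx j (Rm m) x y"
  unfolding G_def[abs_def] by (simp add: Dx_add[OF pol_Py pol_Rm] Dx_mult[OF pol_P0 pol_coord] Dx_coord)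

lemma Dy_G: "x \<in> U \<Longrightarrow> y \<noteq> 0 \<Longrightarrow>
    Dy j (G m) x y = Dy j P0 x y * y $ m + P0 x y * of_bool (j = m) + Dy j (Rm m) x y"
  unfolding G_def[abs_def] by (simp add: Dy_add[OF pol_Py pol_Rm] Dy_mult[OF pol_P0 pol_coord] Dy_coord)

lemma Dy_Dx_G:
  assumes "x \<in> U" "y \<noteq> 0"
  shows "Dy m (Dx j (G m)) x y = Dy m (Dx j P0) x y * y $ m + Dx j P0 x y + Dy m (Dx j (Rm m)) x y"
proof -
  note p = pol_Dx[OF pol_P0] pol0_Dx[OF pol_Rm]
  have "Dy m (Dx j (G m)) x y = Dy m (\<lambda>x y. Dx j P0 x y * y $ m + Dx j (Rm m) x y) x y"
    by (rule Dy_cong) (use assms Dx_G in auto)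
  thus ?thesis
    using assms by (simp add: Dy_add[OF pol_mult[OF p(1) pol_coord] p(2)] Dy_mult[OF p(1) pol_coord] Dy_coord)
qed

lemma Dy_Dy_G:
  assumes "x \<in> U" "y \<noteq> 0"
  shows "Dy m (Dy j (G m)) x y = Dy m (Dy j P0) x y * y $ m + Dy j P0 x y + Dy m P0 x y * of_bool (j = m)
      + Dy m (Dy j (Rm m)) x y"
proof -
  note p = pol_Dy[OF pol_P0] pol0_Dy[OF pol_Rm]
  note q = pol_mult[OF p(1) pol_coord] pol_mult[OF pol_P0 pol_const]
  have 1: "pol 2 1 (\<lambda>x y. Dy j P0 x y * y $ m + P0 x y * of_bool (j = m))"
    using pol_add[OF q] by (simp add: eval_nat_numeral)
  have "Dy m (Dy j (G m)) x y = Dy m (\<lambda>x y. Dy j P0 x y * y $ m + P0 x y * of_bool (j = m)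
      + Dy j (Rm m) x y) x y"
    by (rule Dy_cong) (use assms Dy_G in auto)
  thus ?thesis
    using assms by (simp add: Dy_add[OF 1 p(2)] Dy_add[OF q] Dy_mult[OF p(1) pol_coord] Dy_coord
       Dy_mult[OF pol_P0 pol_const] Dy_coef)
qed

definition ric_rest :: "'n local_fun" where
  "ric_rest x y = (real CARD('n) - 1) / 2 * (iF x y * (2 * (\<Sum>j\<in>UNIV. Rm j x y * Dy j ee x y)
      - (\<Sum>j\<in>UNIV. y $ j * Dx j ee x y)))
     + 2 * (\<Sum>m\<in>UNIV. Dx m (Rm m) x y)
     - (\<Sum>m\<in>UNIV. \<Sum>j\<in>UNIV. Dy m (Dx j (Rm m)) x y * y $ j)
     + 2 * (\<Sum>m\<in>UNIV. \<Sum>j\<in>UNIV. G j x y * Dy m (Dy j (Rm m)) x y)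
     - 2 * (P0 x y * (\<Sum>m\<in>UNIV. Dy m (Rm m) x y))
     - (\<Sum>m\<in>UNIV. \<Sum>j\<in>UNIV. Dy j (Rm m) x y * Dy m (Rm j) x y)"

text \<open>Each summand has at most one factor with a pole, namely \<open>iF\<close>,
  \<open>G\<close> or \<open>P0\<close>, and that pole is simple.\<close>

lemma pol_ric_rest: "pol 1 2 ric_rest"
proof -
  have 1: "pol 1 2 (\<lambda>x y. iF x y * (2 * (\<Sum>j\<in>UNIV. Rm j x y * Dy j ee x y) - (\<Sum>j\<in>UNIV. y $ j * Dx j ee x y)))"
    by (rule pol_deg[OF pol_mult[OF pol_inv_F pol_diff[OF pol_cmult[OF pol_sum[OF pol_mult[OF pol_Rm
        pol0_Dy[OF pol_ee]]]]
       pol_sum[OF pol_mult[OF pol_coord pol0_Dx[OF pol_ee]]]]]]) simp_all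
  have 2: "pol 0 2 (\<lambda>x y. \<Sum>m\<in>UNIV. Dx m (Rm m) x y)"
    by (intro pol_sum pol0_Dx pol_Rm)
  have 3: "pol 0 2 (\<lambda>x y. \<Sum>m\<in>UNIV. \<Sum>j\<in>UNIV. Dy m (Dx j (Rm m)) x y * y $ j)"
    by (intro pol_sum pol_deg[OF pol_mult[OF pol0_Dy[OF pol0_Dx[OF pol_Rm]] pol_coord]]) simp_all
  have 4: "pol 1 2 (\<lambda>x y. \<Sum>m\<in>UNIV. \<Sum>j\<in>UNIV. G j x y * Dy m (Dy j (Rm m)) x y)"
    by (intro pol_sum pol_deg[OF pol_mult[OF pol_G pol0_Dy[OF pol0_Dy[OF pol_Rm]]]]) simp_all
  have 5: "pol 1 2 (\<lambda>x y. P0 x y * (\<Sum>m\<in>UNIV. Dy m (Rm m) x y))"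
    by (rule pol_deg[OF pol_mult[OF pol_P0 pol_sum[OF pol0_Dy[OF pol_Rm]]]]) simp_all
  have 6: "pol 0 2 (\<lambda>x y. \<Sum>m\<in>UNIV. \<Sum>j\<in>UNIV. Dy j (Rm m) x y * Dy m (Rm j) x y)"
    by (intro pol_sum pol_deg[OF pol_mult[OF pol0_Dy[OF pol_Rm] pol0_Dy[OF pol_Rm]]]) simp_all
  have "pol 1 2 (\<lambda>x y. ric_rest x y)" unfolding ric_rest_def
    by (intro pol_deg[OF pol_diff[OF pol_diff[OF pol_add[OF pol_diff[OF pol_add[OF pol_cmult[OF 1]
        pol_cmult[OF 2]] 3]
       pol_cmult[OF 4]] pol_cmult[OF 5]] 6]]) simp_all
  thus ?thesis .
qed

lemma Dx_P0:
  assumes "x \<in> U" "y \<noteq> 0"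
  shows "Dx j P0 x y = 1/2 * (Dx j ee x y * iF x y - ee x y * Dx j F x y * iF x y ^ 2)"
  unfolding P0_def[abs_def] Dx_mult[OF pol_cmult[OF pol_ee] pol_inv_F assms] Dx_mult[OF pol_const pol_ee
      assms]
    Dx_coef Dx_inv_F[OF assms] by (simp add: algebra_simps power2_eq_square)

lemma Dy_P0:
  assumes "x \<in> U" "y \<noteq> 0"
  shows "Dy j P0 x y = 1/2 * (Dy j ee x y * iF x y - ee x y * f j x y * iF x y ^ 2)"
  unfolding P0_def[abs_def] Dy_mult[OF pol_cmult[OF pol_ee] pol_inv_F assms] Dy_mult[OF pol_const pol_ee
      assms]
    Dy_coef Dy_inv_F[OF assms] Dy_F[OF assms] by (simp add: algebra_simps power2_eq_square)

lemma f_y: assumes "x \<in> U" "y \<noteq> 0" shows "(\<Sum>k\<in>UNIV. f k x y * y $ k) = F x y"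
  using euler_F[OF assms] by (simp add: Dy_F[OF assms] mult.commute)

lemma ricci_eq:
  assumes L: "\<forall>x\<in>U. \<forall>y. L x y = F x y" and xy: "x \<in> U" "y \<noteq> 0"
  shows "ricci_curv L x y = 3 * (real CARD('n) - 1) / 4 * (ee x y)\<^sup>2 * (iF x y)\<^sup>2 + ric_rest x y"
proof -
  have g: "geodesic_coeff L i x y = G i x y" if "x \<in> U" "y \<noteq> 0" for i x y
    by (rule geodesic_coeff_eq[OF L that])
  have D1: "Dx k (geodesic_coeff L i) x y = Dx k (G i) x y" "Dy k (geodesic_coeff L i) x y = Dy k (G i) x y"
    if "x \<in> U" "y \<noteq> 0" for i k x y
    by (rule Dx_cong Dy_cong; use g that in auto)+
  have D2: "Dy l (Dx k (geodesic_coeff L i)) x y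
      = Dy l (Dx k (G i)) x y" "Dy l (Dy k (geodesic_coeff L i)) x y = Dy l (Dy k (G i)) x y"
    for i k l
    by (rule Dy_cong; use D1 xy in auto)+
  have "ricci_curv L x y = (\<Sum>m\<in>UNIV. 2 * Dx m (G m) x y
     - (\<Sum>j\<in>UNIV. Dy m (Dx j (G m)) x y * y $ j)
     + 2 * (\<Sum>j\<in>UNIV. G j x y * Dy m (Dy j (G m)) x y)
     - (\<Sum>j\<in>UNIV. Dy j (G m) x y * Dy m (G j) x y))"
    unfolding ricci_curv_def riemann_curv_def Let_def by (simp add: D1 D2 g xy)
  also have "\<dots> = 2 * (\<Sum>m\<in>UNIV. Dx m (G m) x y)
     - (\<Sum>m\<in>UNIV. \<Sum>j\<in>UNIV. Dy m (Dx j (G m)) x y * y $ j)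
     + 2 * (\<Sum>m\<in>UNIV. \<Sum>j\<in>UNIV. G j x y * Dy m (Dy j (G m)) x y)
     - (\<Sum>m\<in>UNIV. \<Sum>j\<in>UNIV. Dy j (G m) x y * Dy m (G j) x y)"
    by (simp add: sum.distrib sum_subtractf sum_distrib_left)
  finally have R: "ricci_curv L x y = \<dots>" .
  let ?X = "\<Sum>j\<in>UNIV. Dx j P0 x y * y $ j"
  let ?Z = "\<Sum>j\<in>UNIV. Rm j x y * Dy j P0 x y"
  have eP: "(\<Sum>j\<in>UNIV. Dy j P0 x y * y $ j) = P0 x y"
    using euler[OF pol_P0 xy] by (simp add: mult.commute)
  have T1: "(\<Sum>m\<in>UNIV. Dx m (G m) x y) = ?X + (\<Sum>m\<in>UNIV. Dx m (Rm m) x y)"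
    using xy by (simp add: Dx_G sum.distrib)
  have T2: "(\<Sum>m\<in>UNIV. \<Sum>j\<in>UNIV. Dy m (Dx j (G m)) x y * y $ j)
      = (real CARD('n) + 1) * ?X + (\<Sum>m\<in>UNIV. \<Sum>j\<in>UNIV. Dy m (Dx j (Rm m)) x y * y $ j)"
  proof -
    have "(\<Sum>m\<in>UNIV. Dy m (Dx j P0) x y * y $ m) = Dx j P0 x y" for j
      using euler[OF pol_Dx[OF pol_P0] xy] by (simp add: mult.commute)
    hence "(\<Sum>m\<in>UNIV. Dy m (Dx j (G m)) x y) = (real CARD('n) + 1) * Dx j P0 x y
        + (\<Sum>m\<in>UNIV. Dy m (Dx j (Rm m)) x y)" for j
      using xy by (simp add: Dy_Dx_G sum.distrib algebra_simps)
    hence "(\<Sum>j\<in>UNIV. (\<Sum>m\<in>UNIV. Dy m (Dx j (G m)) x y) * y $ j)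
      = (real CARD('n) + 1) * ?X + (\<Sum>j\<in>UNIV. (\<Sum>m\<in>UNIV. Dy m (Dx j (Rm m)) x y) * y $ j)"
      by (simp add: distrib_right sum.distrib sum_distrib_left mult.assoc)
    thus ?thesis
      by (subst (1 2) sum.swap) (simp add: sum_distrib_right)
  qed
  have T3: "(\<Sum>m\<in>UNIV. \<Sum>j\<in>UNIV. G j x y * Dy m (Dy j (G m)) x y)
      = (real CARD('n) + 1) * ((P0 x y)\<^sup>2 + ?Z) + (\<Sum>m\<in>UNIV. \<Sum>j\<in>UNIV. G j x y * Dy m (Dy j (Rm m)) x y)"
  proof -
    \<comment> \<open>The degree is 0 here against 1 in \<open>T2\<close>: the copy of
      \<open>Dy j P0\<close> that Euler's relation does not give comes from the Kronecker term in
      \<open>Dy_Dy_G\<close>, so both traces carry \<open>n + 1\<close>.\<close>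
    have "(\<Sum>m\<in>UNIV. Dy m (Dy j P0) x y * y $ m) = 0" for j
      using euler[OF pol_Dy[OF pol_P0] xy] by (simp add: mult.commute)
    hence "(\<Sum>m\<in>UNIV. Dy m (Dy j (G m)) x y) = (real CARD('n) + 1) * Dy j P0 x y
        + (\<Sum>m\<in>UNIV. Dy m (Dy j (Rm m)) x y)" for j
      using xy by (simp add: Dy_Dy_G sum.distrib sum_of_bool algebra_simps)
    hence "(\<Sum>j\<in>UNIV. G j x y * (\<Sum>m\<in>UNIV. Dy m (Dy j (G m)) x y))
      = (real CARD('n) + 1) * (\<Sum>j\<in>UNIV. G j x y * Dy j P0 x y)
          + (\<Sum>j\<in>UNIV. G j x y * (\<Sum>m\<in>UNIV. Dy m (Dy j (Rm m)) x y))"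
      by (simp add: distrib_left sum.distrib sum_distrib_left mult_ac)
    moreover have "(\<Sum>j\<in>UNIV. G j x y * Dy j P0 x y) = P0 x y * (\<Sum>j\<in>UNIV. Dy j P0 x y * y $ j) + ?Z"
      by (simp add: G_def distrib_right distrib_left sum.distrib sum_distrib_left mult_ac)
    ultimately show ?thesis unfolding eP
      by (subst (1 2) sum.swap) (simp add: sum_distrib_left power2_eq_square)
  qed
  have T4: "(\<Sum>m\<in>UNIV. \<Sum>j\<in>UNIV. Dy j (G m) x y * Dy m (G j) x y)
      = (real CARD('n) + 3) * (P0 x y)\<^sup>2 + 4 * ?Z + 2 * (P0 x y * (\<Sum>m\<in>UNIV. Dy m (Rm m) x y))
        + (\<Sum>m\<in>UNIV. \<Sum>j\<in>UNIV. Dy j (Rm m) x y * Dy m (Rm j) x y)"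
  proof -
    \<comment> \<open>In the square of the derivative of \<open>P y\<close>, the rank-one part
      contributes \<open>P^2\<close>, its products with the identity \<open>2 P^2\<close>, and the
      identity \<open>n P^2\<close>; hence \<open>n + 3\<close>.\<close>
    have e: "Dy j (G m) x y * Dy m (G j) x y = (Dy m P0 x y * y $ m) * (Dy j P0 x y * y $ j)
      + of_bool (j = m) * (P0 x y * (Dy m P0 x y * y $ j + Dy j P0 x y * y $ m))
      + of_bool (j = m) * (P0 x y)\<^sup>2
      + Dy j P0 x y * (Dy m (Rm j) x y * y $ m) + Dy m P0 x y * (Dy j (Rm m) x y * y $ j)
      + of_bool (j = m) * (P0 x y * (Dy m (Rm j) x y + Dy j (Rm m) x y))
      + Dy j (Rm m) x y * Dy m (Rm j) x y" for j m
      using xy by (simp add: Dy_G algebra_simps power2_eq_square)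
    have R: "(\<Sum>m\<in>UNIV. Dy m (Rm j) x y * y $ m) = 2 * Rm j x y" for j
      using euler[OF pol_Rm xy] by (simp add: mult.commute)
    have s1: "(\<Sum>m\<in>UNIV. \<Sum>j\<in>UNIV. (Dy m P0 x y * y $ m) * (Dy j P0 x y * y $ j)) = (P0 x y)\<^sup>2"
      unfolding sum_product[symmetric] eP by (simp add: power2_eq_square)
    have s2: "(\<Sum>m\<in>UNIV. P0 x y * (Dy m P0 x y * y $ m + Dy m P0 x y * y $ m)) = 2 * (P0 x y)\<^sup>2"
      unfolding sum_distrib_left[symmetric] sum.distrib eP by (simp add: power2_eq_square)
    have s5: "(\<Sum>m\<in>UNIV. \<Sum>j\<in>UNIV. Dy m P0 x y * (Dy j (Rm m) x y * y $ j)) = 2 * ?Z"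
      unfolding sum_distrib_left[symmetric] R by (simp add: sum_distrib_left mult_ac)
    have s4: "(\<Sum>m\<in>UNIV. \<Sum>j\<in>UNIV. Dy j P0 x y * (Dy m (Rm j) x y * y $ m)) = 2 * ?Z"
      by (subst sum.swap) (rule s5)
    have s6: "(\<Sum>m\<in>UNIV. P0 x y * (Dy m (Rm m) x y + Dy m (Rm m) x y))
        = 2 * (P0 x y * (\<Sum>m\<in>UNIV. Dy m (Rm m) x y))"
      by (simp add: sum_distrib_left mult_ac)
    show ?thesis
      unfolding e sum.distrib sum_of_bool s1 s2 s4 s5 s6 by (simp add: algebra_simps)
  qed
  have X: "?X = 1/2 * (iF x y * (\<Sum>j\<in>UNIV. y $ j * Dx j ee x y)
      - ee x y * iF x y ^ 2 * (\<Sum>j\<in>UNIV. Dx j F x y * y $ j))"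
    using xy by (simp add: Dx_P0 algebra_simps sum.distrib sum_subtractf sum_distrib_left)
  have Z: "?Z = 1/2 * (iF x y * (\<Sum>j\<in>UNIV. Rm j x y * Dy j ee x y)
      - ee x y * iF x y ^ 2 * (\<Sum>j\<in>UNIV. f j x y * Rm j x y))"
    using xy by (simp add: Dy_P0 algebra_simps sum.distrib sum_subtractf sum_distrib_left)
  \<comment> \<open>The same quantity \<open>F_{y^j} R^j\<close> now appears in \<open>?X\<close>
    and in \<open>?Z\<close>, which is what makes the mixed terms of \<open>ricci_identity\<close>
    cancel.\<close>
  have FF: "(\<Sum>j\<in>UNIV. Dx j F x y * y $ j) = 2 * (P0 x y * F x y + (\<Sum>j\<in>UNIV. f j x y * Rm j x y))"
  proof -
    have "(\<Sum>k\<in>UNIV. f k x y * G k x y) = P0 x y * (\<Sum>k\<in>UNIV. f k x y * y $ k) + (\<Sum>j\<in>UNIV. f j x y * Rm j x y)"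
      by (simp add: G_def distrib_left sum.distrib sum_distrib_left mult_ac)
    thus ?thesis unfolding F_along_geodesics[OF xy] f_y[OF xy] by simp
  qed
  have P: "P0 x y = 1/2 * ee x y * iF x y" by (rule P0_def)
  have "P0 x y * F x y = ee x y / 2"
    using F_iF[OF xy] unfolding P by algebra
  hence FF': "2 * (P0 x y * F x y + q) = ee x y + 2 * q" for q
    by simp
  show ?thesis
    unfolding R T1 T2 T3 T4 ric_rest_def X Z FF FF' by (rule ricci_identity[OF P])
qed

end

text \<open>The Hessian of \<open>K/F^2\<close> contracted with the inverse fundamental tensor. The
  term with \<open>a^{ij}\<close> contributes 6, the mixed term 4 and the term with
  \<open>y^i y^j\<close> 2, each times \<open>K (\<beta> + b^2 \<alpha>) / F^5\<close>. The letters
  \<open>M\<close>, \<open>n\<close>, \<open>r\<close> stand for parts of lower pole order.\<close>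

lemma scalar_identity:
  fixes A :: real
  assumes "A * I = 1" "F * J = 1"
  shows "A * J * (6 * K * J ^ 4 * (F * I + (\<beta> * I + b2)) + M)
      - A * J ^ 2 * (2 * (- 2 * K * J ^ 3 * (\<beta> * I + b2) + n))
      + (b2 * A + \<beta>) * J ^ 3 * (2 * (K * J ^ 2 + r))
    = 12 * K * (\<beta> + b2 * A) * J ^ 5
      + (6 * K * J ^ 4 + A * J * M - 2 * A * J ^ 2 * n + 2 * (b2 * A + \<beta>) * J ^ 3 * r)"
  using assms by algebra

section \<open>The leading pole of the scalar curvature\<close>

context randers_chart begin

lemma up_f: "x \<in> U \<Longrightarrow> up x (\<lambda>l. f l x y) k = y $ k * ial x y + V x k"
  unfolding f_def V_def up_Y[of x y k, symmetric]
  by (simp add: up_def distrib_left sum.distrib sum_distrib_left sum_distrib_right mult_ac)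

lemma f_V: "x \<in> U \<Longrightarrow> (\<Sum>k\<in>UNIV. f k x y * V x k) = be x y * ial x y + b2 x"
  unfolding f_def b2_def V_Y[of x y, symmetric]
  by (simp add: distrib_left distrib_right sum.distrib sum_distrib_left sum_distrib_right mult_ac)

text \<open>The coefficient of \<open>1/F^2\<close> in the Ricci curvature.\<close>

definition KK :: "'n local_fun" where
  "KK x y = 3 * (real CARD('n) - 1) / 4 * (ee x y)\<^sup>2"

lemma pol_KK: "pol 0 4 (\<lambda>x y. KK x y)"
  unfolding KK_def power2_eq_square
  by (rule pol_deg[OF pol_cmult[OF pol_mult[OF pol_ee pol_ee]]]) simp_all

lemma pol_iF_power: "pol k (- int k) (\<lambda>x y. iF x y ^ k)"
proof (induction k)
  case (Suc k)
  show ?case using pol_mult[OF pol_inv_F Suc] by simp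
qed (simp add: pol_const)

lemma Dy_iF_power:
  assumes "x \<in> U" "y \<noteq> 0"
  shows "Dy i (\<lambda>x y. iF x y ^ k) x y = - real k * f i x y * iF x y ^ Suc k"
proof (induction k)
  case (Suc k)
  show ?case using Suc assms
    by (simp add: Dy_mult[OF pol_inv_F pol_iF_power] Dy_inv_F Dy_F algebra_simps)
qed (simp add: Dy_coef)

lemma scalar_pole:
  assumes L: "\<forall>x\<in>U. \<forall>y. L x y = F x y"
  obtains H where "pol 4 0 H" "\<And>x y. x \<in> U \<Longrightarrow> y \<noteq> 0 \<Longrightarrow>
    scalar_curv L x y = 6 * KK x y * (be x y + b2 x * al x y) * iF x y ^ 5 + H x y"
proof -
  define W where "W = (\<lambda>x y. KK x y * iF x y ^ 2 + ric_rest x y)"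
  define n where "n = (\<lambda>i x y. Dy i KK x y * iF x y ^ 2 + Dy i ric_rest x y)"
  \<comment> \<open>Only the terms in which both derivatives fall on the power of \<open>1/F\<close>
    reach order four; all others are collected in \<open>M\<close>, of order three.\<close>
  define M where "M = (\<lambda>i j x y. -2 * (Dy j (\<lambda>x y. KK x y * f i x y) x y * iF x y ^ 3) + Dy j (n i) x y)"
  have pK: "pol 2 2 (\<lambda>x y. KK x y * iF x y ^ 2)"
    by (rule pol_deg[OF pol_mult[OF pol_KK pol_iF_power[of 2]]]) simp_all
  have pW: "pol 2 2 W"
    unfolding W_def by (rule pol_deg[OF pol_add[OF pK pol_ric_rest]]) simp_all
  have pn: "pol 2 1 (n i)" for i
    unfolding n_def
    by (rule pol_deg[OF pol_add[OF pol_mult[OF pol0_Dy[OF pol_KK] pol_iF_power[of 2]] pol_Dy[OF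
        pol_ric_rest]]]) simp_all
  have pKf: "pol 0 4 (\<lambda>x y. KK x y * f i x y)" for i
    using pol_mult[OF pol_KK pol_f] by simp
  have pM: "pol 3 0 (M i j)" for i j
    unfolding M_def
    by (rule pol_deg[OF pol_add[OF pol_cmult[OF pol_mult[OF pol0_Dy[OF pKf] pol_iF_power[of 3]]] pol_Dy[OF
        pn]]]) simp_all
  have D1: "Dy i W x y = -2 * (KK x y * f i x y * iF x y ^ 3) + n i x y" if "x \<in> U" "y \<noteq> 0" for i x y
    unfolding W_def n_def Dy_add[OF pK pol_ric_rest that] Dy_mult[OF pol_KK pol_iF_power that]
        Dy_iF_power[OF that]
    by (simp add: eval_nat_numeral algebra_simps)
  have D2: "Dy j (Dy i W) x y = 6 * KK x y * iF x y ^ 4 * (f i x y * f j x y) + M i j x y"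
      if xy: "x \<in> U" "y \<noteq> 0" for i j x y
  proof -
    have p3: "pol 3 1 (\<lambda>x y. KK x y * f i x y * iF x y ^ 3)"
      using pol_mult[OF pKf pol_iF_power[of 3]] by simp
    have "Dy j (Dy i W) x y = Dy j (\<lambda>x y. -2 * (KK x y * f i x y * iF x y ^ 3) + n i x y) x y"
      by (rule Dy_cong) (use D1 xy in auto)
    also have "\<dots> = 6 * KK x y * iF x y ^ 4 * (f i x y * f j x y) + M i j x y"
      unfolding M_def Dy_add[OF pol_cmult[OF p3] pn xy] Dy_mult[OF pol_const p3 xy] Dy_mult[OF pKf
          pol_iF_power xy] Dy_iF_power[OF xy] Dy_coef
      by (simp add: eval_nat_numeral algebra_simps)
    finally show ?thesis .
  qed
  define H where "H = (\<lambda>x y. 1/2 * (6 * KK x y * iF x y ^ 4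
      + al x y * iF x y * (\<Sum>i\<in>UNIV. \<Sum>j\<in>UNIV. ai x $ i $ j * M i j x y)
      - 2 * al x y * iF x y ^ 2 * (\<Sum>i\<in>UNIV. V x i * n i x y)
      + 2 * (b2 x * al x y + be x y) * iF x y ^ 3 * ric_rest x y))"
  have "pol 4 0 H"
  proof -
    have 1: "pol 4 0 (\<lambda>x y. 6 * KK x y * iF x y ^ 4)"
      using pol_mult[OF pol_cmult[OF pol_KK] pol_iF_power[of 4]] by simp
    have 2: "pol 4 0 (\<lambda>x y. al x y * iF x y * (\<Sum>i\<in>UNIV. \<Sum>j\<in>UNIV. ai x $ i $ j * M i j x y))"
      by (rule pol_deg[OF pol_mult[OF pol_mult[OF pol_al pol_inv_F] pol_sum[OF pol_sum[OF pol_mult[OF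
          pol_coef[OF smooth_ai] pM]]]]]) simp_all
    have 3: "pol 4 0 (\<lambda>x y. 2 * al x y * iF x y ^ 2 * (\<Sum>i\<in>UNIV. V x i * n i x y))"
      by (rule pol_deg[OF pol_mult[OF pol_mult[OF pol_cmult[OF pol_al] pol_iF_power[of 2]] pol_sum[OF
          pol_mult[OF pol_coef[OF smooth_V] pn]]]]) simp_all
    have 4: "pol 4 0 (\<lambda>x y. 2 * (b2 x * al x y + be x y) * iF x y ^ 3 * ric_rest x y)"
      by (rule pol_deg[OF pol_mult[OF pol_mult[OF pol_cmult[OF pol_add[OF pol_mult[OF pol_coef[OF
          smooth_b2] pol_al] pol_be]] pol_iF_power[of 3]] pol_ric_rest]]) simp_all
    show ?thesis unfolding H_def
      by (rule pol_deg[OF pol_cmult[OF pol_add[OF pol_diff[OF pol_add[OF 1 2] 3] 4]]]) simp_all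
  qed
  moreover have "scalar_curv L x y = 6 * KK x y * (be x y + b2 x * al x y) * iF x y ^ 5 + H x y"
      if xy: "x \<in> U" "y \<noteq> 0" for x y
  proof -
    have R: "ricci_curv L x y = W x y" if "x \<in> U" "y \<noteq> 0" for x y
      unfolding W_def ricci_eq[OF L that] KK_def by simp
    have R1: "Dy i (ricci_curv L) x y = Dy i W x y" if "x \<in> U" "y \<noteq> 0" for i x y
      by (rule Dy_cong) (use R that in auto)
    have R2: "Dy j (Dy i (ricci_curv L)) x y = Dy j (Dy i W) x y" for i j
      by (rule Dy_cong) (use R1 xy in auto)
    let ?W = "\<lambda>i j. Dy j (Dy i W) x y"
    have e1: "(\<Sum>j\<in>UNIV. y $ j * ?W i j) = Dy i W x y" for i
      using euler[OF pol_Dy[OF pW] xy] by simp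
    \<comment> \<open>This sum runs over the inner derivative, so \<open>euler_Dy\<close> is used in
      place of Euler's relation for \<open>Dy i W\<close>.\<close>
    have e2: "(\<Sum>i\<in>UNIV. y $ i * ?W i j) = Dy j W x y" for j
      using euler_Dy[OF pW xy] by simp
    have e3: "(\<Sum>i\<in>UNIV. y $ i * Dy i W x y) = 2 * (KK x y * iF x y ^ 2 + ric_rest x y)"
      using euler[OF pW xy] by (simp add: W_def)
    have VW: "(\<Sum>i\<in>UNIV. V x i * Dy i W x y) = -2 * KK x y * iF x y ^ 3 * (be x y * ial x y + b2 x)
        + (\<Sum>i\<in>UNIV. V x i * n i x y)"
      unfolding D1[OF xy] f_V[OF xy(1), symmetric]
      by (simp add: right_diff_distrib sum_subtractf sum_distrib_left mult_ac)
    have ff: "(\<Sum>i\<in>UNIV. \<Sum>j\<in>UNIV. ai x $ i $ j * (f i x y * f j x y)) = F x y * ial x y + (be x y * ial x y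
        + b2 x)"
    proof -
      have "(\<Sum>i\<in>UNIV. \<Sum>j\<in>UNIV. ai x $ i $ j * (f i x y * f j x y))
          = (\<Sum>i\<in>UNIV. f i x y * up x (\<lambda>l. f l x y) i)"
        by (simp add: up_def sum_distrib_left mult_ac)
      also have "\<dots> = (\<Sum>i\<in>UNIV. f i x y * y $ i) * ial x y + (\<Sum>i\<in>UNIV. f i x y * V x i)"
        unfolding up_f[OF xy(1)] by (simp add: distrib_left sum.distrib sum_distrib_right mult.assoc)
      finally show ?thesis unfolding f_y[OF xy] f_V[OF xy(1)] .
    qed
    have aW: "(\<Sum>i\<in>UNIV. \<Sum>j\<in>UNIV. ai x $ i $ j * ?W i j) = 6 * KK x y * iF x y ^ 4 * (F x y * ial x y
        + (be x y * ial x y + b2 x))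
       + (\<Sum>i\<in>UNIV. \<Sum>j\<in>UNIV. ai x $ i $ j * M i j x y)"
      unfolding D2[OF xy] ff[symmetric] by (simp add: distrib_left sum.distrib sum_distrib_left mult_ac)
    \<comment> \<open>The factor 1/2 in the Ricci tensor turns the 12 of
      \<open>scalar_identity\<close> into the 6 of the claim.\<close>
    have "scalar_curv L x y = 1/2 * (\<Sum>i\<in>UNIV. \<Sum>j\<in>UNIV. gi i j x y * ?W i j)"
      unfolding scalar_curv_def ricci_tensor_def fund_inv_eq[OF L xy] R2 by (simp add: sum_distrib_left)
    also have "(\<Sum>i\<in>UNIV. \<Sum>j\<in>UNIV. gi i j x y * ?W i j) =
        al x y * iF x y * (\<Sum>i\<in>UNIV. \<Sum>j\<in>UNIV. ai x $ i $ j * ?W i j)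
        - al x y * iF x y ^ 2 * (2 * (\<Sum>i\<in>UNIV. V x i * Dy i W x y))
        + (b2 x * al x y + be x y) * iF x y ^ 3 * (\<Sum>i\<in>UNIV. y $ i * Dy i W x y)"
    proof -
      have s1: "(\<Sum>i\<in>UNIV. V x i * Dy i W x y) = (\<Sum>i\<in>UNIV. \<Sum>j\<in>UNIV. V x i * (y $ j * ?W i j))"
        unfolding sum_distrib_left[symmetric] e1 ..
      have s2: "(\<Sum>i\<in>UNIV. V x i * Dy i W x y) = (\<Sum>i\<in>UNIV. \<Sum>j\<in>UNIV. V x j * (y $ i * ?W i j))"
        by (subst sum.swap) (simp add: e2 flip: sum_distrib_left)
      have s3: "(\<Sum>i\<in>UNIV. y $ i * Dy i W x y) = (\<Sum>i\<in>UNIV. \<Sum>j\<in>UNIV. y $ i * (y $ j * ?W i j))"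
        unfolding sum_distrib_left[symmetric] e1 ..
      have "2 * (\<Sum>i\<in>UNIV. V x i * Dy i W x y) = (\<Sum>i\<in>UNIV. \<Sum>j\<in>UNIV. V x i * (y $ j * ?W i j))
          + (\<Sum>i\<in>UNIV. \<Sum>j\<in>UNIV. V x j * (y $ i * ?W i j))"
        using s1 s2 by linarith
      thus ?thesis unfolding s3
        by (simp add: gi_def sum_distrib_left sum.distrib sum_subtractf algebra_simps)
    qed
    also have "\<dots> = 12 * KK x y * (be x y + b2 x * al x y) * iF x y ^ 5
      + (6 * KK x y * iF x y ^ 4 + al x y * iF x y * (\<Sum>i\<in>UNIV. \<Sum>j\<in>UNIV. ai x $ i $ j * M i j x y)
      - 2 * al x y * iF x y ^ 2 * (\<Sum>i\<in>UNIV. V x i * n i x y)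
      + 2 * (b2 x * al x y + be x y) * iF x y ^ 3 * ric_rest x y)"
      unfolding aW VW e3 by (rule scalar_identity[OF al_ial[OF xy] F_iF[OF xy]])
    finally show ?thesis unfolding H_def by argo
  qed
  ultimately show ?thesis using that by blast
qed

end

section \<open>Divisibility along a line\<close>

text \<open>
  Restrictions to a line \<open>t \<mapsto> u + t v\<close> of polynomials in \<open>y\<close>, \<open>\<alpha>\<close>, \<open>1/\<alpha>\<close>, where \<open>A\<close> is the
  restriction of \<open>\<alpha>\<^sup>2\<close>.
\<close>

definition line_poly :: "(real \<Rightarrow> real) \<Rightarrow> (real \<Rightarrow> real) \<Rightarrow> bool" where
  "line_poly A h \<longleftrightarrow> (\<exists>k p q. \<forall>t. complex_of_real (A t ^ k * h t) =
     poly p (of_real t) + of_real (sqrt (A t)) * poly q (of_real t))"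

lemma line_poly_const: "line_poly A (\<lambda>t. c)"
  unfolding line_poly_def by (intro exI[of _ 0] exI[of _ "[:of_real c:]"]) simp

lemma line_poly_linear: "line_poly A (\<lambda>t. c + t * d)"
  unfolding line_poly_def
      by (rule exI[of _ 0], rule exI[of _ "[:of_real c, of_real d:]"], rule exI[of _ 0]) simp

locale line_quadratic =
  fixes A :: "real \<Rightarrow> real" and a0 a1 a2 :: real
  assumes A_pos: "A t > 0" and A_eq: "A t = a0 + a1 * t + a2 * t\<^sup>2"
begin

definition PA :: "complex poly" where "PA = [:of_real a0, of_real a1, of_real a2:]"

lemma poly_PA: "poly PA (of_real t) = of_real (A t)"
  by (simp add: PA_def A_eq algebra_simps power2_eq_square)

lemma sqrt_sq: "complex_of_real (sqrt (A t)) * of_real (sqrt (A t)) = of_real (A t)"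
  using A_pos[of t] by (simp flip: of_real_mult)

lemma line_poly_sqrt: "line_poly A (\<lambda>t. sqrt (A t))"
  unfolding line_poly_def by (rule exI[of _ 0], rule exI[of _ 0], rule exI[of _ 1]) simp

lemma line_poly_inv_sqrt: "line_poly A (\<lambda>t. 1 / sqrt (A t))"
proof -
  have "A t * (1 / sqrt (A t)) = sqrt (A t)" for t
    using A_pos[of t] by (simp add: field_simps)
  thus ?thesis
    unfolding line_poly_def by (intro exI[of _ 1] exI[of _ 0] exI[of _ 1]) simp
qed

lemma line_poly_mult:
  assumes "line_poly A g" "line_poly A h" shows "line_poly A (\<lambda>t. g t * h t)"
proof -
  from assms obtain k p q l r s where
    1: "\<And>t. complex_of_real (A t ^ k * g t) = poly p (of_real t)
        + of_real (sqrt (A t)) * poly q (of_real t)" and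
    2: "\<And>t. complex_of_real (A t ^ l * h t) = poly r (of_real t) + of_real (sqrt (A t)) * poly s (of_real t)"
    unfolding line_poly_def by blast
  have "complex_of_real (A t ^ (k + l) * (g t * h t)) =
      poly (p * r + PA * q * s) (of_real t) + of_real (sqrt (A t)) * poly (p * s + q * r) (of_real t)" for t
  proof -
    have "complex_of_real (A t ^ (k + l) * (g t * h t)) = of_real (A t ^ k * g t) * of_real (A t ^ l * h t)"
      by (simp add: power_add)
    also have "\<dots> = poly (p * r) (of_real t)
        + (of_real (sqrt (A t)) * of_real (sqrt (A t))) * (poly q (of_real t) * poly s (of_real t))
        + of_real (sqrt (A t)) * poly (p * s + q * r) (of_real t)"
      unfolding 1 2 by (simp add: algebra_simps)
    finally show ?thesis unfolding sqrt_sq by (simp add: poly_PA algebra_simps)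
  qed
  thus ?thesis unfolding line_poly_def by blast
qed

lemma line_poly_add:
  assumes "line_poly A g" "line_poly A h" shows "line_poly A (\<lambda>t. g t + h t)"
proof -
  from assms obtain k p q l r s where
    1: "\<And>t. complex_of_real (A t ^ k * g t) = poly p (of_real t)
        + of_real (sqrt (A t)) * poly q (of_real t)" and
    2: "\<And>t. complex_of_real (A t ^ l * h t) = poly r (of_real t) + of_real (sqrt (A t)) * poly s (of_real t)"
    unfolding line_poly_def by blast
  have "complex_of_real (A t ^ (k + l) * (g t + h t)) =
      poly (PA ^ l * p + PA ^ k * r) (of_real t) + of_real (sqrt (A t)) * poly (PA ^ l * q
          + PA ^ k * s) (of_real t)" for t
  proof -
    have "complex_of_real (A t ^ (k + l) * (g t + h t)) =
        of_real (A t) ^ l * of_real (A t ^ k * g t) + of_real (A t) ^ k * of_real (A t ^ l * h t)"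
      by (simp add: power_add algebra_simps)
    thus ?thesis unfolding 1 2 by (simp add: poly_PA algebra_simps)
  qed
  thus ?thesis unfolding line_poly_def by blast
qed

lemma poly_real_eq_0:
  assumes "\<And>t::real. poly p (of_real t) = (0 :: complex)" shows "p = 0"
proof (rule ccontr)
  assume "p \<noteq> 0"
  hence "finite {z. poly p z = 0}" by (rule poly_roots_finite)
  hence "finite (range (of_real :: real \<Rightarrow> complex))"
    by (rule rev_finite_subset) (use assms in auto)
  thus False using finite_imageD[of "of_real :: real \<Rightarrow> complex" UNIV] infinite_UNIV_char_0
    by (auto simp: inj_of_real)
qed

end

lemma nonreal_root:
  fixes c0 c1 c2 :: real
  assumes "c2 > 0" "\<And>t. c0 + c1 * t + c2 * t\<^sup>2 > 0"
  obtains w :: complex where "of_real c0 + of_real c1 * w + of_real c2 * w\<^sup>2 = 0" "Im w \<noteq> 0"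
proof -
  have "\<not> constant (poly [:complex_of_real c0, of_real c1, of_real c2:])"
    using assms(1) by (simp add: constant_degree)
  then obtain w where "poly [:complex_of_real c0, of_real c1, of_real c2:] w = 0"
    using fundamental_theorem_of_algebra by blast
  hence w: "of_real c0 + of_real c1 * w + of_real c2 * w\<^sup>2 = 0"
    by (simp add: algebra_simps power2_eq_square)
  moreover have "Im w \<noteq> 0"
  proof
    assume "Im w = 0"
    hence "w = of_real (Re w)" by (simp add: complex_eq_iff)
    hence "complex_of_real (c0 + c1 * Re w + c2 * (Re w)\<^sup>2) = 0"
      using w by (metis of_real_add of_real_mult of_real_power)
    hence "c0 + c1 * Re w + c2 * (Re w)\<^sup>2 = 0"
      by (simp only: of_real_eq_0_iff)
    thus False using assms(2)[of "Re w"] by simp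
  qed
  ultimately show ?thesis using that by blast
qed

context line_quadratic begin

text \<open>\<open>A\<close> has a simple complex root, so it is not the square of a rational function.\<close>

lemma sqrt_independent:
  fixes X Y :: "complex poly"
  assumes a2: "a2 > 0"
    and eq: "\<And>t. poly X (of_real t) + of_real (sqrt (A t)) * poly Y (of_real t) = 0"
  shows "X = 0 \<and> Y = 0"
proof -
  have "poly (X * X - PA * (Y * Y)) (of_real t) = 0" for t
  proof -
    have "poly X (of_real t) = - of_real (sqrt (A t)) * poly Y (of_real t)"
      using eq[of t] by (simp add: add_eq_0_iff2)
    hence "poly X (of_real t) * poly X (of_real t)
        = (of_real (sqrt (A t)) * of_real (sqrt (A t))) * (poly Y (of_real t) * poly Y (of_real t))"
      by (simp add: mult_ac)
    thus ?thesis unfolding sqrt_sq by (simp add: poly_PA)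
  qed
  hence XY: "X * X = PA * (Y * Y)"
    using poly_real_eq_0[of "X * X - PA * (Y * Y)"] by auto
  obtain z :: complex where z: "of_real a0 + of_real a1 * z + of_real a2 * z\<^sup>2 = 0" "Im z \<noteq> 0"
    using nonreal_root[OF a2, of a0 a1] A_pos A_eq by metis
  have PA0: "PA \<noteq> 0" using a2 by (simp add: PA_def)
  have z1: "poly PA z = 0" using z(1) by (simp add: PA_def algebra_simps power2_eq_square)
  have "cnj (of_real a0 + of_real a1 * z + of_real a2 * z\<^sup>2) = 0" using z(1) by simp
  hence z2: "poly PA (cnj z) = 0" by (simp add: PA_def algebra_simps power2_eq_square)
  \<comment> \<open>Were the root double, the quadratic \<open>PA\<close> would be a constant times
    \<open>(x - z)^2\<close> and could not vanish at the conjugate of \<open>z\<close>, which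
    differs from \<open>z\<close>.\<close>
  have "order z PA = 1"
  proof -
    have "order z PA \<noteq> 0" using z1 PA0 by (simp add: order_root)
    moreover have "\<not> 2 \<le> order z PA"
    proof
      assume "2 \<le> order z PA"
      hence "[:-z, 1:] ^ 2 dvd PA"
        using order_divides by blast
      then obtain r where r: "PA = [:-z, 1:] ^ 2 * r" by (elim dvdE)
      hence r0: "r \<noteq> 0" using PA0 by auto
      have "degree PA = 2" using a2 by (simp add: PA_def)
      hence "degree r = 0" using r r0 by (simp add: degree_mult_eq degree_power_eq)
      then obtain c where "r = [:c:]" by (rule degree_eq_zeroE)
      moreover have "(cnj z - z)\<^sup>2 * poly r (cnj z) = 0"
        using z2 unfolding r by (simp add: poly_power algebra_simps)
      moreover have "cnj z \<noteq> z" using z(2) by (auto simp: complex_eq_iff)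
      ultimately show False using r0 by auto
    qed
    ultimately show ?thesis by linarith
  qed
  \<comment> \<open>A parity argument: orders at \<open>z\<close> double in \<open>X * X\<close> and
    in \<open>Y * Y\<close>, whereas \<open>PA\<close> contributes 1.\<close>
  moreover have "2 * order z X = order z PA + 2 * order z Y" if "Y \<noteq> 0"
  proof -
    have "PA * (Y * Y) \<noteq> 0" using that PA0 by simp
    moreover from this have "X * X \<noteq> 0" using XY by simp
    ultimately show ?thesis
      using XY order_mult[of X X z] order_mult[of PA "Y * Y" z] order_mult[of Y Y z] by simp
  qed
  ultimately have "Y \<noteq> 0 \<Longrightarrow> 2 * order z X = 1 + 2 * order z Y" by metis
  moreover have "2 * i \<noteq> 1 + 2 * j" for i j :: nat by presburger
  ultimately have "Y = 0" by blast
  thus ?thesis using XY by simp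
qed

text \<open>With \<open>h = (p + sqrt A r) / A^k\<close> the hypothesis splits into
  \<open>A r + B p = 0\<close> and \<open>p + B r = E^2 A^k\<close>. Eliminating \<open>p\<close>
  gives \<open>(A - B^2) r = - B E^2 A^k\<close>, whose left side vanishes at a root
  \<open>w\<close> of \<open>A - B^2\<close>. The form is nonreal-rooted by \<open>q\<close>, and
  \<open>A(w) = B(w)^2\<close> is not 0, so \<open>E(w) = 0\<close>.\<close>

lemma line_divisibility:
  assumes a2: "a2 > 0"
    and h: "line_poly A h"
    and b: "b0 \<noteq> 0 \<or> b1 \<noteq> 0"
    and q: "a2 - b1\<^sup>2 > 0" "\<And>t. A t - (b0 + b1 * t)\<^sup>2 > 0"
    and eq: "\<And>t. (e0 + e1 * t + e2 * t\<^sup>2)\<^sup>2 * sqrt (A t) = (sqrt (A t) + (b0 + b1 * t)) * h t"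
  shows "e0 * (a2 - b1\<^sup>2) = e2 * (a0 - b0\<^sup>2)"
proof -
  from h obtain k p r where
    h: "\<And>t. complex_of_real (A t ^ k * h t) = poly p (of_real t) + of_real (sqrt (A t)) * poly r (of_real t)"
    unfolding line_poly_def by blast
  define B E :: "complex poly" where B_def: "B = [:of_real b0, of_real b1:]"
    and E_def: "E = [:of_real e0, of_real e1, of_real e2:]"
  have "PA * r + B * p = 0 \<and> p + B * r - E ^ 2 * PA ^ k = 0"
  proof (rule sqrt_independent[OF a2])
    fix t
    let ?s = "complex_of_real (sqrt (A t))"
    have B: "poly B (of_real t) = of_real (b0 + b1 * t)" by (simp add: B_def algebra_simps)
    have E: "poly E (of_real t) = of_real (e0 + e1 * t + e2 * t\<^sup>2)"
        by (simp add: E_def algebra_simps power2_eq_square)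
    have "complex_of_real (A t ^ k * ((e0 + e1 * t + e2 * t\<^sup>2)\<^sup>2 * sqrt (A t))) =
       (?s + of_real (b0 + b1 * t)) * of_real (A t ^ k * h t)"
      unfolding eq by (simp add: algebra_simps)
    hence "poly (PA ^ k) (of_real t) * (poly E (of_real t))\<^sup>2 * ?s =
       (?s + poly B (of_real t)) * (poly p (of_real t) + ?s * poly r (of_real t))"
      unfolding h B E by (simp add: poly_PA mult.assoc)
    also have "\<dots> = (?s * ?s) * poly r (of_real t) + poly B (of_real t) * poly p (of_real t)
       + ?s * (poly p (of_real t) + poly B (of_real t) * poly r (of_real t))"
      by (simp add: algebra_simps)
    finally show "poly (PA * r + B * p) (of_real t) + ?s * poly (p + B * r - E ^ 2 * PA ^ k) (of_real t) = 0"
      unfolding sqrt_sq by (simp add: poly_PA algebra_simps)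
  qed
  hence 1: "PA * r = - B * p" and 2: "p = E ^ 2 * PA ^ k - B * r"
    by (auto simp: add_eq_0_iff2 algebra_simps)
  have "(PA - B ^ 2) * r = - (B * E ^ 2 * PA ^ k)"
    using 1 unfolding 2 by (simp add: algebra_simps power2_eq_square)
  obtain w :: complex where w: "of_real (a0 - b0\<^sup>2) + of_real (a1 - 2 * b0 * b1) * w + of_real (a2
      - b1\<^sup>2) * w\<^sup>2 = 0" "Im w \<noteq> 0"
  proof (rule nonreal_root[OF q(1)])
    show "a0 - b0\<^sup>2 + (a1 - 2 * b0 * b1) * t + (a2 - b1\<^sup>2) * t\<^sup>2 > 0" for t
      using q(2)[of t] by (simp add: A_eq algebra_simps power2_eq_square)
  qed
  have PB: "poly PA w = (poly B w)\<^sup>2"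
    using w(1) by (simp add: PA_def B_def algebra_simps power2_eq_square)
  hence "poly ((PA - B ^ 2) * r) w = 0" by (simp add: poly_power)
  hence "poly B w * (poly E w)\<^sup>2 * (poly PA w) ^ k = 0"
    unfolding \<open>(PA - B ^ 2) * r = _\<close> by (simp add: poly_power)
  \<comment> \<open>A nonzero real polynomial of degree at most one has no nonreal root. This is
    where \<open>\<beta> \<noteq> 0\<close> on the line enters.\<close>
  moreover have Bw: "poly B w \<noteq> 0"
  proof
    assume "poly B w = 0"
    hence 0: "of_real b0 + w * of_real b1 = 0" by (simp add: B_def)
    have "Im (of_real b0 + w * of_real b1) = Im w * b1" "Re (of_real b0 + w * of_real b1) = b0
        + Re w * b1" by simp_all
    thus False using b w(2) unfolding 0 by auto
  qed
  ultimately have "poly E w = 0" by (simp add: PB)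
  hence E: "of_real e0 + of_real e1 * w + of_real e2 * w\<^sup>2 = 0"
    by (simp add: E_def algebra_simps power2_eq_square)
  \<comment> \<open>The combination removes the term in \<open>w^2\<close>; a real polynomial of
    degree at most one that vanishes at a nonreal point has both coefficients 0.\<close>
  have "complex_of_real (e0 * (a2 - b1\<^sup>2) - e2 * (a0 - b0\<^sup>2)) + of_real (e1 * (a2 - b1\<^sup>2) - e2 * (a1
      - 2 * b0 * b1)) * w =
     of_real (a2 - b1\<^sup>2) * (of_real e0 + of_real e1 * w + of_real e2 * w\<^sup>2)
     - of_real e2 * (of_real (a0 - b0\<^sup>2) + of_real (a1 - 2 * b0 * b1) * w + of_real (a2 - b1\<^sup>2) * w\<^sup>2)"
    by (simp add: algebra_simps)
  hence 0: "complex_of_real (e0 * (a2 - b1\<^sup>2) - e2 * (a0 - b0\<^sup>2)) + of_real (e1 * (a2 - b1\<^sup>2) - e2 * (a1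
      - 2 * b0 * b1)) * w = 0" (is "of_real ?c + of_real ?d * w = 0")
    unfolding E w(1) by simp
  have "Im (of_real ?c + of_real ?d * w) = ?d * Im w" "Re (of_real ?c + of_real ?d * w) = ?c + ?d * Re w"
      by simp_all
  thus ?thesis using w(2) unfolding 0 by auto
qed

end

context line_quadratic begin

lemma line_poly_power: "line_poly A g \<Longrightarrow> line_poly A (\<lambda>t. g t ^ k)"
  by (induction k) (auto intro: line_poly_mult line_poly_const)

end

section \<open>Proportionality of \<open>e_00\<close> and
  \<open>\<alpha>^2 - \<beta>^2\<close>\<close>

context randers_chart begin

text \<open>Equal to \<open>(\<alpha> - \<beta>) F\<close>, hence the quadratic polynomial in
  \<open>y\<close> that vanishes on the cone \<open>F = 0\<close>.\<close>

definition qq :: "'n local_fun" where "qq x y = A2 x y - (be x y)\<^sup>2"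

lemma qq_pos: "x \<in> U \<Longrightarrow> y \<noteq> 0 \<Longrightarrow> 0 < qq x y"
  using abs_be_less[of x y] al_pos[of x y] power2_strict_mono[of "be x y" "al x y"]
      by (simp add: qq_def al_sq)

text \<open>The bound \<open>|\<beta>| < \<alpha>\<close> is tested on the vector \<open>V\<close>,
  where both \<open>\<beta>\<close> and \<open>\<alpha>^2\<close> take the value \<open>b^2\<close>;
  so \<open>b^2 < sqrt (b^2)\<close> unless \<open>V\<close> vanishes.\<close>

lemma b2_less_1: assumes "x \<in> U" shows "b2 x < 1"
proof (cases "\<forall>k. V x k = 0")
  case False
  let ?v = "\<chi> k. V x k"
  have v: "?v \<noteq> 0" using False by (simp add: vec_eq_iff)
  have be: "be x ?v = b2 x" by (simp add: be_def b2_def)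
  have "A2 x ?v = (\<Sum>k\<in>UNIV. Y k x ?v * ?v $ k)" by (rule Y_y[symmetric])
  also have "\<dots> = b2 x"
    unfolding Y_def using a_up[OF assms, of _ "\<lambda>l. b x $ l"] by (simp add: b2_def flip: V_def)
  finally have A: "A2 x ?v = b2 x" .
  have "0 < b2 x" using A2_pos[OF assms v] A by simp
  moreover have "b2 x < sqrt (b2 x)"
    using abs_be_less[OF assms v] be A by (simp add: al_def)
  hence "(b2 x)\<^sup>2 < b2 x"
    using \<open>0 < b2 x\<close> by (metis power_strict_mono less_imp_le pos2 real_sqrt_pow2)
  ultimately show ?thesis by (simp add: power2_eq_square)
qed (simp add: b2_def)

lemma quad_line:
  fixes c :: "'n \<Rightarrow> 'n \<Rightarrow> real"
  shows "(\<Sum>i\<in>UNIV. \<Sum>j\<in>UNIV. c i j * (u + t *\<^sub>R v) $ i * (u + t *\<^sub>R v) $ j) =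
    (\<Sum>i\<in>UNIV. \<Sum>j\<in>UNIV. c i j * u $ i * u $ j)
    + (\<Sum>i\<in>UNIV. \<Sum>j\<in>UNIV. c i j * (u $ i * v $ j + v $ i * u $ j)) * t
    + (\<Sum>i\<in>UNIV. \<Sum>j\<in>UNIV. c i j * v $ i * v $ j) * t\<^sup>2"
proof -
  have "c i j * (u + t *\<^sub>R v) $ i * (u + t *\<^sub>R v) $ j = c i j * u $ i * u $ j
      + c i j * (u $ i * v $ j + v $ i * u $ j) * t + c i j * v $ i * v $ j * t\<^sup>2" for i j
    by (simp add: algebra_simps power2_eq_square)
  thus ?thesis by (simp only: sum.distrib flip: sum_distrib_right)
qed

lemma be_line: "be x (u + t *\<^sub>R v) = be x u + be x v * t"
  by (simp add: be_def distrib_left sum.distrib sum_distrib_left mult_ac)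

text \<open>The factor \<open>F^k\<close> clears the poles, and along the line \<open>F\<close>
  itself is \<open>sqrt A\<close> plus a polynomial of degree one. A pole order larger than
  necessary only multiplies by further powers of \<open>F\<close>.\<close>

lemma line_poly_pol:
  assumes "pol k d H" and x: "x \<in> U" and uv: "\<And>t. u + t *\<^sub>R v \<noteq> 0"
    and lq: "line_quadratic (\<lambda>t. A2 x (u + t *\<^sub>R v)) a0 a1 a2"
  shows "line_poly (\<lambda>t. A2 x (u + t *\<^sub>R v)) (\<lambda>t. F x (u + t *\<^sub>R v) ^ k * H x (u + t *\<^sub>R v))"
proof -
  let ?A = "\<lambda>t. A2 x (u + t *\<^sub>R v)"
  interpret line_quadratic ?A a0 a1 a2 by (rule lq)
  have al: "line_poly ?A (\<lambda>t. al x (u + t *\<^sub>R v))"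
    using line_poly_sqrt by (simp add: al_def)
  have F: "line_poly ?A (\<lambda>t. F x (u + t *\<^sub>R v))"
    using line_poly_add[OF al line_poly_linear[of _ "be x u" "be x v"]]
        by (simp add: F_def be_line mult.commute)
  show ?thesis using assms(1)
  proof (induction rule: pol.induct)
    case (pol_coord i)
    show ?case using line_poly_linear[of ?A "u $ i" "v $ i"] by simp
  next
    case pol_inv_al
    show ?case using line_poly_inv_sqrt by (simp add: ial_def al_def)
  next
    case pol_inv_F
    show ?case using F_iF[OF x uv] by (simp add: line_poly_const)
  next
    case (pol_plus k d H K)
    thus ?case using line_poly_add[OF pol_plus.IH] by (simp add: distrib_left)
  next
    case (pol_mult k d H l e K)
    thus ?case using line_poly_mult[OF pol_mult.IH] by (simp add: power_add mult_ac)
  next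
    case (pol_le k d H l)
    have "F x (u + t *\<^sub>R v) ^ l = F x (u + t *\<^sub>R v) ^ (l - k) * F x (u + t *\<^sub>R v) ^ k" for t
      using pol_le.hyps by (simp flip: power_add)
    thus ?case using line_poly_mult[OF line_poly_power[OF F, of "l - k"] pol_le.IH] by (simp add: mult.assoc)
  next
    case (pol_cong k d H K)
    thus ?case using x uv by simp
  qed (auto simp: line_poly_const al)
qed

text \<open>After multiplication by \<open>F^5\<close> the curvature equation says that
  \<open>e_00^2 \<alpha>\<close> is \<open>F\<close> times a function without pole;
  \<open>line_divisibility\<close> then applies to the line through \<open>u\<close> in the
  direction \<open>v\<close>.\<close>

lemma ee_proportional_aux:
  assumes L: "\<forall>x\<in>U. \<forall>y. L x y = F x y" and x: "x \<in> U"
    and r: "\<And>y. y \<noteq> 0 \<Longrightarrow> scalar_curv L x y =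
        real CARD('n) * (real CARD('n) - 1) * ((\<Sum>i\<in>UNIV. \<theta> i * y $ i) / F x y + \<mu>)"
    and v: "be x v \<noteq> 0"
  shows "ee x u * qq x v = ee x v * qq x u"
proof (cases "\<exists>t. u + t *\<^sub>R v = 0")
  case True
  then obtain c where u: "u = c *\<^sub>R v" by (metis add_eq_0_iff2 scaleR_minus_left)
  have "be x u = c * be x v" "A2 x u = c\<^sup>2 * A2 x v" "ee x u = c\<^sup>2 * ee x v"
    by (simp_all add: u be_def A2_def ee_def sum_distrib_left power2_eq_square mult_ac)
  thus ?thesis by (simp add: qq_def algebra_simps power2_eq_square)
next
  case False
  hence uv: "u + t *\<^sub>R v \<noteq> 0" for t by blast
  have v0: "v \<noteq> 0" using v by (auto simp: be_def)
  \<comment> \<open>In dimension one every line in a nonzero direction passes through 0, which the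
    present case excludes.\<close>
  have n: "real CARD('n) - 1 \<noteq> 0"
  proof
    assume "real CARD('n) - 1 = 0"
    hence "CARD('n) = 1" by simp
    then obtain i :: 'n where i: "UNIV = {i}" by (rule card_1_singletonE)
    hence all: "j = i" for j by auto
    have "v $ i \<noteq> 0" using v0 all by (metis vec_eq_iff zero_index)
    hence "u + (- (u $ i / v $ i)) *\<^sub>R v = 0"
      by (simp add: vec_eq_iff) (metis all divide_self_if mult.commute mult.right_neutral
          times_divide_eq_right nonzero_mult_div_cancel_left)
    thus False using uv by blast
  qed
  define A where "A = (\<lambda>t. A2 x (u + t *\<^sub>R v))"
  define a1 where "a1 = (\<Sum>i\<in>UNIV. \<Sum>j\<in>UNIV. a x $ i $ j * (u $ i * v $ j + v $ i * u $ j))"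
  have lq: "line_quadratic A (A2 x u) a1 (A2 x v)"
  proof
    fix t show "A t > 0" unfolding A_def by (rule A2_pos[OF x uv])
    show "A t = A2 x u + a1 * t + A2 x v * t\<^sup>2"
      unfolding A_def A2_def a1_def by (rule quad_line)
  qed
  interpret line_quadratic A "A2 x u" a1 "A2 x v" by (rule lq)
  obtain H where H: "pol 4 0 H" and rH: "\<And>x y. x \<in> U \<Longrightarrow> y \<noteq> 0 \<Longrightarrow>
    scalar_curv L x y = 6 * KK x y * (be x y + b2 x * al x y) * iF x y ^ 5 + H x y"
    using scalar_pole[OF L] by blast
  define m where "m = real CARD('n) * (real CARD('n) - 1)"
  \<comment> \<open>\<open>9/2\<close> is \<open>6 * 3/4\<close>, from \<open>scalar_pole\<close>
    and \<open>KK\<close>; the factor \<open>1 - b^2\<close> arises from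
    \<open>F - (\<beta> + b^2 \<alpha>) = (1 - b^2) \<alpha>\<close>.\<close>
  define c where "c = 9 / 2 * (real CARD('n) - 1) * (1 - b2 x)"
  have c0: "c \<noteq> 0" using n b2_less_1[OF x] by (simp add: c_def)
  \<comment> \<open>The quotient by \<open>F\<close>: the curvature equation times
    \<open>F^5\<close>, with the leading term \<open>6 K (\<beta> + b^2 \<alpha>)\<close> replaced
    by \<open>6 K F - c e_00^2 \<alpha>\<close>.\<close>
  define g where "g = (\<lambda>y. 6 * KK x y + F x y ^ 4 * H x y - m * ((\<Sum>i\<in>UNIV. \<theta> i * y $ i) * F x y ^ 3
      + \<mu> * F x y ^ 4))"
  have g: "c * ((ee x y)\<^sup>2 * al x y) = F x y * g y" if y: "y \<noteq> 0" for y
  proof -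
    let ?F = "F x y" and ?T = "\<Sum>i\<in>UNIV. \<theta> i * y $ i"
    have "6 * KK x y * (be x y + b2 x * al x y) * iF x y ^ 5 + H x y = m * (?T * iF x y + \<mu>)"
      using r[OF y] rH[OF x y] by (simp add: m_def iF_def)
    hence "?F ^ 5 * (6 * KK x y * (be x y + b2 x * al x y) * iF x y ^ 5 + H x y)
        = ?F ^ 5 * (m * (?T * iF x y + \<mu>))"
      by simp
    moreover have "?F ^ 5 * (6 * KK x y * (be x y + b2 x * al x y) * iF x y ^ 5 + H x y)
       = 6 * KK x y * (be x y + b2 x * al x y) * (?F * iF x y) ^ 5 + ?F ^ 5 * H x y"
      by (simp add: algebra_simps power_mult_distrib)
    moreover have "?F ^ 5 * (m * (?T * iF x y + \<mu>)) = m * (?T * ?F ^ 4 * (?F * iF x y) + \<mu> * ?F ^ 5)"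
      by (simp add: algebra_simps eval_nat_numeral)
    ultimately have "6 * KK x y * (be x y + b2 x * al x y) + ?F ^ 5 * H x y = m * (?T * ?F ^ 4 + \<mu> * ?F ^ 5)"
      unfolding F_iF[OF x y] by simp
    moreover have "c * ((ee x y)\<^sup>2 * al x y) = 6 * KK x y * (F x y - (be x y + b2 x * al x y))"
      by (simp add: c_def KK_def F_def field_simps)
    ultimately show ?thesis
      by (simp add: g_def algebra_simps eval_nat_numeral)
  qed
  note lp = line_poly_pol[OF _ x uv lq[unfolded A_def], folded A_def]
  have lF: "line_poly A (\<lambda>t. F x (u + t *\<^sub>R v))"
    using lp[OF pol_F] by simp
  have "line_poly A (\<lambda>t. 6 * (F x (u + t *\<^sub>R v) ^ 0 * KK x (u + t *\<^sub>R v)) + F x (u + t *\<^sub>R v) ^ 4 * H x (u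
      + t *\<^sub>R v)
     + (- m) * (((\<Sum>i\<in>UNIV. \<theta> i * u $ i) + t * (\<Sum>i\<in>UNIV. \<theta> i * v $ i)) * F x (u + t *\<^sub>R v) ^ 3 + \<mu> * F x (u
         + t *\<^sub>R v) ^ 4))"
    by (intro line_poly_add line_poly_mult line_poly_const line_poly_linear line_poly_power lF lp[OF H]
        lp[OF pol_KK])
  hence "line_poly A (\<lambda>t. (1 / c) * g (u + t *\<^sub>R v))"
    by (intro line_poly_mult line_poly_const)
       (simp add: g_def sum.distrib sum_distrib_left algebra_simps)
  moreover have "(ee x (u + t *\<^sub>R v))\<^sup>2 * al x (u + t *\<^sub>R v) = F x (u + t *\<^sub>R v) * ((1 / c) * g (u
      + t *\<^sub>R v))" for t
    using g[OF uv, of t] c0 by (simp add: field_simps)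
  moreover have "ee x (u + t *\<^sub>R v) = ee x u + (\<Sum>i\<in>UNIV. \<Sum>j\<in>UNIV. EE x i j * (u $ i * v $ j
      + v $ i * u $ j)) * t + ee x v * t\<^sup>2" for t
    unfolding ee_def by (rule quad_line)
  ultimately have "ee x u * (A2 x v - (be x v)\<^sup>2) = ee x v * (A2 x u - (be x u)\<^sup>2)"
    by (intro line_divisibility[OF A2_pos[OF x v0], of "\<lambda>t. (1 / c) * g (u + t *\<^sub>R v)" "be x u" "be x v"])
       (use v qq_pos[OF x v0] qq_pos[OF x uv] in \<open>auto simp: qq_def A_def be_line F_def al_def\<close>)
  thus ?thesis by (simp add: qq_def)
qed

lemma smooth_quad: "(\<And>i j. smooth_on U (\<lambda>x. c x i j)) \<Longrightarrow>
   smooth_on U (\<lambda>x. \<Sum>i\<in>UNIV. \<Sum>j\<in>UNIV. c x i j * y $ i * y $ j)"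
  by (intro smooth_on_sum smooth_on_mult smooth_on_const open_U)

lemma smooth_ee: "smooth_on U (\<lambda>x. ee x y)"
  unfolding ee_def by (intro smooth_quad smooth_EE)

lemma smooth_qq: "smooth_on U (\<lambda>x. qq x y)"
  unfolding qq_def A2_def be_def power2_eq_square
  by (intro smooth_on_diff smooth_quad smooth_a smooth_on_mult smooth_on_sum smooth_on_const smooth_b open_U)

text \<open>
  Where \<open>\<beta>\<close> vanishes at a point the pole argument says nothing, but the points with \<open>\<beta> \<noteq> 0\<close>
  together with the interior of the zero set of \<open>\<beta>\<close> are dense.
\<close>

lemma ee_proportional:
  assumes L: "\<forall>x\<in>U. \<forall>y. L x y = F x y"
    and r: "\<And>x y. x \<in> U \<Longrightarrow> y \<noteq> 0 \<Longrightarrow> scalar_curv L x y =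
        real CARD('n) * (real CARD('n) - 1) * ((\<Sum>i\<in>UNIV. \<theta> x i * y $ i) / F x y + \<mu> x)"
    and x: "x \<in> U"
  shows "ee x u * qq x v = ee x v * qq x u"
proof (rule ccontr)
  define g where "g = (\<lambda>x. ee x u * qq x v - ee x v * qq x u)"
  assume "ee x u * qq x v \<noteq> ee x v * qq x u"
  hence gx: "g x \<noteq> 0" by (simp add: g_def)
  have "continuous_on U g"
    unfolding g_def by (intro smooth_on_continuous smooth_on_diff smooth_on_mult smooth_ee smooth_qq)
  hence op: "open (U \<inter> g -` (- {0}))"
    using open_U by (intro continuous_open_preimage) auto
  have b0: "b z $ i = 0" if z: "z \<in> U \<inter> g -` (- {0})" for z i
  proof (rule ccontr)
    assume "b z $ i \<noteq> 0"
    moreover have "be z (axis i 1) = b z $ i"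
      by (simp add: be_def axis_def if_distrib cong: if_cong)
    ultimately have w: "be z (axis i 1) \<noteq> 0" by simp
    have zU: "z \<in> U" using z by simp
    define w where "w = axis i (1 :: real)"
    \<comment> \<open>The line argument needs a direction on which \<open>\<beta>\<close> is not 0,
      so \<open>u\<close> and \<open>v\<close> are each compared with \<open>w\<close>.\<close>
    have p: "ee z u * qq z w = ee z w * qq z u" "ee z v * qq z w = ee z w * qq z v"
      using ee_proportional_aux[OF L zU r[OF zU] w] by (simp_all add: w_def)
    have "qq z w \<noteq> 0" using qq_pos[OF zU, of w] by (simp add: w_def)
    moreover have "(ee z u * qq z v - ee z v * qq z u) * qq z w = 0"
      using p by algebra
    ultimately have "g z = 0" by (simp add: g_def)
    thus False using z by simp
  qed
  have xS: "x \<in> U \<inter> g -` (- {0})" using x gx by simp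
  \<comment> \<open>Now \<open>\<beta>\<close> vanishes in a whole neighbourhood of
    \<open>x\<close>, so its first derivatives vanish too and \<open>e_00\<close> is 0 at
    \<open>x\<close>.\<close>
  have "db m x i = partial m (\<lambda>_. 0) x" for m i
    unfolding db_def by (rule partial_cong[OF op xS]) (use b0 in auto)
  moreover have "V x k = 0" for k
    using b0[OF xS] by (simp add: V_def up_def)
  ultimately have "EE x i j = 0" for i j
    using b0[OF xS] by (simp add: EE_def)
  hence "ee x w = 0" for w by (simp add: ee_def)
  thus False using gx by (simp add: g_def)
qed

end

section \<open>Determinants and volumes of ellipsoids\<close>

lemma det_shear:
  fixes m n :: "'n::finite"
  assumes "m \<noteq> n"
  shows "det (matrix (\<lambda>x::real^'n. \<chi> i. if i = m then x $ m + x $ n else x $ i)) = 1"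
proof -
  have "matrix (\<lambda>x::real^'n. \<chi> i. if i = m then x $ m + x $ n else x $ i) =
      (\<chi> k. if k = m then row m (mat 1) + 1 *s row n (mat 1) else row k (mat 1))"
    using assms by (auto simp: matrix_def row_def mat_def axis_def vec_eq_iff)
  thus ?thesis by (simp only: det_row_operation[OF assms] det_I)
qed

text \<open>
  The library has this for a well-ordered index type only, the order being used to compute the
  determinant of a shear.
\<close>

lemma measure_linear_image_finite:
  fixes g :: "real^'n::finite \<Rightarrow> real^'n"
  assumes "linear g" "S \<in> lmeasurable"
  shows "g ` S \<in> lmeasurable \<and> measure lebesgue (g ` S) = \<bar>det (matrix g)\<bar> * measure lebesgue S"
proof -
  define P where "P = (\<lambda>g :: real^'n \<Rightarrow> real^'n. \<forall>S\<in>lmeasurable.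
    g ` S \<in> lmeasurable \<and> measure lebesgue (g ` S) = \<bar>det (matrix g)\<bar> * measure lebesgue S)"
  have suff: "P g" if "linear g"
    "\<And>a b. cbox a b \<noteq> {} \<Longrightarrow> measure lebesgue (g ` cbox a b)
        = \<bar>det (matrix g)\<bar> * measure lebesgue (cbox a b)" for g
    unfolding P_def
  proof
    fix S :: "(real^'n) set" assume "S \<in> lmeasurable"
    have "measure lebesgue (g ` cbox a b) = \<bar>det (matrix g)\<bar> * measure lebesgue (cbox a b)" for a b
      using that(2)[of a b] by (cases "cbox a b = {}") auto
    from measure_linear_sufficient[OF that(1) \<open>S \<in> lmeasurable\<close> this]
    show "g ` S \<in> lmeasurable \<and> measure lebesgue (g ` S) = \<bar>det (matrix g)\<bar> * measure lebesgue S"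
      by simp
  qed
  have "P g"
  proof (rule induct_linear_elementary[OF assms(1)])
    fix g h :: "real^'n \<Rightarrow> real^'n" assume "linear g" "linear h" "P g" "P h"
    show "P (g \<circ> h)"
      unfolding P_def
    proof
      fix S :: "(real^'n) set" assume "S \<in> lmeasurable"
      moreover have "(g \<circ> h) ` S = g ` h ` S" by (simp add: image_comp)
      ultimately show "(g \<circ> h) ` S \<in> lmeasurable \<and>
          measure lebesgue ((g \<circ> h) ` S) = \<bar>det (matrix (g \<circ> h))\<bar> * measure lebesgue S"
        using \<open>P g\<close> \<open>P h\<close> matrix_compose[OF \<open>linear h\<close> \<open>linear g\<close>]
        unfolding P_def by (simp add: det_mul abs_mult)
    qed
  next
    fix g :: "real^'n \<Rightarrow> real^'n" and i assume g: "linear g" "\<And>x. g x $ i = 0"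
    hence "\<not> inj g"
      by (metis linear_injective_imp_surjective surjE one_neq_zero vec_component)
    hence "negligible (g ` S)" "det (matrix g) = 0" for S
      using g(1) negligible_linear_singular_image det_nz_iff_inj by blast+
    thus "P g" by (simp add: P_def negligible_iff_measure)
  next
    fix c :: "'n \<Rightarrow> real"
    have "matrix (\<lambda>x::real^'n. \<chi> i. c i * x $ i) = (\<chi> i j. c i * of_bool (i = j))"
      by (auto simp: matrix_def axis_def vec_eq_iff)
    thus "P (\<lambda>x. \<chi> i. c i * x $ i)"
      by (simp add: P_def measurable_stretch measure_stretch det_diagonal)
  next
    fix m n :: 'n assume mn: "m \<noteq> n"
    let ?h = "\<lambda>x::real^'n. \<chi> i. x $ Transposition.transpose m n i"
    show "P ?h"
    proof (rule suff)
      show "linear ?h" by (rule linearI) (simp_all add: vec_eq_iff)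
      have "matrix ?h = (\<chi> i. (mat 1 :: real^'n^'n) $ Transposition.transpose m n i)"
        by (auto simp: matrix_def axis_def mat_def vec_eq_iff)
      hence "\<bar>det (matrix ?h)\<bar> = 1"
        by (simp add: det_permute_rows permutes_swap_id abs_mult sign_swap_id)
      moreover fix a b :: "real^'n" assume ne: "cbox a b \<noteq> {}"
      have "?h ` cbox a b = cbox (?h a) (?h b)"
      proof (intro equalityI subsetI)
        fix y assume y: "y \<in> cbox (?h a) (?h b)"
        have "?h y \<in> cbox a b"
          unfolding mem_box_cart
        proof
          fix i show "a $ i \<le> ?h y $ i \<and> ?h y $ i \<le> b $ i"
            using y[unfolded mem_box_cart, rule_format, of "Transposition.transpose m n i"] by simp
        qed
        moreover have "y = ?h (?h y)" by (simp add: vec_eq_iff)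
        ultimately show "y \<in> ?h ` cbox a b" by blast
      qed (auto simp: mem_box_cart)
      moreover from this have "cbox (?h a) (?h b) \<noteq> {}" using ne by blast
      moreover have "(\<Prod>i\<in>UNIV. b $ Transposition.transpose m n i - a $ Transposition.transpose m n i)
          = (\<Prod>i\<in>UNIV. b $ i - a $ i)"
        by (rule prod.reindex_bij_betw[of "Transposition.transpose m n" UNIV UNIV "\<lambda>i. b $ i - a $ i"]) simp
      ultimately show "measure lebesgue (?h ` cbox a b) = \<bar>det (matrix ?h)\<bar> * measure lebesgue (cbox a b)"
        using ne by (simp add: content_cbox_cart)
    qed
  next
    fix m n :: 'n assume mn: "m \<noteq> n"
    let ?h = "\<lambda>x::real^'n. \<chi> i. if i = m then x $ m + x $ n else x $ i"
    have lin: "linear ?h"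
      by (rule linearI) (auto simp: vec_eq_iff algebra_simps)
    show "P ?h"
    proof (rule suff[OF lin])
      fix a b :: "real^'n" assume ne: "cbox a b \<noteq> {}"
      have c: "cbox a b = (+) a ` cbox 0 (b - a)"
        using cbox_translation[of a 0 "b - a"] by simp
      have "?h ` cbox a b = (+) (?h a) ` (?h ` cbox 0 (b - a))"
        unfolding c image_image using linear_add[OF lin] by simp
      hence "measure lebesgue (?h ` cbox a b) = measure lebesgue (?h ` cbox 0 (b - a))"
        by (simp only: measure_translation)
      also have "\<dots> = measure lebesgue (cbox 0 (b - a))"
        using mn ne c by (intro measure_shear_interval) auto
      also have "\<dots> = measure lebesgue (cbox a b)"
        unfolding c measure_translation ..
      finally show "measure lebesgue (?h ` cbox a b) = \<bar>det (matrix ?h)\<bar> * measure lebesgue (cbox a b)"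
        using det_shear[OF mn] by simp
    qed
  qed
  thus ?thesis using assms(2) by (simp add: P_def)
qed

locale posdef_matrix =
  fixes Q :: "real^'n::finite^'n"
  assumes sym: "Q $ i $ j = Q $ j $ i"
    and pos: "y \<noteq> 0 \<Longrightarrow> y \<bullet> (Q *v y) > 0"
begin

lemma inner_sym: "u \<bullet> (Q *v w) = w \<bullet> (Q *v u)"
proof -
  have "transpose Q = Q" by (simp add: transpose_def vec_eq_iff sym)
  thus ?thesis by (metis dot_lmul_matrix inner_commute transpose_matrix_vector)
qed

text \<open>Gram-Schmidt for the inner product of \<open>Q\<close>. A set of fewer than
  \<open>n\<close> vectors does not span, which supplies the next vector.\<close>

lemma orthonormal_set:
  assumes "k \<le> CARD('n)"
  shows "\<exists>S. finite S \<and> card S = k \<and> (\<forall>u\<in>S. \<forall>w\<in>S. u \<bullet> (Q *v w) = of_bool (u = w))"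
  using assms
proof (induction k)
  case 0
  show ?case by (intro exI[of _ "{}"]) simp
next
  case (Suc k)
  then obtain S where S: "finite S" "card S = k" and on: "\<And>u w. u \<in> S \<Longrightarrow> w \<in> S \<Longrightarrow> u \<bullet> (Q *v w) = of_bool (u
      = w)"
    by auto
  have "dim (span S) < CARD('n)"
    using dim_le_card'[OF S(1)] S(2) Suc.prems by simp
  hence "span S \<noteq> UNIV" by (metis dim_UNIV less_irrefl DIM_cart DIM_real mult.right_neutral)
  then obtain w where w: "w \<notin> span S" by blast
  define w' where "w' = w - (\<Sum>s\<in>S. (s \<bullet> (Q *v w)) *\<^sub>R s)"
  have "w' \<noteq> 0"
  proof
    assume "w' = 0"
    hence "w = (\<Sum>s\<in>S. (s \<bullet> (Q *v w)) *\<^sub>R s)" by (simp add: w'_def)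
    also have "\<dots> \<in> span S" by (intro span_sum span_scale span_base)
    finally show False using w by simp
  qed
  hence p: "w' \<bullet> (Q *v w') > 0" by (rule pos)
  have orth: "w' \<bullet> (Q *v u) = 0" if "u \<in> S" for u
  proof -
    have "w' \<bullet> (Q *v u) = w \<bullet> (Q *v u) - (\<Sum>s\<in>S. (s \<bullet> (Q *v w)) * (s \<bullet> (Q *v u)))"
      by (simp add: w'_def inner_diff_left inner_sum_left)
    also have "(\<Sum>s\<in>S. (s \<bullet> (Q *v w)) * (s \<bullet> (Q *v u))) = (\<Sum>s\<in>S. if s = u then s \<bullet> (Q *v w) else 0)"
      by (rule sum.cong) (auto simp: on that)
    also have "\<dots> = w \<bullet> (Q *v u)" using S(1) that inner_sym by simp
    finally show ?thesis by simp
  qed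
  define u where "u = (1 / sqrt (w' \<bullet> (Q *v w'))) *\<^sub>R w'"
  have uu: "u \<bullet> (Q *v u) = 1"
    using p by (simp add: u_def matrix_vector_mult_scaleR)
  have us: "u \<bullet> (Q *v s) = 0" if "s \<in> S" for s
    using orth[OF that] by (simp add: u_def)
  have "u \<notin> S" using us[of u] uu by auto
  show ?case
  proof (intro exI conjI ballI)
    show "finite (insert u S)" "card (insert u S) = Suc k" using S \<open>u \<notin> S\<close> by auto
    fix v w assume "v \<in> insert u S" "w \<in> insert u S"
    thus "v \<bullet> (Q *v w) = of_bool (v = w)"
      using uu us[of w] us[of v] on[of v w] \<open>u \<notin> S\<close> inner_sym[of v u]
      by (elim insertE) (simp_all split: if_splits, auto)
  qed
qed

lemma orthonormalize:
  obtains M :: "real^'n^'n" where "transpose M ** Q ** M = mat 1"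
proof -
  obtain S where S: "finite S" "card S = CARD('n)" and on: "\<And>u w. u \<in> S \<Longrightarrow> w \<in> S \<Longrightarrow> u \<bullet> (Q *v w)
      = of_bool (u = w)"
    using orthonormal_set[of "CARD('n)"] by auto
  then obtain h where h: "bij_betw h (UNIV :: 'n set) S"
    using finite_same_card_bij[of "UNIV :: 'n set" S] by auto
  define M :: "real^'n^'n" where "M = (\<chi> i j. h j $ i)"
  have "(transpose M ** Q ** M) $ i $ j = h i \<bullet> (Q *v h j)" for i j
    by (simp add: M_def matrix_matrix_mult_def transpose_def inner_vec_def matrix_vector_mult_def
        sum_distrib_left sum_distrib_right mult.assoc) (rule sum.swap)
  also have "h i \<bullet> (Q *v h j) = of_bool (i = j)" for i j
    using on[of "h i" "h j"] h by (auto simp: bij_betw_def inj_on_eq_iff)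
  finally have "transpose M ** Q ** M = mat 1"
    by (simp add: vec_eq_iff mat_def)
  thus ?thesis using that by blast
qed

lemma det_pos: "det Q > 0"
proof -
  obtain M :: "real^'n^'n" where M: "transpose M ** Q ** M = mat 1" by (rule orthonormalize)
  have "det M ^ 2 * det Q = 1"
    using arg_cong[OF M, of det] by (simp add: det_mul det_transpose power2_eq_square mult_ac)
  thus ?thesis by (metis zero_less_mult_iff zero_less_one zero_le_power2 not_less)
qed

text \<open>The matrix \<open>M\<close> from \<open>orthonormalize\<close> maps the round ball of
  radius \<open>sqrt c\<close> onto the ellipsoid, and \<open>M^T Q M = 1\<close> forces
  \<open>|det M| = 1 / sqrt (det Q)\<close>.\<close>

lemma ellipsoid_volume:
  assumes c: "c > 0"
  shows "measure lborel {y. y \<bullet> (Q *v y) < c}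
      = sqrt c ^ CARD('n) / sqrt (det Q) * measure lborel (ball (0::real^'n) 1)"
proof -
  obtain M :: "real^'n^'n" where M: "transpose M ** Q ** M = mat 1" by (rule orthonormalize)
  have d: "det M ^ 2 * det Q = 1"
    using arg_cong[OF M, of det] by (simp add: det_mul det_transpose power2_eq_square mult_ac)
  have "det M \<noteq> 0" using d by auto
  hence inv: "invertible M" by (simp add: invertible_det_nz)
  have q: "(M *v z) \<bullet> (Q *v (M *v z)) = z \<bullet> z" for z
  proof -
    have "z \<bullet> (transpose M *v w) = w \<bullet> (M *v z)" for w
      by (simp add: transpose_matrix_vector inner_commute[of z] dot_lmul_matrix)
    hence "(M *v z) \<bullet> (Q *v (M *v z)) = z \<bullet> ((transpose M ** Q ** M) *v z)"
      by (simp add: matrix_vector_mul_assoc[symmetric] inner_commute)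
    thus ?thesis by (simp add: M)
  qed
  have "{y. y \<bullet> (Q *v y) < c} = (*v) M ` ball 0 (sqrt c)"
  proof (intro equalityI subsetI)
    fix y assume y: "y \<in> {y. y \<bullet> (Q *v y) < c}"
    define z where "z = matrix_inv M *v y"
    have yz: "y = M *v z" by (simp add: z_def matrix_vector_mul_assoc invertible_matrix_inv[OF inv])
    have "z \<bullet> z < c" using y q[of z] yz by simp
    hence "norm z < sqrt c" by (simp add: norm_eq_sqrt_inner)
    thus "y \<in> (*v) M ` ball 0 (sqrt c)" using yz by auto
  next
    fix y assume "y \<in> (*v) M ` ball 0 (sqrt c)"
    then obtain z where z: "y = M *v z" "norm z < sqrt c" by auto
    have "z \<bullet> z < c" using z(2) by (simp add: norm_eq_sqrt_inner)
    thus "y \<in> {y. y \<bullet> (Q *v y) < c}" using q[of z] z(1) by simp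
  qed
  moreover have "open {y. y \<bullet> (Q *v y) < c}"
    by (intro open_Collect_less continuous_intros linear_continuous_on matrix_vector_mul_bounded_linear)
  ultimately have "measure lborel {y. y \<bullet> (Q *v y) < c} = measure lebesgue ((*v) M ` ball 0 (sqrt c))"
    by (metis borel_open measure_completion sets_lborel)
  also have "\<dots> = \<bar>det M\<bar> * measure lebesgue (ball (0::real^'n) (sqrt c))"
    using measure_linear_image_finite[OF matrix_vector_mul_linear[of M] lmeasurable_ball] by simp
  also have "measure lebesgue (ball (0::real^'n) (sqrt c))
      = sqrt c ^ CARD('n) * measure lborel (ball (0::real^'n) 1)"
    using content_ball_conv_unit_ball[of "sqrt c" "0::real^'n"] c by simp
  also have "\<bar>det M\<bar> = 1 / sqrt (det Q)"
  proof -
    have "sqrt (det M ^ 2 * det Q) = 1" using d by simp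
    hence "\<bar>det M\<bar> * sqrt (det Q) = 1" by (simp add: real_sqrt_mult)
    thus ?thesis using det_pos by (simp add: field_simps)
  qed
  finally show ?thesis by simp
qed

end

section \<open>The derivative of a determinant\<close>

lemma partial_prod:
  fixes g :: "'b \<Rightarrow> real^'n::finite \<Rightarrow> real"
  assumes "finite J" "\<And>i. i \<in> J \<Longrightarrow> g i differentiable (at x)"
  shows "(\<lambda>z. \<Prod>i\<in>J. g i z) differentiable (at x) \<and>
    partial m (\<lambda>z. \<Prod>i\<in>J. g i z) x = (\<Sum>i\<in>J. partial m (g i) x * (\<Prod>j\<in>J - {i}. g j x))"
  using assms
proof (induction J rule: finite_induct)
  case (insert k J)
  have "(\<Prod>j\<in>insert k J - {i}. g j x) = g k x * (\<Prod>j\<in>J - {i}. g j x)" if "i \<in> J" for i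
  proof -
    have "insert k J - {i} = insert k (J - {i})" using insert that by auto
    thus ?thesis using insert by simp
  qed
  moreover have "insert k J - {k} = J" using insert by auto
  ultimately show ?case using insert
    by (auto simp: partial_mult sum_distrib_left mult_ac intro!: sum.cong)
qed simp

lemma partial_det:
  fixes A :: "real^'m::finite \<Rightarrow> real^'n::finite^'n"
  assumes "\<And>i j. (\<lambda>z. A z $ i $ j) differentiable (at x)"
  shows "(\<lambda>z. det (A z)) differentiable (at x)"
    and partial_det_mat_1: "A x = mat 1 \<Longrightarrow> partial m (\<lambda>z. det (A z)) x
        = (\<Sum>i\<in>UNIV. partial m (\<lambda>z. A z $ i $ i) x)"
proof -
  let ?T = "\<lambda>p z. \<Prod>i\<in>UNIV. A z $ i $ p i"
  have T: "?T p differentiable (at x)" for p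
    using partial_prod[of UNIV "\<lambda>i z. A z $ i $ p i" x] assms by simp
  show "(\<lambda>z. det (A z)) differentiable (at x)"
    unfolding det_def by (intro differentiable_sum differentiable_mult differentiable_const T ballI) simp_all
  assume A1: "A x = mat 1"
  have z: "partial m (?T p) x = 0" if p: "p permutes UNIV" "p \<noteq> id" for p
  proof -
    have "(\<Prod>j\<in>UNIV - {i}. A x $ j $ p j) = 0" for i
    proof -
      obtain k where k: "p k \<noteq> k" using p(2) by (auto simp: fun_eq_iff)
      \<comment> \<open>A permutation other than the identity moves at least two indices. Even with
        the factor \<open>i\<close> left out, an off-diagonal entry of the identity matrix remains,
        and it is 0.\<close>
      have "p (p k) \<noteq> p k" using k permutes_inj[OF p(1)] by (auto simp: inj_eq)
      then obtain j where "j \<noteq> i" "p j \<noteq> j" using k by metis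
      thus ?thesis by (intro prod_zero) (auto simp: A1 mat_def intro!: bexI[of _ j])
    qed
    thus ?thesis using partial_prod[of UNIV "\<lambda>i z. A z $ i $ p i" x m] assms by (simp del: prod_zero_iff)
  qed
  have "partial m (\<lambda>z. det (A z)) x = (\<Sum>p | p permutes UNIV. of_int (sign p) * partial m (?T p) x)"
    unfolding det_def using T
    by (subst partial_sum) (auto simp: partial_cmult finite_permutations intro!: differentiable_mult)
  also have "\<dots> = (\<Sum>p | p permutes (UNIV :: 'n set). if p = id then partial m (?T id) x else 0)"
    by (rule sum.cong) (auto simp: z sign_id)
  also have "\<dots> = partial m (?T id) x"
    by (simp add: finite_permutations permutes_id)
  also have "\<dots> = (\<Sum>i\<in>UNIV. partial m (\<lambda>z. A z $ i $ i) x)"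
    using partial_prod[of UNIV "\<lambda>i z. A z $ i $ i" x m] assms by (simp add: A1 mat_def)
  finally show "partial m (\<lambda>z. det (A z)) x = (\<Sum>i\<in>UNIV. partial m (\<lambda>z. A z $ i $ i) x)" .
qed

text \<open>Multiplying by the constant matrix \<open>B\<close> moves the base point to the identity
  matrix, where only the diagonal contributes to first order.\<close>

lemma jacobi_formula:
  fixes A :: "real^'m::finite \<Rightarrow> real^'n::finite^'n"
  assumes d: "\<And>i j. (\<lambda>z. A z $ i $ j) differentiable (at x)" and B: "B ** A x = mat 1"
  shows "partial m (\<lambda>z. det (A z)) x
      = det (A x) * (\<Sum>i\<in>UNIV. \<Sum>j\<in>UNIV. B $ i $ j * partial m (\<lambda>z. A z $ j $ i) x)"
proof -
  have e: "(B ** A z) $ i $ j = (\<Sum>k\<in>UNIV. B $ i $ k * A z $ k $ j)" for z i j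
    by (simp add: matrix_matrix_mult_def)
  have "(\<lambda>z. (B ** A z) $ i $ j) differentiable (at x)" for i j
    unfolding e using d by (intro differentiable_sum differentiable_mult differentiable_const) auto
  from partial_det_mat_1[of "\<lambda>z. B ** A z", OF this B, of m]
  have "partial m (\<lambda>z. det B * det (A z)) x = (\<Sum>i\<in>UNIV. partial m (\<lambda>z. \<Sum>k\<in>UNIV. B $ i $ k * A z $ k $ i) x)"
    by (simp add: det_mul e)
  hence "det B * partial m (\<lambda>z. det (A z)) x = (\<Sum>i\<in>UNIV. \<Sum>k\<in>UNIV. B $ i $ k * partial m (\<lambda>z. A z $ k $ i) x)"
    using d partial_det(1)[of A, OF d] by (simp add: partial_cmult partial_sum)
  hence "det (A x) * det B * partial m (\<lambda>z. det (A z)) x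
      = det (A x) * (\<Sum>i\<in>UNIV. \<Sum>k\<in>UNIV. B $ i $ k * partial m (\<lambda>z. A z $ k $ i) x)"
    by (simp add: mult.assoc)
  moreover have "det (A x) * det B = 1"
    using arg_cong[OF B, of det] by (simp add: det_mul mult.commute)
  ultimately show ?thesis by simp
qed

section \<open>The Busemann-Hausdorff volume of a Randers metric\<close>

context randers_chart begin

definition lam :: "real^'n \<Rightarrow> real" where "lam x = 1 - b2 x"

text \<open>The matrix of \<open>\<alpha>^2 - \<beta>^2\<close>. In Zermelo's navigation picture
  \<open>lam * Q\<close> is the Riemannian metric and \<open>- V / lam\<close> the wind: the unit
  ball of \<open>F\<close> is the unit ball of that metric, translated by the wind.\<close>

definition Q :: "real^'n \<Rightarrow> real^'n^'n" where "Q x = (\<chi> i j. a x $ i $ j - b x $ i * b x $ j)"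

lemma lam_pos: "x \<in> U \<Longrightarrow> 0 < lam x"
  using b2_less_1 by (simp add: lam_def)

lemma Q_qq: "y \<bullet> (Q x *v y) = qq x y"
proof -
  have "y \<bullet> (Q x *v y) = (\<Sum>i\<in>UNIV. \<Sum>j\<in>UNIV. a x $ i $ j * y $ i * y $ j
      - (b x $ i * y $ i) * (b x $ j * y $ j))"
    unfolding inner_vec_def matrix_vector_mult_def Q_def
    by (simp add: sum_distrib_left algebra_simps)
  also have "\<dots> = qq x y"
    by (simp add: qq_def A2_def be_def power2_eq_square sum_product sum_subtractf)
  finally show ?thesis .
qed

lemma posdef_Q: "x \<in> U \<Longrightarrow> posdef_matrix (Q x)"
  by standard (auto simp: Q_qq qq_pos, auto simp: Q_def sym_a)

lemma qq_Q: "qq x y = (\<Sum>i\<in>UNIV. \<Sum>j\<in>UNIV. Q x $ i $ j * y $ i * y $ j)"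
  unfolding Q_qq[symmetric] by (simp add: inner_vec_def matrix_vector_mult_def sum_distrib_left mult_ac)

lemma qq_line: "qq x (u + t *\<^sub>R v) = qq x u
    + (\<Sum>i\<in>UNIV. \<Sum>j\<in>UNIV. Q x $ i $ j * (u $ i * v $ j + v $ i * u $ j)) * t + qq x v * t\<^sup>2"
  by (simp only: qq_Q quad_line)

lemma a_V: "x \<in> U \<Longrightarrow> (\<Sum>k\<in>UNIV. a x $ i $ k * V x k) = b x $ i"
  unfolding V_def by (rule a_up)

text \<open>In matrix form \<open>Q V = \<lambda> b\<close>, since \<open>a V = b\<close> and
  \<open>b V = b^2\<close>.\<close>

lemma Q_bilinear: "(\<Sum>i\<in>UNIV. \<Sum>j\<in>UNIV. Q x $ i $ j * (y $ i * V x j + V x i * y $ j)) = 2 * lam x * be x y"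
    if "x \<in> U"
proof -
  have "Q x $ i $ j * V x j = a x $ i $ j * V x j - b x $ i * (b x $ j * V x j)" for i j
    by (simp add: Q_def algebra_simps)
  hence "(\<Sum>j\<in>UNIV. Q x $ i $ j * V x j) = b x $ i - b x $ i * b2 x" for i
    by (simp only: sum_subtractf a_V[OF that] b2_def flip: sum_distrib_left)
  hence "(\<Sum>j\<in>UNIV. Q x $ i $ j * V x j) = lam x * b x $ i" for i
    by (simp add: lam_def algebra_simps)
  hence *: "(\<Sum>i\<in>UNIV. \<Sum>j\<in>UNIV. Q x $ i $ j * (y $ i * V x j)) = lam x * be x y"
    by (simp add: mult.left_commute[of _ "y $ _"] flip: sum_distrib_left)
      (simp add: be_def sum_distrib_left mult_ac)
  have "(\<Sum>i\<in>UNIV. \<Sum>j\<in>UNIV. Q x $ i $ j * (V x i * y $ j)) = (\<Sum>i\<in>UNIV. \<Sum>j\<in>UNIV. Q x $ i $ j * (y $ i * V x j))"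
    by (subst sum.swap) (simp add: Q_def sym_a[OF that] mult_ac)
  thus ?thesis using * by (simp add: distrib_left sum.distrib)
qed

text \<open>\<open>F < 1\<close> means \<open>\<alpha> < 1 - \<beta>\<close>, and squaring loses
  nothing: the branch \<open>\<alpha> < \<beta> - 1\<close> contradicts
  \<open>|\<beta>| \<le> \<alpha>\<close>.\<close>

lemma F_less_1_iff: assumes "x \<in> U" shows "F x y < 1 \<longleftrightarrow> qq x y + 2 * be x y < 1"
proof -
  have al: "0 \<le> al x y" "\<bar>be x y\<bar> \<le> al x y"
    using al_pos[OF assms, of y] abs_be_less[OF assms, of y] by (cases "y
        = 0"; force simp: al_def A2_def be_def)+
  have "qq x y + 2 * be x y < 1 \<longleftrightarrow> (al x y)\<^sup>2 < (1 - be x y)\<^sup>2"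
    unfolding qq_def al_sq[OF assms, symmetric] by (simp add: algebra_simps power2_eq_square)
  also have "\<dots> \<longleftrightarrow> al x y < \<bar>1 - be x y\<bar>"
    using al(1) by (metis abs_le_square_iff abs_of_nonneg not_less)
  also have "\<dots> \<longleftrightarrow> F x y < 1"
    using al by (auto simp: F_def)
  finally show ?thesis by simp
qed

lemma indicatrix_volume:
  assumes "x \<in> U"
  shows "measure lborel {y. F x y < 1}
      = sqrt (1 / lam x) ^ CARD('n) / sqrt (det (Q x)) * measure lborel (ball (0::real^'n) 1)"
proof -
  interpret posdef_matrix "Q x" by (rule posdef_Q[OF assms])
  let ?c = "1 / lam x"
  let ?V = "\<chi> i. V x i"
  have l: "lam x > 0" by (rule lam_pos[OF assms])
  have VV: "qq x ?V = lam x * b2 x" "be x ?V = b2 x"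
  proof -
    show "be x ?V = b2 x" by (simp add: be_def b2_def)
    have "2 * qq x ?V = (\<Sum>i\<in>UNIV. \<Sum>j\<in>UNIV. Q x $ i $ j * (?V $ i * V x j + V x i * ?V $ j))"
      unfolding Q_qq[symmetric] by (simp add: inner_vec_def matrix_vector_mult_def sum_distrib_left mult_ac)
    also have "\<dots> = 2 * lam x * be x ?V" by (rule Q_bilinear[OF assms])
    finally show "qq x ?V = lam x * b2 x" by (simp add: \<open>be x ?V = b2 x\<close>)
  qed
  \<comment> \<open>Completing the square: the translation by \<open>- V / \<lambda>\<close> cancels
    the linear term because \<open>Q V = \<lambda> b\<close>.\<close>
  have E: "qq x (z + (- ?c) *\<^sub>R ?V) + 2 * be x (z + (- ?c) *\<^sub>R ?V) = qq x z - b2 x / lam x" for z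
  proof -
    have "qq x (z + t *\<^sub>R ?V) = qq x z + 2 * lam x * be x z * t + qq x ?V * t\<^sup>2" for t
      unfolding qq_line using Q_bilinear[OF assms, of z] by simp
    from this[of "- ?c"] show ?thesis
      unfolding be_line VV using l by (simp add: field_simps power2_eq_square)
  qed
  have c: "1 + b2 x / lam x = ?c" using l by (simp add: lam_def field_simps)
  have *: "F x (z + (- ?c) *\<^sub>R ?V) < 1 \<longleftrightarrow> z \<bullet> (Q x *v z) < ?c" for z
    unfolding F_less_1_iff[OF assms] Q_qq E using c by (intro iffI; linarith)
  have im: "{y. F x y < 1} = (+) ((- ?c) *\<^sub>R ?V) ` {z. z \<bullet> (Q x *v z) < ?c}" (is "_ = _ ` ?S")
  proof (intro equalityI subsetI)
    fix y assume "y \<in> {y. F x y < 1}"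
    hence "y - (- ?c) *\<^sub>R ?V \<in> ?S" using *[of "y - (- ?c) *\<^sub>R ?V"] by simp
    thus "y \<in> (+) ((- ?c) *\<^sub>R ?V) ` ?S" by (intro image_eqI[of _ _ "y - (- ?c) *\<^sub>R ?V"]) simp_all
  next
    fix y assume "y \<in> (+) ((- ?c) *\<^sub>R ?V) ` ?S"
    thus "y \<in> {y. F x y < 1}" using * by (auto simp: add.commute)
  qed
  have op: "open ?S"
    by (intro open_Collect_less continuous_intros linear_continuous_on matrix_vector_mul_bounded_linear)
  have "measure lborel {y. F x y < 1} = measure lebesgue ((+) ((- ?c) *\<^sub>R ?V) ` ?S)"
    unfolding im using borel_open[OF open_translation[OF op]]
    by (intro measure_completion[symmetric]) (simp only: sets_lborel)
  also have "\<dots> = measure lebesgue ?S" by (rule measure_translation)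
  also have "\<dots> = measure lborel ?S" by (rule measure_completion) (simp add: borel_open op)
  also have "\<dots> = sqrt ?c ^ CARD('n) / sqrt (det (Q x)) * measure lborel (ball (0::real^'n) 1)"
    using l by (intro ellipsoid_volume) simp
  finally show ?thesis .
qed

lemma ln_sigma:
  assumes L: "\<forall>x\<in>U. \<forall>y. L x y = F x y" and x: "x \<in> U"
  shows "ln (sigma_BH L x) = 1/2 * ln (det (Q x)) + real CARD('n) / 2 * ln (lam x)"
proof -
  interpret posdef_matrix "Q x" by (rule posdef_Q[OF x])
  have l: "lam x > 0" by (rule lam_pos[OF x])
  have B: "measure lborel (ball (0::real^'n) 1) > 0" by (rule content_ball_pos) simp
  have "sigma_BH L x = sqrt (det (Q x)) * sqrt (lam x) ^ CARD('n)"
    using L x l B det_pos unfolding sigma_BH_def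
    by (simp add: indicatrix_volume[OF x] real_sqrt_divide power_divide field_simps)
  thus ?thesis using l det_pos by (simp add: ln_mult ln_realpow ln_sqrt)
qed

text \<open>The combinations of first derivatives in which the volume and the divergence of the
  spray are expressed; \<open>tr m\<close> is the derivative of \<open>ln (det a)\<close> in
  direction \<open>m\<close>, and \<open>w - z\<close>, with \<open>z\<close> defined below, gives
  \<open>2 s_m\<close>.\<close>

definition w :: "'n \<Rightarrow> real^'n \<Rightarrow> real" where "w m x = (\<Sum>j\<in>UNIV. V x j * db m x j)"

definition DV :: "'n \<Rightarrow> real^'n \<Rightarrow> real" where "DV m x = (\<Sum>i\<in>UNIV. \<Sum>j\<in>UNIV. da m x i j * (V x i * V x j))"

definition tr :: "'n \<Rightarrow> real^'n \<Rightarrow> real" where "tr m x = (\<Sum>i\<in>UNIV. \<Sum>j\<in>UNIV. ai x $ i $ j * da m x j i)"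

lemmas diff_a = smooth_on_differentiable[OF smooth_a]
lemmas diff_b = smooth_on_differentiable[OF smooth_b]
lemmas diff_V = smooth_on_differentiable[OF smooth_V]

definition z :: "'n \<Rightarrow> real^'n \<Rightarrow> real" where "z i x = (\<Sum>k\<in>UNIV. V x k * db k x i)"

lemma s0_eq: "2 * s0 x y = (\<Sum>m\<in>UNIV. y $ m * (w m x - z m x))"
proof -
  have "2 * s0 x y = (\<Sum>k\<in>UNIV. \<Sum>m\<in>UNIV. V x k * (db m x k - db k x m) * y $ m)"
    unfolding s0_def sl_def by (simp add: sum_distrib_left mult.assoc)
  also have "\<dots> = (\<Sum>m\<in>UNIV. \<Sum>k\<in>UNIV. V x k * (db m x k - db k x m) * y $ m)" by (rule sum.swap)
  also have "\<dots> = (\<Sum>m\<in>UNIV. y $ m * (w m x - z m x))"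
    unfolding w_def z_def by (simp add: sum_distrib_left sum_subtractf algebra_simps)
  finally show ?thesis .
qed

text \<open>Differentiating \<open>a V = b\<close> yields the derivative of \<open>V\<close> without
  a formula for the derivative of \<open>a^{-1}\<close>.\<close>

lemma a_V_partial:
  assumes x: "x \<in> U"
  shows "(\<Sum>j\<in>UNIV. a x $ i $ j * partial m (\<lambda>z. V z j) x) = db m x i - (\<Sum>j\<in>UNIV. da m x i j * V x j)"
proof -
  have "db m x i = partial m (\<lambda>z. \<Sum>j\<in>UNIV. a z $ i $ j * V z j) x"
    unfolding db_def by (rule partial_cong[OF open_U x]) (simp add: a_V)
  thus ?thesis using x
    by (subst (asm) partial_sum) (auto simp: partial_mult diff_a diff_V sum.distrib da_def)
qed

lemma b_V_partial:
  assumes x: "x \<in> U"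
  shows "(\<Sum>k\<in>UNIV. b x $ k * partial m (\<lambda>z. V z k) x) = w m x - DV m x"
proof -
  have "(\<Sum>k\<in>UNIV. b x $ k * partial m (\<lambda>z. V z k) x)
      = (\<Sum>j\<in>UNIV. (\<Sum>i\<in>UNIV. a x $ j $ i * V x i) * partial m (\<lambda>z. V z j) x)"
    unfolding a_V[OF x] ..
  also have "\<dots> = (\<Sum>i\<in>UNIV. \<Sum>j\<in>UNIV. V x i * (a x $ i $ j * partial m (\<lambda>z. V z j) x))"
    by (subst sum.swap) (simp add: sum_distrib_left sum_distrib_right sym_a[OF x] mult_ac)
  also have "\<dots> = w m x - DV m x"
    unfolding sum_distrib_left[symmetric] a_V_partial[OF x] w_def DV_def
    by (simp add: right_diff_distrib sum_subtractf sum_distrib_left mult_ac)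
  finally show ?thesis .
qed

lemma partial_b2: assumes x: "x \<in> U" shows "partial m b2 x = 2 * w m x - DV m x"
proof -
  have "partial m b2 x = w m x + (\<Sum>k\<in>UNIV. b x $ k * partial m (\<lambda>z. V z k) x)"
    unfolding b2_def[abs_def] using x
    by (subst partial_sum) (auto simp: partial_mult diff_b diff_V sum.distrib w_def db_def mult_ac)
  thus ?thesis unfolding b_V_partial[OF x] by simp
qed

lemma partial_det_Q:
  assumes x: "x \<in> U"
  shows "partial m (\<lambda>z. det (Q z)) x = det (Q x) * (tr m x - partial m b2 x / lam x)"
    and "(\<lambda>z. det (Q z)) differentiable (at x)"
proof -
  have d: "(\<lambda>z. Q z $ i $ j) differentiable (at x)" for i j
    unfolding Q_def using x by (simp add: diff_a diff_b differentiable_diff differentiable_mult)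
  show "(\<lambda>z. det (Q z)) differentiable (at x)" by (rule partial_det(1)[OF d])
  have l: "lam x > 0" by (rule lam_pos[OF x])
  \<comment> \<open>The Sherman-Morrison inverse of the rank-one perturbation
    \<open>Q = a - b b^T\<close>.\<close>
  define B where "B = (\<chi> i j. ai x $ i $ j + V x i * V x j / lam x)"
  have "(\<Sum>k\<in>UNIV. B $ i $ k * Q x $ k $ j) = of_bool (i = j)" for i j
  proof -
    have "B $ i $ k * Q x $ k $ j = ai x $ i $ k * a x $ k $ j - (ai x $ i $ k * b x $ k) * b x $ j
        + (V x i / lam x) * (a x $ j $ k * V x k) - (V x i * b x $ j / lam x) * (b x $ k * V x k)" for k
      using l by (simp add: B_def Q_def sym_a[OF x, of j k] field_simps)
    hence "(\<Sum>k\<in>UNIV. B $ i $ k * Q x $ k $ j) = (\<Sum>k\<in>UNIV. ai x $ i $ k * a x $ k $ j)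
        - (\<Sum>k\<in>UNIV. ai x $ i $ k * b x $ k) * b x $ j + (V x i / lam x) * (\<Sum>k\<in>UNIV. a x $ j $ k * V x k)
        - (V x i * b x $ j / lam x) * (\<Sum>k\<in>UNIV. b x $ k * V x k)"
      by (simp only: sum.distrib sum_subtractf sum_distrib_left sum_distrib_right)
    also have "\<dots> = of_bool (i = j) - V x i * b x $ j + (V x i / lam x) * b x $ j
        - (V x i * b x $ j / lam x) * b2 x"
      unfolding ai_left[OF x] b2_def[symmetric] a_V[OF x] by (simp add: V_def up_def)
    also have "\<dots> = of_bool (i = j)"
    proof -
      have "1 / lam x - b2 x / lam x = 1" using l by (simp add: lam_def field_simps)
      hence "V x i * b x $ j * (1 / lam x - b2 x / lam x) = V x i * b x $ j" by simp
      thus ?thesis by (simp add: right_diff_distrib)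
    qed
    finally show ?thesis .
  qed
  hence BQ: "B ** Q x = mat 1" by (simp add: matrix_matrix_mult_def vec_eq_iff mat_def)
  have pQ: "partial m (\<lambda>z. Q z $ j $ i) x = da m x j i - db m x j * b x $ i - b x $ j * db m x i" for i j
    unfolding Q_def using x
        by (simp add: partial_diff partial_mult diff_a diff_b differentiable_mult da_def db_def)
  have "B $ i $ j * (da m x j i - db m x j * b x $ i - b x $ j * db m x i) =
      ai x $ i $ j * da m x j i - (ai x $ j $ i * b x $ i) * db m x j - (ai x $ i $ j * b x $ j) * db m x i
      + (1 / lam x) * (da m x i j * (V x i * V x j)) - (1 / lam x) * ((b x $ i * V x i) * (V x j * db m x j))
      - (1 / lam x) * ((V x i * db m x i) * (b x $ j * V x j))" for i j
    using l by (simp add: B_def ai_sym[OF x, of j i] da_sym[OF x, of m j i] field_simps)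
  hence "(\<Sum>i\<in>UNIV. \<Sum>j\<in>UNIV. B $ i $ j * (da m x j i - db m x j * b x $ i - b x $ j * db m x i)) =
      tr m x - (\<Sum>j\<in>UNIV. (\<Sum>i\<in>UNIV. ai x $ j $ i * b x $ i) * db m x j)
      - (\<Sum>i\<in>UNIV. (\<Sum>j\<in>UNIV. ai x $ i $ j * b x $ j) * db m x i)
      + (1 / lam x) * DV m x - (1 / lam x) * (b2 x * w m x) - (1 / lam x) * (w m x * b2 x)"
    unfolding tr_def DV_def b2_def w_def sum_product
    by (simp only: sum.distrib sum_subtractf flip: sum_distrib_left sum_distrib_right)
       (subst sum.swap[of _ UNIV UNIV], simp add: sum_distrib_right)
  also have "\<dots> = tr m x - 2 * w m x + (1 / lam x) * (DV m x - 2 * b2 x * w m x)"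
    by (simp add: w_def V_def up_def algebra_simps)
  also have "\<dots> = tr m x - partial m b2 x / lam x"
    using l by (simp add: partial_b2[OF x] lam_def field_simps)
  finally show "partial m (\<lambda>z. det (Q z)) x = det (Q x) * (tr m x - partial m b2 x / lam x)"
    by (simp add: jacobi_formula[OF d BQ] pQ)
qed

text \<open>The derivative of \<open>b2\<close>, divided by \<open>2 \<lambda>\<close>, is
  subtracted once for \<open>det Q\<close> and \<open>n\<close> times for
  \<open>\<lambda>^{n/2}\<close>; this is the origin of \<open>n + 1\<close>.\<close>

lemma partial_ln_sigma:
  assumes L: "\<forall>x\<in>U. \<forall>y. L x y = F x y" and x: "x \<in> U"
  shows "partial m (\<lambda>z. ln (sigma_BH L z)) x = tr m x / 2 - (real CARD('n) + 1) / (2 * lam x) * (2 * w m x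
      - DV m x)"
proof -
  interpret posdef_matrix "Q x" by (rule posdef_Q[OF x])
  have l: "lam x > 0" by (rule lam_pos[OF x])
  have db2: "b2 differentiable (at x)" by (rule smooth_on_differentiable[OF smooth_b2 x])
  have dl: "lam differentiable (at x)" "partial m lam x = - partial m b2 x"
    unfolding lam_def[abs_def] using db2 by (simp_all add: partial_diff differentiable_diff)
  have 1: "(ln has_field_derivative 1 / det (Q x)) (at (det (Q x)))" "(ln has_field_derivative 1 / lam x)
      (at (lam x))"
    using l det_pos by (auto intro!: derivative_eq_intros)
  note c1 = partial_chain[OF 1(1) partial_det_Q(2)[OF x]] and c2 = partial_chain[OF 1(2) dl(1)]
  have "partial m (\<lambda>z. ln (sigma_BH L z)) x = partial m (\<lambda>z. 1/2 * ln (det (Q z))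
      + real CARD('n) / 2 * ln (lam z)) x"
    by (rule partial_cong[OF open_U x]) (rule ln_sigma[OF L])
  also have "\<dots> = 1/2 * partial m (\<lambda>z. ln (det (Q z))) x + real CARD('n) / 2 * partial m (\<lambda>z. ln (lam z)) x"
    using c1(2) c2(2)
        by (subst partial_add) (auto simp: partial_cmult differentiable_mult differentiable_const simp
        del: times_divide_eq_left)
  also have "\<dots> = 1/2 * (tr m x - partial m b2 x / lam x) - real CARD('n) / 2 * (partial m b2 x / lam x)"
    unfolding c1(1) c2(1) partial_det_Q(1)[OF x] dl(2) using det_pos by simp
  also have "\<dots> = tr m x / 2 - (real CARD('n) + 1) / (2 * lam x) * (2 * w m x - DV m x)"
    using l by (simp add: partial_b2[OF x] field_simps)
  finally show ?thesis .
qed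

text \<open>The summand \<open>\<alpha> s^m_0\<close> has divergence 0, because both
  \<open>y_m s^m_0\<close> and the trace of \<open>s\<close> vanish by antisymmetry. Homogeneity
  gives \<open>n + 1\<close> for \<open>s_0 y^m\<close>, and the spray of \<open>\<alpha>\<close>
  gives half the derivative of \<open>ln (det a)\<close> along \<open>y\<close>.\<close>

lemma div_Rm:
  assumes xy: "x \<in> U" "y \<noteq> 0"
  shows "(\<Sum>m\<in>UNIV. Dy m (Rm m) x y) = 1/2 * (\<Sum>k\<in>UNIV. y $ k * tr k x) - (real CARD('n) + 1) * s0 x y"
proof -
  have s: "pol 0 2 (\<lambda>x y. s0 x y * y $ m)" for m using pol_mult[OF pol_s0 pol_coord] by simp
  have as: "pol 0 2 (\<lambda>x y. al x y * sig m x y)" for m using pol_mult[OF pol_al pol_sig] by simp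
  have Gs: "pol 0 2 (\<lambda>x y. Ga m x y - s0 x y * y $ m)" for m using pol_diff[OF pol_Ga s] by simp
  have Dm: "Dy m (\<lambda>x y. - (s0 x y * y $ m)) x y = - Dy m s0 x y * y $ m - s0 x y" for m
  proof -
    have "Dy m (\<lambda>x y. - 1 * (s0 x y * y $ m)) x y = - Dy m s0 x y * y $ m - s0 x y"
      unfolding Dy_mult[OF pol_const s xy] Dy_mult[OF pol_s0 pol_coord xy] Dy_coord Dy_coef by simp
    thus ?thesis by simp
  qed
  have "Dy m (Rm m) x y = Dy m (Ga m) x y - Dy m s0 x y * y $ m - s0 x y
      + (Y m x y * sig m x y) * ial x y + al x y * Dy m (sig m) x y" for m
  proof -
    have "Rm m = (\<lambda>x y. Ga m x y + - (s0 x y * y $ m) + al x y * sig m x y)"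
      by (simp add: Rm_def fun_eq_iff)
    hence "Dy m (Rm m) x y = Dy m (Ga m) x y + Dy m (\<lambda>x y. - (s0 x y * y $ m)) x y
        + Dy m (\<lambda>x y. al x y * sig m x y) x y"
      using Dy_add[OF _ as xy, of 0 2 "\<lambda>x y. Ga m x y +
          - (s0 x y * y $ m)"] Dy_add[OF pol_Ga pol_minus[OF s] xy] Gs
      by simp
    thus ?thesis unfolding Dm Dy_mult[OF pol_al pol_sig xy] Dy_al[OF xy] by simp
  qed
  hence "(\<Sum>m\<in>UNIV. Dy m (Rm m) x y) = (\<Sum>m\<in>UNIV. Dy m (Ga m) x y) - (\<Sum>m\<in>UNIV. Dy m s0 x y * y $ m)
      - real CARD('n) * s0 x y
      + (\<Sum>m\<in>UNIV. Y m x y * sig m x y) * ial x y + al x y * (\<Sum>m\<in>UNIV. Dy m (sig m) x y)"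
    by (simp add: sum.distrib sum_subtractf sum_distrib_left sum_distrib_right)
  moreover have "(\<Sum>m\<in>UNIV. Dy m s0 x y * y $ m) = s0 x y"
    using euler[OF pol_s0 xy] by (simp add: mult.commute)
  moreover have "(\<Sum>m\<in>UNIV. Y m x y * sig m x y) = 0"
    unfolding sig_def using Y_up[OF xy(1)] y_sl by simp
  moreover have "(\<Sum>m\<in>UNIV. Dy m (sig m) x y) = 0"
  proof -
    have Ds: "Dy m (sl l) x y = (db m x l - db l x m) / 2" for m l
      unfolding sl_def[abs_def] by (rule lin_Dy[OF smooth_sl xy])
    have "Dy m (sig m) x y = (\<Sum>l\<in>UNIV. ai x $ m $ l * ((db m x l - db l x m) / 2))" for m
      unfolding sig_def[abs_def] up_def
      by (subst Dy_sum[OF pol_mult[OF pol_coef[OF smooth_ai] pol_sl] finite_class.finite_UNIV xy])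
         (simp add: Dy_mult[OF pol_coef[OF smooth_ai] pol_sl xy] Dy_coef Ds)
    thus ?thesis
      by (simp only:) (rule antisym_sum, simp add: ai_sym[OF xy(1), of _ _] field_simps)
  qed
  moreover have "(\<Sum>m\<in>UNIV. Dy m (Ga m) x y) = 1/2 * (\<Sum>k\<in>UNIV. y $ k * tr k x)"
  proof -
    have D: "Dy m (Ga m) x y = (\<Sum>l\<in>UNIV. 1/4 * ai x $ m $ l * (\<Sum>k\<in>UNIV. (C l x m k + C l x k m) * y $ k))"
        for m
    proof -
      have e: "Ga m = (\<lambda>x y. \<Sum>l\<in>UNIV. 1/4 * ai x $ m $ l * cal l x y)"
        by (simp add: Ga_def up_def sum_distrib_left fun_eq_iff mult.assoc)
      have sm: "smooth_on U (\<lambda>x. 1/4 * ai x $ m $ l)" for l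
        by (intro smooth_on_mult smooth_on_const smooth_ai open_U)
      have "Dy m (cal l) x y = (\<Sum>k\<in>UNIV. (C l x m k + C l x k m) * y $ k)" for l
        unfolding cal_def[abs_def] by (rule quad_Dy[OF smooth_C xy])
      thus ?thesis
        unfolding e Dy_sum[OF pol_mult[OF pol_coef[OF sm] pol_cal] finite_class.finite_UNIV xy]
          Dy_mult[OF pol_coef[OF sm] pol_cal xy] Dy_coef by simp
    qed
    have p: "1/4 * ai x $ m $ l * ((C l x m k + C l x k m) * y $ k) =
        1/2 * (y $ k * (ai x $ m $ l * da k x l m)) + 1/2 * y $ k * (ai x $ m $ l * (da m x l k
            - da l x m k))" for m l k
      unfolding C_def da_sym[OF xy(1), of l k m] by (simp add: field_simps)
    have z: "(\<Sum>m\<in>UNIV. \<Sum>l\<in>UNIV. ai x $ m $ l * (da m x l k - da l x m k)) = 0" for k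
      by (rule antisym_sum) (simp add: ai_sym[OF xy(1), of _ _] field_simps)
    have "(\<Sum>m\<in>UNIV. Dy m (Ga m) x y) = (\<Sum>m\<in>UNIV. \<Sum>l\<in>UNIV. \<Sum>k\<in>UNIV. 1/4 * ai x $ m $ l * ((C l x m k
        + C l x k m) * y $ k))"
      unfolding D by (simp only: sum_distrib_left)
    also have "\<dots> = (\<Sum>k\<in>UNIV. \<Sum>m\<in>UNIV. \<Sum>l\<in>UNIV. 1/4 * ai x $ m $ l * ((C l x m k + C l x k m) * y $ k))"
      by (subst sum.swap, subst (2) sum.swap) (rule refl)
    also have "\<dots> = 1/2 * (\<Sum>k\<in>UNIV. y $ k * tr k x)"
      unfolding p by (simp only: sum.distrib z tr_def flip: sum_distrib_left) simp
    finally show ?thesis .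
  qed
  ultimately show ?thesis by (simp add: algebra_simps)
qed

text \<open>The \<open>tr\<close> terms of the spray and of the volume cancel, leaving besides
  \<open>P0 - s0\<close> only the derivative of \<open>b2\<close> along \<open>y\<close>, which is
  the sum of \<open>y^m (2 w_m - DV_m)\<close>.\<close>

lemma S_curv_eq:
  assumes L: "\<forall>x\<in>U. \<forall>y. L x y = F x y" and xy: "x \<in> U" "y \<noteq> 0"
  shows "S_curv L x y = (real CARD('n) + 1) * (P0 x y - s0 x y
      + 1 / (2 * lam x) * (\<Sum>m\<in>UNIV. y $ m * (2 * w m x - DV m x)))"
proof -
  have "Dy m (geodesic_coeff L m) x y = Dy m (G m) x y" for m
    by (rule Dy_cong) (use geodesic_coeff_eq[OF L] xy in auto)
  hence "(\<Sum>m\<in>UNIV. Dy m (geodesic_coeff L m) x y) = (\<Sum>m\<in>UNIV. Dy m P0 x y * y $ m)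
      + real CARD('n) * P0 x y + (\<Sum>m\<in>UNIV. Dy m (Rm m) x y)"
    using xy by (simp add: Dy_G sum.distrib)
  also have "(\<Sum>m\<in>UNIV. Dy m P0 x y * y $ m) = P0 x y"
    using euler[OF pol_P0 xy] by (simp add: mult.commute)
  finally have 1: "(\<Sum>m\<in>UNIV. Dy m (geodesic_coeff L m) x y) =
     (real CARD('n) + 1) * (P0 x y - s0 x y) + 1/2 * (\<Sum>k\<in>UNIV. y $ k * tr k x)"
    unfolding div_Rm[OF xy] by (simp add: algebra_simps)
  have "(\<Sum>m\<in>UNIV. y $ m * partial m (\<lambda>z. ln (sigma_BH L z)) x)
     = 1/2 * (\<Sum>k\<in>UNIV. y $ k * tr k x) - (real CARD('n) + 1) / (2 * lam x) * (\<Sum>m\<in>UNIV. y $ m * (2 * w m x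
         - DV m x))"
  proof -
    have "y $ m * (tr m x / 2 - (real CARD('n) + 1) / (2 * lam x) * (2 * w m x - DV m x)) =
       1/2 * (y $ m * tr m x) - (real CARD('n) + 1) / (2 * lam x) * (y $ m * (2 * w m x - DV m x))" for m
      by (simp add: algebra_simps)
    thus ?thesis unfolding partial_ln_sigma[OF L xy(1)] by (simp only: sum_subtractf sum_distrib_left)
  qed
  thus ?thesis unfolding S_curv_def 1 by (simp add: algebra_simps)
qed

text \<open>Polarizing the hypothesis at the pair \<open>(y, V)\<close> expresses the derivative of
  \<open>b2\<close> along \<open>y\<close> as \<open>2 \<lambda> (s_0 + 2 \<kappa> \<beta>)\<close>.
  Since \<open>P0 = \<kappa> (\<alpha> - \<beta>)\<close>, the bracket in \<open>S_curv_eq\<close>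
  becomes \<open>\<kappa> (\<alpha> - \<beta>) + 2 \<kappa> \<beta> = \<kappa> F\<close>.\<close>

lemma S_curv_isotropic:
  assumes L: "\<forall>x\<in>U. \<forall>y. L x y = F x y" and xy: "x \<in> U" "y \<noteq> 0"
    and e: "\<And>y. ee x y = 2 * \<kappa> * qq x y"
  shows "S_curv L x y = (real CARD('n) + 1) * \<kappa> * F x y"
proof -
  let ?V = "\<chi> i. V x i"
  have l: "lam x > 0" by (rule lam_pos[OF xy(1)])
  have bil: "(\<Sum>i\<in>UNIV. \<Sum>j\<in>UNIV. EE x i j * (y $ i * V x j + V x i * y $ j)) = 4 * \<kappa> * lam x * be x y"
  proof -
    let ?B = "\<lambda>c :: 'n \<Rightarrow> 'n \<Rightarrow> real. \<Sum>i\<in>UNIV. \<Sum>j\<in>UNIV. c i j * (y $ i * V x j + V x i * y $ j)"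
    have "ee x (y + 1 *\<^sub>R ?V) = ee x y + ?B (EE x) + ee x ?V"
      unfolding ee_def using quad_line[of "EE x" y 1 ?V] by simp
    moreover have "qq x (y + 1 *\<^sub>R ?V) = qq x y + ?B (\<lambda>i j. Q x $ i $ j) + qq x ?V"
      unfolding qq_line by simp
    ultimately have "?B (EE x) = 2 * \<kappa> * ?B (\<lambda>i j. Q x $ i $ j)"
      unfolding e by (simp add: algebra_simps)
    thus ?thesis unfolding Q_bilinear[OF xy(1)] by simp
  qed
  \<comment> \<open>The derivatives of \<open>a\<close> along \<open>V\<close>; they enter the two
    halves of the polarized Christoffel term with opposite signs and cancel.\<close>
  define X where "X = (\<lambda>i. \<Sum>j\<in>UNIV. \<Sum>k\<in>UNIV. V x j * V x k * da j x k i)"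
  define c where "c = (\<lambda>j. w j x - z j x)"
  have EE: "EE x i j = db j x i - 1/2 * (\<Sum>k\<in>UNIV. V x k * C k x i j) + b x $ i * c j" for i j
    unfolding EE_def c_def w_def z_def by (simp add: right_diff_distrib sum_subtractf)
  have t1: "(\<Sum>i\<in>UNIV. \<Sum>j\<in>UNIV. db j x i * (y $ i * V x j + V x i * y $ j)) = (\<Sum>i\<in>UNIV. y $ i * z i x)
      + (\<Sum>i\<in>UNIV. y $ i * w i x)"
  proof -
    have "(\<Sum>i\<in>UNIV. \<Sum>j\<in>UNIV. db j x i * (V x i * y $ j)) = (\<Sum>i\<in>UNIV. y $ i * w i x)"
      unfolding w_def by (subst sum.swap) (simp add: sum_distrib_left mult_ac)
    thus ?thesis unfolding z_def by (simp add: distrib_left sum.distrib sum_distrib_left mult_ac)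
  qed
  define S where "S = (\<lambda>i j. \<Sum>k\<in>UNIV. V x k * C k x i j)"
  have t2: "(\<Sum>i\<in>UNIV. \<Sum>j\<in>UNIV. S i j * (y $ i * V x j + V x i * y $ j)) = 2 * (\<Sum>i\<in>UNIV. y $ i * DV i x)"
  proof -
    have "(\<Sum>j\<in>UNIV. S i j * V x j) = X i" for i
    proof -
      have "(\<Sum>j\<in>UNIV. S i j * V x j) =
          2 * (\<Sum>j\<in>UNIV. \<Sum>k\<in>UNIV. V x j * V x k * da j x k i) - (\<Sum>j\<in>UNIV. \<Sum>k\<in>UNIV. V x k * V x j * da k x j i)"
        unfolding S_def C_def da_sym[OF xy(1), of _ i]
        by (simp add: sum_distrib_left sum_distrib_right sum_subtractf[symmetric] algebra_simps)
      also have "(\<Sum>j\<in>UNIV. \<Sum>k\<in>UNIV. V x k * V x j * da k x j i) = X i"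
        unfolding X_def by (rule sum.swap)
      finally show ?thesis unfolding X_def by simp
    qed
    hence "(\<Sum>i\<in>UNIV. y $ i * X i) = (\<Sum>i\<in>UNIV. y $ i * (\<Sum>j\<in>UNIV. S i j * V x j))" by simp
    hence s1: "(\<Sum>i\<in>UNIV. \<Sum>j\<in>UNIV. S i j * (y $ i * V x j)) = (\<Sum>i\<in>UNIV. y $ i * X i)"
      by (simp add: sum_distrib_left mult_ac)
    have "(\<Sum>i\<in>UNIV. S i j * V x i) = 2 * DV j x - X j" for j
    proof -
      have "(\<Sum>i\<in>UNIV. S i j * V x i) =
          2 * (\<Sum>i\<in>UNIV. \<Sum>k\<in>UNIV. da j x k i * (V x k * V x i))
              - (\<Sum>i\<in>UNIV. \<Sum>k\<in>UNIV. V x k * V x i * da k x i j)"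
        unfolding S_def C_def
        by (simp add: sum_distrib_left sum_distrib_right sum_subtractf[symmetric] algebra_simps)
      also have "(\<Sum>i\<in>UNIV. \<Sum>k\<in>UNIV. da j x k i * (V x k * V x i)) = DV j x"
        unfolding DV_def by (rule sum.swap)
      also have "(\<Sum>i\<in>UNIV. \<Sum>k\<in>UNIV. V x k * V x i * da k x i j) = X j"
        unfolding X_def by (rule sum.swap)
      finally show ?thesis .
    qed
    hence "(\<Sum>j\<in>UNIV. y $ j * (2 * DV j x - X j)) = (\<Sum>j\<in>UNIV. y $ j * (\<Sum>i\<in>UNIV. S i j * V x i))" by simp
    hence s2: "(\<Sum>j\<in>UNIV. \<Sum>i\<in>UNIV. S i j * (V x i * y $ j)) = (\<Sum>j\<in>UNIV. y $ j * (2 * DV j x - X j))"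
      by (simp add: sum_distrib_left mult_ac)
    have "(\<Sum>i\<in>UNIV. \<Sum>j\<in>UNIV. S i j * (V x i * y $ j)) = (\<Sum>j\<in>UNIV. y $ j * (2 * DV j x - X j))"
      unfolding s2[symmetric] by (rule sum.swap)
    thus ?thesis using s1
        by (simp add: distrib_left sum.distrib right_diff_distrib sum_subtractf sum_distrib_left mult_ac)
  qed
  have t3: "(\<Sum>i\<in>UNIV. \<Sum>j\<in>UNIV. b x $ i * c j * (y $ i * V x j + V x i * y $ j))
      = b2 x * (\<Sum>j\<in>UNIV. y $ j * c j)"
  proof -
    have "(\<Sum>j\<in>UNIV. c j * V x j) = (\<Sum>j\<in>UNIV. \<Sum>k\<in>UNIV. V x j * V x k * (db j x k - db k x j))"
      unfolding c_def w_def z_def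
          by (simp add: sum_distrib_left sum_distrib_right algebra_simps sum_subtractf)
    also have "\<dots> = 0" by (rule antisym_sum) (simp add: algebra_simps)
    finally have cV: "(\<Sum>j\<in>UNIV. c j * V x j) = 0" .
    have "(\<Sum>i\<in>UNIV. \<Sum>j\<in>UNIV. b x $ i * c j * (y $ i * V x j + V x i * y $ j)) =
       (\<Sum>i\<in>UNIV. b x $ i * y $ i) * (\<Sum>j\<in>UNIV. c j * V x j)
           + (\<Sum>i\<in>UNIV. b x $ i * V x i) * (\<Sum>j\<in>UNIV. y $ j * c j)"
      unfolding sum_product by (simp add: algebra_simps sum.distrib)
    thus ?thesis unfolding cV b2_def by simp
  qed
  have "EE x i j * (y $ i * V x j + V x i * y $ j) = db j x i * (y $ i * V x j + V x i * y $ j)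
     + (- 1/2) * (S i j * (y $ i * V x j + V x i * y $ j))
     + b x $ i * c j * (y $ i * V x j + V x i * y $ j)" for i j
    unfolding EE S_def by (simp add: algebra_simps)
  hence "4 * \<kappa> * lam x * be x y = (\<Sum>i\<in>UNIV. y $ i * z i x) + (\<Sum>i\<in>UNIV. y $ i * w i x)
     + (- 1/2) * (2 * (\<Sum>i\<in>UNIV. y $ i * DV i x)) + b2 x * (\<Sum>j\<in>UNIV. y $ j * c j)"
    unfolding bil[symmetric] t1[symmetric] t2[symmetric] t3[symmetric]
    by (simp only: sum.distrib sum_distrib_left)
  moreover have "(\<Sum>j\<in>UNIV. y $ j * c j) = (\<Sum>i\<in>UNIV. y $ i * w i x) - (\<Sum>i\<in>UNIV. y $ i * z i x)"
    by (simp add: c_def right_diff_distrib sum_subtractf)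
  moreover have "2 * s0 x y = (\<Sum>j\<in>UNIV. y $ j * c j)"
    unfolding s0_eq c_def ..
  moreover have "(\<Sum>m\<in>UNIV. y $ m * (2 * w m x - DV m x)) = 2 * (\<Sum>i\<in>UNIV. y $ i * w i x)
      - (\<Sum>i\<in>UNIV. y $ i * DV i x)"
    by (simp add: right_diff_distrib sum_subtractf sum_distrib_left mult_ac)
  ultimately have "(\<Sum>m\<in>UNIV. y $ m * (2 * w m x - DV m x)) = 2 * lam x * (s0 x y + 2 * \<kappa> * be x y)"
    unfolding lam_def by algebra
  hence "1 / (2 * lam x) * (\<Sum>m\<in>UNIV. y $ m * (2 * w m x - DV m x)) = s0 x y + 2 * \<kappa> * be x y"
    using l by simp
  moreover have "P0 x y = \<kappa> * (al x y - be x y)"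
  proof -
    have "qq x y = (al x y - be x y) * F x y"
      unfolding qq_def F_def al_sq[OF xy(1), symmetric] by (simp add: algebra_simps power2_eq_square)
    thus ?thesis unfolding P0_def e using F_iF[OF xy] by (simp add: mult.assoc)
  qed
  ultimately have "P0 x y - s0 x y + 1 / (2 * lam x) * (\<Sum>m\<in>UNIV. y $ m * (2 * w m x - DV m x)) = \<kappa> * F x y"
    unfolding F_def by argo
  thus ?thesis unfolding S_curv_eq[OF L xy] by simp
qed

end

section \<open>Change of coordinates\<close>

lemma DERIV_along_axis:
  fixes f :: "real^'n::finite \<Rightarrow> real"
  assumes "f differentiable (at (z + s *\<^sub>R axis i 1))"
  shows "((\<lambda>s. f (z + s *\<^sub>R axis i 1)) has_field_derivative partial i f (z + s *\<^sub>R axis i 1)) (at s)"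
proof -
  have l: "((\<lambda>s::real. z + s *\<^sub>R axis i 1) has_derivative (\<lambda>t. t *\<^sub>R axis i 1)) (at s)"
    by (auto intro!: derivative_eq_intros)
  obtain f' where f': "(f has_derivative f') (at (z + s *\<^sub>R axis i 1))"
    using assms by (auto simp: differentiable_def)
  have "((\<lambda>s. f (z + s *\<^sub>R axis i 1)) has_derivative (\<lambda>t. f' (t *\<^sub>R axis i 1))) (at s)"
    by (rule has_derivative_compose[OF l f'])
  moreover have "f' (t *\<^sub>R axis i 1) = partial i f (z + s *\<^sub>R axis i 1) * t" for t
    using linear_cmul[OF has_derivative_linear[OF f']] partial_has_derivative[OF f'] by simp
  ultimately show ?thesis by (simp add: has_field_derivative_def)
qed

text \<open>The mean value theorem is applied first in direction \<open>i\<close>, to the difference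
  of two translates of \<open>f\<close>, and then in direction \<open>j\<close>, to
  \<open>partial i f\<close>.\<close>

lemma second_difference:
  fixes f :: "real^'n::finite \<Rightarrow> real"
  assumes f: "smooth_on S f" and S: "ball x \<delta> \<subseteq> S" and h: "0 < h" "2 * h < \<delta>"
  obtains z where "z \<in> ball x \<delta>"
    "f (x + h *\<^sub>R axis i 1 + h *\<^sub>R axis j 1) - f (x + h *\<^sub>R axis i 1) - f (x + h *\<^sub>R axis j 1) + f x
      = h * h * partial j (partial i f) z"
proof -
  have inS: "x + s *\<^sub>R axis i 1 + t *\<^sub>R axis j 1 \<in> ball x \<delta>" if "0 \<le> s" "s \<le> h" "0 \<le> t" "t \<le> h" for s t
  proof -
    have "norm (s *\<^sub>R axis i 1 + t *\<^sub>R axis j (1::real) :: real^'n) \<le> s + t"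
      using that by (intro norm_triangle_le) (simp add: norm_axis_1)
    hence "dist (x + (s *\<^sub>R axis i 1 + t *\<^sub>R axis j 1)) x < \<delta>" using that h by (simp add: dist_norm)
    thus ?thesis by (simp add: dist_commute add.assoc)
  qed
  let ?y = "x + h *\<^sub>R axis j (1::real)"
  have fd: "f differentiable (at z)" if "z \<in> ball x \<delta>" for z
    using smooth_on_differentiable[OF f] S that by blast
  have "\<exists>s. 0 < s \<and> s < h \<and> (f (?y + h *\<^sub>R axis i 1) - f (x + h *\<^sub>R axis i 1)) - (f (?y + 0 *\<^sub>R axis i 1)
      - f (x + 0 *\<^sub>R axis i 1)) =
     (h - 0) * (partial i f (?y + s *\<^sub>R axis i 1) - partial i f (x + s *\<^sub>R axis i 1))"
  proof (rule MVT2[OF h(1)])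
    fix s assume "0 \<le> s" "s \<le> h"
    hence "x + s *\<^sub>R axis i 1 + h *\<^sub>R axis j 1 \<in> ball x \<delta>" "x + s *\<^sub>R axis i 1 + 0 *\<^sub>R axis j 1 \<in> ball x \<delta>"
      using inS[of s h] inS[of s 0] h by auto
    hence "?y + s *\<^sub>R axis i 1 \<in> ball x \<delta>" "x + s *\<^sub>R axis i 1 \<in> ball x \<delta>"
      by (simp_all add: algebra_simps)
    thus "((\<lambda>s. f (?y + s *\<^sub>R axis i 1) - f (x + s *\<^sub>R axis i 1)) has_real_derivative
        partial i f (?y + s *\<^sub>R axis i 1) - partial i f (x + s *\<^sub>R axis i 1)) (at s)"
      by (intro DERIV_diff DERIV_along_axis fd)
  qed
  then obtain s where s: "0 < s" "s < h" and e1: "f (?y + h *\<^sub>R axis i 1) - f (x + h *\<^sub>R axis i 1) - f ?y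
      + f x =
     h * (partial i f (?y + s *\<^sub>R axis i 1) - partial i f (x + s *\<^sub>R axis i 1))" by auto
  let ?w = "x + s *\<^sub>R axis i (1::real)"
  have "\<exists>t. 0 < t \<and> t < h \<and> partial i f (?w + h *\<^sub>R axis j 1) - partial i f (?w + 0 *\<^sub>R axis j 1) = (h
      - 0) * partial j (partial i f) (?w + t *\<^sub>R axis j 1)"
  proof (rule MVT2[OF h(1)])
    fix t assume "0 \<le> t" "t \<le> h"
    hence "?w + t *\<^sub>R axis j 1 \<in> S" using inS[of s t] s S by auto
    thus "((\<lambda>t. partial i f (?w + t *\<^sub>R axis j 1)) has_real_derivative partial j (partial i f) (?w
        + t *\<^sub>R axis j 1)) (at t)"
      by (intro DERIV_along_axis smooth_on_differentiable[OF smooth_on_partial[OF f]])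
  qed
  then obtain t where t: "0 < t" "t < h" and e2: "partial i f (?w + h *\<^sub>R axis j 1) - partial i f ?w
      = h * partial j (partial i f) (?w + t *\<^sub>R axis j 1)"
    by auto
  have q: "?y + s *\<^sub>R axis i 1 = ?w + h *\<^sub>R axis j 1" "?y + h *\<^sub>R axis i 1 = x + h *\<^sub>R axis i 1
      + h *\<^sub>R axis j 1"
    by (simp_all add: algebra_simps)
  have "f (x + h *\<^sub>R axis i 1 + h *\<^sub>R axis j 1) - f (x + h *\<^sub>R axis i 1) - f (x + h *\<^sub>R axis j 1) + f x
      = h * h * partial j (partial i f) (?w + t *\<^sub>R axis j 1)"
    using e1 unfolding q e2 by simp
  thus ?thesis using that inS[of s t] s t by auto
qed

text \<open>The second difference over a square does not change when \<open>i\<close> and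
  \<open>j\<close> are exchanged, so the two mixed derivatives agree at two points near
  \<open>x\<close>; continuity carries this to \<open>x\<close>.\<close>

lemma partial_commute:
  fixes f :: "real^'n::finite \<Rightarrow> real"
  assumes f: "smooth_on S f" and x: "x \<in> S"
  shows "partial i (partial j f) x = partial j (partial i f) x"
proof (rule ccontr)
  let ?g = "\<lambda>i j. partial j (partial i f)"
  assume "\<not> ?thesis"
  hence e: "0 < dist (?g i j x) (?g j i x) / 2" (is "0 < ?e") by simp
  have "isCont (?g i j) x" for i j
    using smooth_on_continuous[OF smooth_on_partial[OF smooth_on_partial[OF f]]] smooth_on_open[OF f] x
    by (simp add: continuous_on_eq_continuous_at)
  hence "\<exists>d>0. \<forall>z. dist z x < d \<longrightarrow> dist (?g i j z) (?g i j x) < ?e" for i j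
    using e unfolding continuous_at_eps_delta by blast
  then obtain d1 d2 where d: "d1 > 0" "d2 > 0" "\<And>z. dist z x < d1 \<Longrightarrow> dist (?g i j z) (?g i j x) < ?e"
     "\<And>z. dist z x < d2 \<Longrightarrow> dist (?g j i z) (?g j i x) < ?e" by metis
  obtain d3 where d3: "d3 > 0" "ball x d3 \<subseteq> S"
    using smooth_on_open[OF f] x openE by blast
  define \<delta> where "\<delta> = min d1 (min d2 d3)"
  have \<delta>: "\<delta> > 0" "ball x \<delta> \<subseteq> S" using d d3 by (auto simp: \<delta>_def)
  define h where "h = \<delta> / 3"
  have h: "0 < h" "2 * h < \<delta>" using \<delta> by (auto simp: h_def)
  obtain z1 where z1: "z1 \<in> ball x \<delta>" "f (x + h *\<^sub>R axis i 1 + h *\<^sub>R axis j 1) - f (x + h *\<^sub>R axis i 1)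
      - f (x + h *\<^sub>R axis j 1) + f x
      = h * h * ?g i j z1" by (rule second_difference[OF f \<delta>(2) h])
  obtain z2 where z2: "z2 \<in> ball x \<delta>" "f (x + h *\<^sub>R axis j 1 + h *\<^sub>R axis i 1) - f (x + h *\<^sub>R axis j 1)
      - f (x + h *\<^sub>R axis i 1) + f x
      = h * h * ?g j i z2" by (rule second_difference[OF f \<delta>(2) h])
  have "x + h *\<^sub>R axis j 1 + h *\<^sub>R axis i 1 = x + h *\<^sub>R axis i 1 + h *\<^sub>R axis j 1"
      by (simp add: algebra_simps)
  note z2' = z2(2)[unfolded this]
  have "h * h * ?g i j z1 = h * h * ?g j i z2" using z1(2) z2' by linarith
  hence "?g i j z1 = ?g j i z2" using h by simp
  moreover have "dist (?g i j z1) (?g i j x) < ?e" "dist (?g j i z2) (?g j i x) < ?e"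
    using z1(1) z2(1) by (intro d(3) d(4); simp add: \<delta>_def dist_commute)+
  ultimately show False
    using dist_triangle2[of "?g i j x" "?g j i x" "?g i j z1"] by (simp add: dist_commute)
qed

definition jac :: "(real^'n \<Rightarrow> real^'n) \<Rightarrow> 'n \<Rightarrow> 'n \<Rightarrow> real^'n::finite \<Rightarrow> real" where
  "jac \<phi> i k x = partial i (\<lambda>z. \<phi> z $ k) x"

lemma has_derivative_jac:
  fixes \<phi> :: "real^'n::finite \<Rightarrow> real^'n"
  assumes "\<And>k. (\<lambda>z. \<phi> z $ k) differentiable (at x)"
  shows "(\<phi> has_derivative (\<lambda>h. \<chi> k. \<Sum>i\<in>UNIV. h $ i * jac \<phi> i k x)) (at x)"
  unfolding has_derivative_componentwise_within[of \<phi>] jac_def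
  using has_derivative_partial[OF assms] by (auto simp: Basis_vec_def inner_axis)

text \<open>The direction is a family of components rather than a vector, so that \<open>V x\<close>
  and the components of a pushed vector can be inserted as they stand.\<close>

definition dir :: "('n \<Rightarrow> real) \<Rightarrow> (real^'n \<Rightarrow> real) \<Rightarrow> real^'n::finite \<Rightarrow> real" where
  "dir u f x = (\<Sum>k\<in>UNIV. u k * partial k f x)"

lemma dir_mult:
  assumes "f differentiable (at x)" "g differentiable (at x)"
  shows "dir u (\<lambda>x. f x * g x) x = dir u f x * g x + f x * dir u g x"
  using assms
      by (simp add: dir_def partial_mult distrib_left sum.distrib sum_distrib_left sum_distrib_right mult_ac)

lemma dir_sum:
  assumes "\<And>j. j \<in> J \<Longrightarrow> f j differentiable (at x)" "finite J"
  shows "dir u (\<lambda>x. \<Sum>j\<in>J. f j x) x = (\<Sum>j\<in>J. dir u (f j) x)"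
  using assms by (simp add: dir_def partial_sum sum_distrib_left) (rule sum.swap)

lemma dir_cong:
  assumes "open S" "x \<in> S" "\<And>z. z \<in> S \<Longrightarrow> f z = g z"
  shows "dir u f x = dir u g x"
  using partial_cong[OF assms] by (simp add: dir_def)

lemma dir_chain:
  fixes \<phi> :: "real^'n::finite \<Rightarrow> real^'n"
  assumes "\<And>k. (\<lambda>z. \<phi> z $ k) differentiable (at x)" "g differentiable (at (\<phi> x))"
  shows "dir u (\<lambda>z. g (\<phi> z)) x = dir (\<lambda>k. dir u (\<lambda>z. \<phi> z $ k) x) g (\<phi> x)"
    and "(\<lambda>z. g (\<phi> z)) differentiable (at x)"
proof -
  have d: "((\<lambda>z. g (\<phi> z)) has_derivative (\<lambda>h. \<Sum>k\<in>UNIV. (\<Sum>i\<in>UNIV. h $ i * jac \<phi> i k x) * partial k g (\<phi>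
      x))) (at x)"
    using has_derivative_compose[OF has_derivative_jac[OF assms(1)] has_derivative_partial[OF assms(2)]]
        by simp
  thus "(\<lambda>z. g (\<phi> z)) differentiable (at x)" by (auto simp: differentiable_def)
  have "partial i (\<lambda>z. g (\<phi> z)) x = (\<Sum>k\<in>UNIV. jac \<phi> i k x * partial k g (\<phi> x))" for i
    unfolding partial_has_derivative[OF d] by (simp only: axis_of_bool sum_of_bool)
  thus "dir u (\<lambda>z. g (\<phi> z)) x = dir (\<lambda>k. dir u (\<lambda>z. \<phi> z $ k) x) g (\<phi> x)"
    unfolding dir_def jac_def by (simp add: sum_distrib_left sum_distrib_right mult.assoc) (rule sum.swap)
qed

context randers_chart begin

lemma smooth_Q: "smooth_on U (\<lambda>x. Q x $ i $ j)"
  unfolding Q_def by (simp add: smooth_on_diff smooth_on_mult smooth_a smooth_b)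

text \<open>
  Up to sign and a term proportional to \<open>\<alpha>\<^sup>2 - \<beta>\<^sup>2\<close>, this is a Lie derivative of the
  navigation metric; unlike the definition of \<open>ee\<close> it involves no Christoffel symbols.
\<close>

lemma ee_Lie:
  assumes x: "x \<in> U"
  shows "2 * ee x y = dir (V x) (\<lambda>z. qq z y) x
    + 2 * (\<Sum>i\<in>UNIV. \<Sum>j\<in>UNIV. Q x $ i $ j * y $ i * dir (\<lambda>k. y $ k) (\<lambda>z. V z j) x)
    + 2 * be x y * dir (\<lambda>k. y $ k) b2 x"
proof -
  let ?d = "\<Sum>i\<in>UNIV. \<Sum>k\<in>UNIV. db k x i * y $ i * y $ k"
  let ?T = "\<Sum>k\<in>UNIV. \<Sum>i\<in>UNIV. \<Sum>j\<in>UNIV. y $ k * y $ i * (da k x i j * V x j)"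
  let ?S = "\<Sum>k\<in>UNIV. V x k * (\<Sum>i\<in>UNIV. \<Sum>j\<in>UNIV. da k x i j * y $ i * y $ j)"
  have 1: "dir (V x) (\<lambda>z. qq z y) x = ?S - 2 * be x y * (\<Sum>i\<in>UNIV. z i x * y $ i)"
  proof -
    have dA: "(\<lambda>z. A2 z y) differentiable (at x)" "(\<lambda>z. be z y) differentiable (at x)"
      using x by (rule A2_diff_x, rule be_diff_x)
    have "partial k (\<lambda>z. qq z y) x = (\<Sum>i\<in>UNIV. \<Sum>j\<in>UNIV. da k x i j * y $ i * y $ j)
        - 2 * be x y * (\<Sum>i\<in>UNIV. db k x i * y $ i)" for k
    proof (cases "y = 0")
      case False
      thus ?thesis
        using A2_Dx[OF x False, of k] be_Dx[OF x False, of k] dA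
        unfolding qq_def[abs_def] power2_eq_square
        by (simp add: partial_diff partial_mult differentiable_mult Dx_def da_def db_def)
    qed (simp add: qq_def A2_def be_def)
    hence "dir (V x) (\<lambda>z. qq z y) x = ?S - 2 * be x y * (\<Sum>k\<in>UNIV. \<Sum>i\<in>UNIV. V x k * db k x i * y $ i)"
      by (simp add: dir_def right_diff_distrib sum_subtractf sum_distrib_left mult_ac)
    also have "(\<Sum>k\<in>UNIV. \<Sum>i\<in>UNIV. V x k * db k x i * y $ i) = (\<Sum>i\<in>UNIV. z i x * y $ i)"
      unfolding z_def by (subst sum.swap) (simp add: sum_distrib_right)
    finally show ?thesis .
  qed
  have 2: "(\<Sum>i\<in>UNIV. \<Sum>j\<in>UNIV. Q x $ i $ j * y $ i * dir (\<lambda>k. y $ k) (\<lambda>z. V z j) x)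
      = ?d - ?T - be x y * (\<Sum>k\<in>UNIV. y $ k * (w k x - DV k x))"
  proof -
    have "(\<Sum>j\<in>UNIV. Q x $ i $ j * partial k (\<lambda>z. V z j) x) = db k x i - (\<Sum>j\<in>UNIV. da k x i j * V x j)
        - b x $ i * (w k x - DV k x)" for i k
    proof -
      have "Q x $ i $ j * partial k (\<lambda>z. V z j) x = a x $ i $ j * partial k (\<lambda>z. V z j) x
          - b x $ i * (b x $ j * partial k (\<lambda>z. V z j) x)" for j
        by (simp add: Q_def algebra_simps)
      thus ?thesis
        by (simp only: sum_subtractf a_V_partial[OF x] b_V_partial[OF x] flip: sum_distrib_left)
    qed
    hence *: "(\<Sum>i\<in>UNIV. \<Sum>k\<in>UNIV. (y $ i * y $ k) * (\<Sum>j\<in>UNIV. Q x $ i $ j * partial k (\<lambda>z. V z j) x))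
      = (\<Sum>i\<in>UNIV. \<Sum>k\<in>UNIV. (y $ i * y $ k) * (db k x i - (\<Sum>j\<in>UNIV. da k x i j * V x j) - b x $ i * (w k x
          - DV k x)))"
      by simp
    have "(\<Sum>j\<in>UNIV. Q x $ i $ j * y $ i * dir (\<lambda>k. y $ k) (\<lambda>z. V z j) x) =
        (\<Sum>k\<in>UNIV. (y $ i * y $ k) * (\<Sum>j\<in>UNIV. Q x $ i $ j * partial k (\<lambda>z. V z j) x))" for i
      by (simp add: dir_def sum_distrib_left mult_ac) (rule sum.swap)
    hence "(\<Sum>i\<in>UNIV. \<Sum>j\<in>UNIV. Q x $ i $ j * y $ i * dir (\<lambda>k. y $ k) (\<lambda>z. V z j) x) =
      (\<Sum>i\<in>UNIV. \<Sum>k\<in>UNIV. (y $ i * y $ k) * (db k x i - (\<Sum>j\<in>UNIV. da k x i j * V x j) - b x $ i * (w k x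
          - DV k x)))"
      using * by simp
    also have "\<dots> = ?d - (\<Sum>i\<in>UNIV. \<Sum>k\<in>UNIV. \<Sum>j\<in>UNIV. y $ k * y $ i * (da k x i j * V x j))
       - (\<Sum>i\<in>UNIV. b x $ i * y $ i) * (\<Sum>k\<in>UNIV. y $ k * (w k x - DV k x))"
      unfolding sum_product by (simp add: right_diff_distrib sum_subtractf sum_distrib_left mult_ac)
    also have "(\<Sum>i\<in>UNIV. \<Sum>k\<in>UNIV. \<Sum>j\<in>UNIV. y $ k * y $ i * (da k x i j * V x j)) = ?T"
      by (rule sum.swap)
    finally show ?thesis by (simp add: be_def)
  qed
  have 3: "dir (\<lambda>k. y $ k) b2 x = (\<Sum>k\<in>UNIV. y $ k * (w k x - DV k x)) + (\<Sum>k\<in>UNIV. y $ k * w k x)"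
    unfolding dir_def partial_b2[OF x] sum.distrib[symmetric] by (simp add: algebra_simps)
  have 4: "(\<Sum>k\<in>UNIV. V x k * cal k x y) = 2 * ?T - ?S"
  proof -
    have "(\<Sum>k\<in>UNIV. V x k * (\<Sum>m\<in>UNIV. y $ m * (\<Sum>l\<in>UNIV. da m x k l * y $ l))) = ?T"
    proof -
      have "(\<Sum>k\<in>UNIV. V x k * (\<Sum>m\<in>UNIV. y $ m * (\<Sum>l\<in>UNIV. da m x k l * y $ l)))
          = (\<Sum>k\<in>UNIV. \<Sum>m\<in>UNIV. \<Sum>l\<in>UNIV. V x k * (y $ m * (da m x k l * y $ l)))"
        by (simp only: sum_distrib_left)
      also have "\<dots> = (\<Sum>m\<in>UNIV. \<Sum>l\<in>UNIV. \<Sum>k\<in>UNIV. V x k * (y $ m * (da m x k l * y $ l)))"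
        by (subst sum.swap, rule sum.cong[OF refl], rule sum.swap)
      also have "\<dots> = ?T"
        by (intro sum.cong refl) (simp add: da_sym[OF x, of _ _] mult_ac)
      finally show ?thesis .
    qed
    moreover have "V x k * cal k x y = 2 * (V x k * (\<Sum>m\<in>UNIV. y $ m * (\<Sum>l\<in>UNIV. da m x k l * y $ l)))
       - V x k * (\<Sum>i\<in>UNIV. \<Sum>j\<in>UNIV. da k x i j * y $ i * y $ j)" for k
      unfolding cal_eq by (simp add: right_diff_distrib)
    ultimately show ?thesis by (simp add: sum_subtractf flip: sum_distrib_left)
  qed
  have 5: "2 * s0 x y = (\<Sum>k\<in>UNIV. y $ k * w k x) - (\<Sum>i\<in>UNIV. z i x * y $ i)"
    unfolding s0_eq by (simp add: right_diff_distrib sum_subtractf mult.commute)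
  show ?thesis using 5 unfolding 1 2 3 ee_eq 4 by algebra
qed

end

lemma dir_const: "dir u (\<lambda>_. c) x = 0"
  by (simp add: dir_def)

text \<open>Two charts on their overlap \<open>W\<close>, with \<open>\<phi>\<close> the transition
  map: \<open>a\<close> and \<open>b\<close> are pullbacks of \<open>a'\<close> and
  \<open>b'\<close>. Invertibility of the Jacobian is recorded as surjectivity, the form in which
  \<open>V_push\<close> uses it.\<close>

locale chart_change = c: randers_chart U a b + d: randers_chart U' a' b'
  for U :: "(real^'n::finite) set" and a b and U' :: "(real^'n) set" and a' b' +
  fixes W :: "(real^'n) set" and \<phi> :: "real^'n \<Rightarrow> real^'n"
  assumes W_sub: "W \<subseteq> U" and phi_in: "x \<in> W \<Longrightarrow> \<phi> x \<in> U'"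
    and open_W: "open W"
    and smooth_phi: "smooth_on W (\<lambda>x. \<phi> x $ k)"
    and a_eq: "x \<in> W \<Longrightarrow> a x $ i $ j =
      (\<Sum>k\<in>UNIV. \<Sum>l\<in>UNIV. a' (\<phi> x) $ k $ l * (jac \<phi> i k x * jac \<phi> j l x))"
    and b_eq: "x \<in> W \<Longrightarrow> b x $ i = (\<Sum>k\<in>UNIV. b' (\<phi> x) $ k * jac \<phi> i k x)"
    and jac_surj: "x \<in> W \<Longrightarrow> \<exists>z :: real^'n. \<forall>k. (\<Sum>i\<in>UNIV. z $ i * jac \<phi> i k x) = u k"
begin

definition push :: "real^'n \<Rightarrow> ('n \<Rightarrow> real) \<Rightarrow> 'n \<Rightarrow> real" where
  "push x u k = (\<Sum>i\<in>UNIV. u i * jac \<phi> i k x)"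

lemma push_dir: "push x u k = dir u (\<lambda>z. \<phi> z $ k) x"
  by (simp add: push_def dir_def jac_def)

lemma bilinear_push:
  fixes A A' :: "real^'n^'n"
  assumes "\<And>i j. A $ i $ j = (\<Sum>k\<in>UNIV. \<Sum>l\<in>UNIV. A' $ k $ l * (jac \<phi> i k x * jac \<phi> j l x))"
  shows "(\<Sum>i\<in>UNIV. \<Sum>j\<in>UNIV. A $ i $ j * u i * v j) = (\<Sum>k\<in>UNIV. \<Sum>l\<in>UNIV. A' $ k $ l * push x u k * push x v l)"
proof -
  have "(\<Sum>i\<in>UNIV. \<Sum>j\<in>UNIV. A $ i $ j * u i * v j) =
      (\<Sum>i\<in>UNIV. \<Sum>j\<in>UNIV. \<Sum>k\<in>UNIV. \<Sum>l\<in>UNIV. A' $ k $ l * ((u i * jac \<phi> i k x) * (v j * jac \<phi> j l x)))"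
    unfolding assms by (simp add: sum_distrib_left sum_distrib_right mult_ac)
  also have "\<dots> = (\<Sum>(i, j, k, l)\<in>UNIV. A' $ k $ l * ((u i * jac \<phi> i k x) * (v j * jac \<phi> j l x)))"
    by (simp add: sum.cartesian_product)
  also have "\<dots> = (\<Sum>(k, l, i, j)\<in>UNIV. A' $ k $ l * ((u i * jac \<phi> i k x) * (v j * jac \<phi> j l x)))"
    by (rule sum.reindex_bij_witness[of _ "\<lambda>(k, l, i, j). (i, j, k, l)" "\<lambda>(i, j, k, l). (k, l, i, j)"]) auto
  also have "\<dots>
      = (\<Sum>k\<in>UNIV. \<Sum>l\<in>UNIV. \<Sum>i\<in>UNIV. \<Sum>j\<in>UNIV. A' $ k $ l * ((u i * jac \<phi> i k x) * (v j * jac \<phi> j l x)))"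
    by (simp add: sum.cartesian_product)
  also have "\<dots> = (\<Sum>k\<in>UNIV. \<Sum>l\<in>UNIV. A' $ k $ l * push x u k * push x v l)"
    unfolding push_def mult.assoc sum_product by (simp add: sum_distrib_left)
  finally show ?thesis .
qed

lemma linear_push: "x \<in> W \<Longrightarrow> (\<Sum>i\<in>UNIV. b x $ i * u i) = (\<Sum>k\<in>UNIV. b' (\<phi> x) $ k * push x u k)"
  unfolding b_eq push_def by (simp add: sum_distrib_left sum_distrib_right mult_ac) (rule sum.swap)

lemma be_push: "x \<in> W \<Longrightarrow> c.be x y = d.be (\<phi> x) (\<chi> k. push x (($) y) k)"
  using linear_push[of x "($) y"] by (simp add: c.be_def d.be_def)

lemma Q_eq:
  assumes "x \<in> W"
  shows "c.Q x $ i $ j = (\<Sum>k\<in>UNIV. \<Sum>l\<in>UNIV. d.Q (\<phi> x) $ k $ l * (jac \<phi> i k x * jac \<phi> j l x))"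
proof -
  have "b x $ i * b x $ j = (\<Sum>k\<in>UNIV. \<Sum>l\<in>UNIV. b' (\<phi> x) $ k * b' (\<phi> x) $ l * (jac \<phi> i k x * jac \<phi> j l x))"
    unfolding b_eq[OF assms] sum_product by (simp add: mult_ac)
  thus ?thesis
    unfolding c.Q_def d.Q_def by (simp add: a_eq[OF assms] left_diff_distrib sum_subtractf)
qed

lemma qq_push: "x \<in> W \<Longrightarrow> c.qq x y = d.qq (\<phi> x) (\<chi> k. push x (($) y) k)"
  using bilinear_push[OF Q_eq, of x "($) y" "($) y"] by (simp add: c.qq_Q d.qq_Q)

text \<open>\<open>V\<close> is characterized by \<open>a V = b\<close>. The covector
  \<open>a'\<close> applied to the pushed \<open>V\<close> agrees with \<open>b'\<close> on all
  pushed vectors, and these are all vectors.\<close>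

lemma V_push:
  assumes x: "x \<in> W"
  shows "d.V (\<phi> x) k = push x (c.V x) k"
proof -
  have xU: "x \<in> U" using x W_sub by auto
  have x'U: "\<phi> x \<in> U'" by (rule phi_in[OF x])
  define r where "r k = (\<Sum>l\<in>UNIV. a' (\<phi> x) $ k $ l * push x (c.V x) l)" for k
  have r: "r k = b' (\<phi> x) $ k" for k
  proof -
    \<comment> \<open>A vector whose image is the \<open>k\<close>-th unit vector, so that testing
      against it isolates component \<open>k\<close>.\<close>
    obtain z where z: "push x (($) z) l = of_bool (l = k)" for l
      using jac_surj[OF x, of "\<lambda>l. of_bool (l = k)"] unfolding push_def by blast
    have "r k = (\<Sum>l\<in>UNIV. \<Sum>m\<in>UNIV. a' (\<phi> x) $ l $ m * push x (($) z) l * push x (c.V x) m)"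
      unfolding z r_def by (subst sum.swap) (simp add: sum_of_bool flip: sum_distrib_right)
    also have "\<dots> = (\<Sum>i\<in>UNIV. \<Sum>j\<in>UNIV. a x $ i $ j * z $ i * c.V x j)"
      by (rule bilinear_push[OF a_eq[OF x], symmetric])
    also have "\<dots> = (\<Sum>i\<in>UNIV. z $ i * (\<Sum>j\<in>UNIV. a x $ i $ j * c.V x j))"
      by (simp add: sum_distrib_left mult_ac)
    also have "\<dots> = (\<Sum>k\<in>UNIV. b' (\<phi> x) $ k * push x (($) z) k)"
      unfolding c.a_V[OF xU] linear_push[OF x, symmetric] by (simp add: mult.commute)
    also have "\<dots> = b' (\<phi> x) $ k" unfolding z by (simp only: sum_of_bool)
    finally show ?thesis .
  qed
  have "d.V (\<phi> x) k = (\<Sum>l\<in>UNIV. d.ai (\<phi> x) $ k $ l * r l)"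
    by (simp add: d.V_def d.up_def r)
  also have "\<dots> = (\<Sum>m\<in>UNIV. (\<Sum>l\<in>UNIV. d.ai (\<phi> x) $ k $ l * a' (\<phi> x) $ l $ m) * push x (c.V x) m)"
    unfolding r_def by (simp add: sum_distrib_left sum_distrib_right mult.assoc) (rule sum.swap)
  also have "\<dots> = push x (c.V x) k"
    unfolding d.ai_left[OF x'U] by (simp only: sum_of_bool)
  finally show ?thesis .
qed

lemma b2_push: "x \<in> W \<Longrightarrow> c.b2 x = d.b2 (\<phi> x)"
  unfolding c.b2_def d.b2_def linear_push V_push ..

lemma smooth_jac: "smooth_on W (\<lambda>z. jac \<phi> i k z)"
  unfolding jac_def by (intro smooth_on_partial smooth_phi)

lemma smooth_push: "smooth_on W (\<lambda>z. push z u k)"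
  unfolding push_def by (intro smooth_on_sum smooth_on_mult smooth_on_const smooth_jac open_W)

text \<open>The formula \<open>ee_Lie\<close> is compared term by term. Second derivatives of
  \<open>\<phi>\<close> enter only through \<open>h\<close>, the Hessian of \<open>\<phi>\<close> at
  \<open>(V, y)\<close>: as \<open>+ 2 Q(y, h)\<close> from differentiating \<open>qq\<close> along
  \<open>V\<close>, and as \<open>- 2 Q(y, h)\<close> from differentiating \<open>V\<close> along
  \<open>y\<close>.\<close>

lemma ee_push:
  assumes x: "x \<in> W"
  shows "c.ee x y = d.ee (\<phi> x) (\<chi> k. push x (($) y) k)"
proof -
  have xU: "x \<in> U" using x W_sub by auto
  have x'U: "\<phi> x \<in> U'" by (rule phi_in[OF x])
  let ?x' = "\<phi> x" and ?y = "($) y" and ?y' = "\<chi> k. push x (($) y) k"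
  have y': "($) ?y' = push x ?y" by (simp add: fun_eq_iff)
  have dphi: "(\<lambda>z. \<phi> z $ k) differentiable (at x)" for k
    by (rule smooth_on_differentiable[OF smooth_phi x])
  note chain = dir_chain[of \<phi> x, OF dphi]
  have dQ: "(\<lambda>z. d.Q z $ k $ l) differentiable (at ?x')" for k l
    by (rule smooth_on_differentiable[OF d.smooth_Q x'U])
  have dp: "(\<lambda>z. push z ?y k) differentiable (at x)" for k
    by (rule smooth_on_differentiable[OF smooth_push x])
  define h where "h k = dir (c.V x) (\<lambda>z. push z ?y k) x" for k
  have dirV: "dir (c.V x) (\<lambda>z. g (\<phi> z)) x = dir (d.V ?x') g ?x'" if "g differentiable (at ?x')" for g
    unfolding chain(1)[OF that] push_dir[symmetric] V_push[OF x, symmetric] ..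
  have diry: "dir ?y (\<lambda>z. g (\<phi> z)) x = dir (push x ?y) g ?x'" if "g differentiable (at ?x')" for g
    unfolding chain(1)[OF that] push_dir[symmetric] ..
  have 1: "dir (c.V x) (\<lambda>z. c.qq z y) x = dir (d.V ?x') (\<lambda>z. d.qq z ?y') ?x'
      + 2 * (\<Sum>k\<in>UNIV. \<Sum>l\<in>UNIV. d.Q ?x' $ k $ l * push x ?y k * h l)"
  proof -
    have e: "dir (c.V x) (\<lambda>z. c.qq z y) x
        = dir (c.V x) (\<lambda>z. \<Sum>k\<in>UNIV. \<Sum>l\<in>UNIV. d.Q (\<phi> z) $ k $ l * push z ?y k * push z ?y l) x"
      by (rule dir_cong[OF open_W x]) (simp add: qq_push d.qq_Q)
    have dQp: "(\<lambda>z. d.Q (\<phi> z) $ k $ l) differentiable (at x)" for k l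
      by (rule chain(2)[OF dQ])
    have d3: "dir (c.V x) (\<lambda>z. d.Q (\<phi> z) $ k $ l * push z ?y k * push z ?y l) x =
       dir (d.V ?x') (\<lambda>z. d.Q z $ k $ l) ?x' * push x ?y k * push x ?y l
       + d.Q ?x' $ k $ l * push x ?y k * h l + d.Q ?x' $ k $ l * push x ?y l * h k" for k l
      by (subst dir_mult, (intro differentiable_mult dQp dp)+, subst dir_mult, (intro dQp dp)+)
         (simp add: dirV[OF dQ] h_def algebra_simps)
    have "dir (c.V x) (\<lambda>z. c.qq z y) x
        = (\<Sum>k\<in>UNIV. \<Sum>l\<in>UNIV. dir (d.V ?x') (\<lambda>z. d.Q z $ k $ l) ?x' * push x ?y k * push x ?y l)
       + (\<Sum>k\<in>UNIV. \<Sum>l\<in>UNIV. d.Q ?x' $ k $ l * push x ?y k * h l)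
       + (\<Sum>k\<in>UNIV. \<Sum>l\<in>UNIV. d.Q ?x' $ k $ l * push x ?y l * h k)"
      unfolding e
      by (subst dir_sum, (intro differentiable_sum differentiable_mult dQp dp ballI
          finite_class.finite_UNIV)+,
          subst dir_sum, (intro differentiable_mult dQp dp finite_class.finite_UNIV)+)
         (simp only: d3 sum.distrib)
    also have "(\<Sum>k\<in>UNIV. \<Sum>l\<in>UNIV. d.Q ?x' $ k $ l * push x ?y l * h k)
        = (\<Sum>k\<in>UNIV. \<Sum>l\<in>UNIV. d.Q ?x' $ k $ l * push x ?y k * h l)"
      by (subst sum.swap) (simp add: d.Q_def d.sym_a[OF x'U] mult_ac)
    also have "(\<Sum>k\<in>UNIV. \<Sum>l\<in>UNIV. dir (d.V ?x') (\<lambda>z. d.Q z $ k $ l) ?x' * push x ?y k * push x ?y l)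
        = dir (d.V ?x') (\<lambda>z. d.qq z ?y') ?x'"
    proof -
      have "dir u (\<lambda>z. d.Q z $ k $ l * s * t) ?x' = dir u (\<lambda>z. d.Q z $ k $ l) ?x' * s * t" for u k l s t
        using dQ by (subst dir_mult, (intro differentiable_mult differentiable_const dQ)+, subst dir_mult)
          (simp_all add: dir_def)
      thus ?thesis unfolding d.qq_Q
        by (subst dir_sum, (intro differentiable_sum differentiable_mult differentiable_const dQ ballI
            finite_class.finite_UNIV)+,
          subst dir_sum, (intro differentiable_mult differentiable_const dQ finite_class.finite_UNIV)+) simp
    qed
    finally show ?thesis by simp
  qed
  have 2: "push x (\<lambda>j. dir ?y (\<lambda>z. c.V z j) x) l = dir (push x ?y) (\<lambda>z. d.V z l) ?x' - h l" for l
  proof -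
    have dV: "(\<lambda>z. d.V z l) differentiable (at ?x')"
      by (rule smooth_on_differentiable[OF d.smooth_V x'U])
    have "dir (push x ?y) (\<lambda>z. d.V z l) ?x' = dir ?y (\<lambda>z. d.V (\<phi> z) l) x"
      by (rule diry[OF dV, symmetric])
    also have "\<dots> = dir ?y (\<lambda>z. \<Sum>i\<in>UNIV. c.V z i * jac \<phi> i l z) x"
      by (rule dir_cong[OF open_W x]) (simp add: V_push push_def)
    also have "\<dots> = (\<Sum>i\<in>UNIV. dir ?y (\<lambda>z. c.V z i) x * jac \<phi> i l x + c.V x i * dir ?y (jac \<phi> i l) x)"
      by (subst dir_sum)
        (auto simp: dir_mult c.diff_V[OF xU] smooth_on_differentiable[OF smooth_jac x])
    also have "\<dots> = push x (\<lambda>j. dir ?y (\<lambda>z. c.V z j) x) l + (\<Sum>i\<in>UNIV. c.V x i * dir ?y (jac \<phi> i l) x)"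
      by (simp add: push_def sum.distrib)
    also have "(\<Sum>i\<in>UNIV. c.V x i * dir ?y (jac \<phi> i l) x) = h l"
    proof -
      \<comment> \<open>The symmetry of the Hessian of \<open>\<phi>\<close> identifies the term
        from differentiating \<open>V\<close> along \<open>y\<close> with the term from
        differentiating the pushed \<open>y\<close> along \<open>V\<close>.\<close>
      have "partial j (jac \<phi> i l) x = partial i (jac \<phi> j l) x" for i j
        unfolding jac_def using partial_commute[OF smooth_phi x] by simp
      hence "(\<Sum>i\<in>UNIV. c.V x i * dir ?y (jac \<phi> i l) x)
          = (\<Sum>i\<in>UNIV. \<Sum>j\<in>UNIV. c.V x i * (y $ j * partial i (jac \<phi> j l) x))"
        by (simp add: dir_def sum_distrib_left)
      also have "\<dots> = (\<Sum>j\<in>UNIV. y $ j * dir (c.V x) (jac \<phi> j l) x)"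
        by (subst sum.swap) (simp add: dir_def sum_distrib_left mult_ac)
      also have "\<dots> = h l"
        unfolding h_def push_def
        by (subst dir_sum) (auto simp: dir_mult smooth_on_differentiable[OF smooth_jac x] dir_const)
      finally show ?thesis .
    qed
    finally show ?thesis by simp
  qed
  have "(\<Sum>i\<in>UNIV. \<Sum>j\<in>UNIV. c.Q x $ i $ j * y $ i * dir ?y (\<lambda>z. c.V z j) x) =
      (\<Sum>k\<in>UNIV. \<Sum>l\<in>UNIV. d.Q ?x' $ k $ l * push x ?y k * dir (push x ?y) (\<lambda>z. d.V z l) ?x')
      - (\<Sum>k\<in>UNIV. \<Sum>l\<in>UNIV. d.Q ?x' $ k $ l * push x ?y k * h l)"
    unfolding bilinear_push[OF Q_eq[OF x]] 2 by (simp add: right_diff_distrib sum_subtractf)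
  moreover have "dir ?y c.b2 x = dir (push x ?y) d.b2 ?x'"
  proof -
    have "dir ?y c.b2 x = dir ?y (\<lambda>z. d.b2 (\<phi> z)) x"
      by (rule dir_cong[OF open_W x b2_push])
    thus ?thesis by (simp add: diry smooth_on_differentiable[OF d.smooth_b2 x'U])
  qed
  ultimately have "2 * c.ee x y = 2 * d.ee ?x' ?y'"
    unfolding c.ee_Lie[OF xU] d.ee_Lie[OF x'U] 1 be_push[OF x] y' by simp
  thus ?thesis by simp
qed

lemma factor_invariant:
  assumes x: "x \<in> W" and y: "(y :: real^'n) \<noteq> 0"
    and e: "\<And>y. c.ee x y = 2 * \<kappa> * c.qq x y" and e': "\<And>y. d.ee (\<phi> x) y = 2 * \<kappa>' * d.qq (\<phi> x) y"
  shows "\<kappa> = \<kappa>'"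
proof -
  have "2 * \<kappa> * c.qq x y = 2 * \<kappa>' * c.qq x y"
    using ee_push[OF x, of y] unfolding e e' qq_push[OF x] .
  thus ?thesis using c.qq_pos[of x y] x y W_sub by auto
qed

end

section \<open>From charts to the manifold\<close>

locale atlas =
  fixes X :: "'m topology" and A :: "('m, 'n::finite) chart set"
  assumes atlas: "smooth_atlas X A"
begin

lemma chart: "c \<in> A \<Longrightarrow> is_chart X c"
  using atlas by (simp add: smooth_atlas_def)

lemma chart_sub: "c \<in> A \<Longrightarrow> fst c \<subseteq> topspace X"
  using chart[of c] openin_subset[of X "fst c"] by (simp add: is_chart_def)

lemma chart_inj: assumes "c \<in> A" shows "inj_on (snd c) (fst c)"
proof -
  have "inj_on (snd c) (topspace (subtopology X (fst c)))"
    using chart[OF assms] homeomorphic_imp_injective_map unfolding is_chart_def by blast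
  thus ?thesis using chart_sub[OF assms] by (simp add: Int_absorb1)
qed

lemma chart_inv_snd: "c \<in> A \<Longrightarrow> p \<in> fst c \<Longrightarrow> chart_inv c (snd c p) = p"
  by (simp add: chart_inv_def chart_inj)

lemma chart_inv_in: "x \<in> snd c ` fst c \<Longrightarrow> chart_inv c x \<in> fst c"
  by (simp add: chart_inv_def inv_into_into)

lemma snd_chart_inv: "x \<in> snd c ` fst c \<Longrightarrow> snd c (chart_inv c x) = x"
  by (simp add: chart_inv_def f_inv_into_f)

lemma transition_snd: "c \<in> A \<Longrightarrow> p \<in> fst c \<Longrightarrow> transition c d (snd c p) = snd d p"
  by (simp add: transition_def chart_inv_snd)

lemma smooth_transition:
  "c \<in> A \<Longrightarrow> d \<in> A \<Longrightarrow> smooth_on (snd c ` (fst c \<inter> fst d)) (\<lambda>x. transition c d x $ i)"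
  using atlas by (simp add: smooth_atlas_def)

lemma open_overlap: "c \<in> A \<Longrightarrow> d \<in> A \<Longrightarrow> open (snd c ` (fst c \<inter> fst d))"
  using smooth_transition smooth_on_open by blast

lemma open_chart: "c \<in> A \<Longrightarrow> open (snd c ` fst c)"
  using open_overlap[of c c] by simp

abbreviation D :: "('m, 'n) chart \<Rightarrow> ('m, 'n) chart \<Rightarrow> 'm \<Rightarrow> real^'n \<Rightarrow> real^'n" where
  "D c d p \<equiv> frechet_derivative (transition c d) (at (snd c p))"

lemma transition_has_derivative:
  assumes "c \<in> A" "d \<in> A" "p \<in> fst c" "p \<in> fst d"
  shows "(transition c d has_derivative D c d p) (at (snd c p))"
    and D_eq: "D c d p h = (\<chi> k. \<Sum>i\<in>UNIV. h $ i * jac (transition c d) i k (snd c p))"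
proof -
  have *: "(transition c d has_derivative (\<lambda>h. \<chi> k. \<Sum>i\<in>UNIV. h $ i * jac (transition c d) i k (snd c p)))
      (at (snd c p))"
    by (intro has_derivative_jac smooth_on_differentiable[OF smooth_transition]) (use assms in auto)
  note e = frechet_derivative_at[OF *, symmetric]
  show "(transition c d has_derivative D c d p) (at (snd c p))" unfolding e by (rule *)
  show "D c d p h = (\<chi> k. \<Sum>i\<in>UNIV. h $ i * jac (transition c d) i k (snd c p))" unfolding e ..
qed

lemma D_comp:
  assumes "c \<in> A" "d \<in> A" "e \<in> A" "p \<in> fst c" "p \<in> fst d" "p \<in> fst e"
  shows "D d e p (D c d p y) = D c e p y"
proof -
  let ?S = "snd c ` (fst c \<inter> fst d) \<inter> snd c ` (fst c \<inter> fst e)"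
  have "((\<lambda>x. transition d e (transition c d x)) has_derivative (\<lambda>y. D d e p (D c d p y))) (at (snd c p))"
    using transition_has_derivative(1)[OF assms(1,2,4,5)] transition_has_derivative(1)[OF assms(2,3,5,6)]
      transition_snd[OF assms(1,4), of d] by (auto intro: has_derivative_compose)
  moreover have "open ?S" by (intro open_Int open_overlap assms)
  moreover have "snd c p \<in> ?S" using assms by auto
  moreover have "transition d e (transition c d x) = transition c e x" if x: "x \<in> ?S" for x
  proof -
    obtain q where q: "x = snd c q" "q \<in> fst c" "q \<in> fst d" using x by blast
    obtain r where r: "x = snd c r" "r \<in> fst c" "r \<in> fst e" using x by blast
    have "q = r" using q r chart_inj[OF assms(1)] by (auto dest: inj_onD)
    thus ?thesis using q r by (simp add: transition_snd assms)
  qed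
  ultimately have "(transition c e has_derivative (\<lambda>y. D d e p (D c d p y))) (at (snd c p))"
    by (rule has_derivative_transform_within_open)
  thus ?thesis using frechet_derivative_at by metis
qed

lemma D_id: assumes "c \<in> A" "p \<in> fst c" shows "D c c p y = y"
proof -
  have "(transition c c has_derivative (\<lambda>y. y)) (at (snd c p))"
  proof (rule has_derivative_transform_within_open[OF has_derivative_ident open_chart[OF assms(1)]])
    fix x assume "x \<in> snd c ` fst c"
    thus "x = transition c c x" using transition_snd[OF assms(1), of _ c] by auto
  qed (use assms in auto)
  thus ?thesis using frechet_derivative_at by metis
qed

lemma D_linear: "c \<in> A \<Longrightarrow> d \<in> A \<Longrightarrow> p \<in> fst c \<Longrightarrow> p \<in> fst d \<Longrightarrow> linear (D c d p)"
  using transition_has_derivative(1) has_derivative_linear by blast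

text \<open>Together with \<open>tvec_in\<close> and \<open>tvec_same\<close> this identifies the
  tangent space with its components in the chart \<open>c\<close>. On charts that do not contain
  \<open>p\<close> both sides have the prescribed value 0.\<close>

lemma tvec_self:
  assumes c: "c \<in> A" "p \<in> fst c" and v: "v \<in> tangent_space A p"
  shows "tvec_of A c p (v c) = v"
proof
  fix d
  show "tvec_of A c p (v c) d = v d"
  proof (cases "d \<in> A \<and> p \<in> fst d")
    case True
    hence "v d = D c d p (v c)" using v c unfolding tangent_space_def by blast
    thus ?thesis using True by (simp add: tvec_of_def)
  next
    case False
    hence "v d = 0" using v unfolding tangent_space_def by blast
    thus ?thesis unfolding tvec_of_def using False by (simp only: if_False)
  qed
qed

lemma tvec_in:
  assumes c: "c \<in> A" "p \<in> fst c"
  shows "tvec_of A c p y \<in> tangent_space A p"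
  unfolding tangent_space_def
proof (intro CollectI conjI ballI allI impI)
  fix d e assume "d \<in> A" "e \<in> A" "p \<in> fst d \<inter> fst e"
  thus "tvec_of A c p y e = D d e p (tvec_of A c p y d)"
    using c by (simp add: tvec_of_def D_comp)
next
  fix d assume "\<not> (d \<in> A \<and> p \<in> fst d)"
  thus "tvec_of A c p y d = 0" unfolding tvec_of_def by (simp only: if_False)
qed

lemma tvec_same: "c \<in> A \<Longrightarrow> p \<in> fst c \<Longrightarrow> tvec_of A c p y c = y"
  by (simp add: tvec_of_def D_id)

lemma tvec_change: "c \<in> A \<Longrightarrow> d \<in> A \<Longrightarrow> p \<in> fst c \<Longrightarrow> p \<in> fst d \<Longrightarrow> tvec_of A d p (D c d p y) = tvec_of A c p y"
  using tvec_self[of d p "tvec_of A c p y"] tvec_in[of c p y] by (simp add: tvec_of_def)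

lemma tvec_linear:
  "c \<in> A \<Longrightarrow> p \<in> fst c \<Longrightarrow> tvec_of A c p (s *\<^sub>R y + z) = (\<lambda>d. s *\<^sub>R tvec_of A c p y d + tvec_of A c p z d)"
  by (rule ext) (simp add: tvec_of_def linear_add linear_cmul D_linear)

lemma tvec_eq_0:
  assumes "c \<in> A" "p \<in> fst c"
  shows "tvec_of A c p y = (\<lambda>_. 0) \<longleftrightarrow> y = 0"
proof
  assume "tvec_of A c p y = (\<lambda>_. 0)"
  thus "y = 0" using tvec_same[OF assms, of y] by simp
next
  assume "y = 0"
  moreover have "D c d p 0 = 0" if "d \<in> A" "p \<in> fst d" for d
    by (rule linear_0[OF D_linear[OF assms(1) that(1) assms(2) that(2)]])
  ultimately show "tvec_of A c p y = (\<lambda>_. 0)" by (simp add: tvec_of_def fun_eq_iff)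
qed

lemma linear_expand:
  assumes c: "c \<in> A" "p \<in> fst c"
    and T: "\<And>u v s. u \<in> tangent_space A p \<Longrightarrow> v \<in> tangent_space A p \<Longrightarrow> T (\<lambda>c. s *\<^sub>R u c + v c) = s * T u
        + (T v :: real)"
  shows "T (tvec_of A c p y) = (\<Sum>i\<in>UNIV. T (tvec_of A c p (axis i 1)) * y $ i)"
proof -
  let ?g = "\<lambda>y. T (tvec_of A c p y)"
  have g: "?g (s *\<^sub>R y + z) = s * ?g y + ?g z" for s y z
    by (simp add: tvec_linear[OF c] T tvec_in[OF c])
  have g0: "?g 0 = 0" using g[of 1 0 0] by simp
  have l: "linear ?g"
  proof
    show "?g (y + z) = ?g y + ?g z" for y z using g[of 1 y z] by simp
    show "?g (s *\<^sub>R y) = s *\<^sub>R ?g y" for s y using g[of s y 0] g0 by simp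
  qed
  have "?g y = ?g (\<Sum>i\<in>UNIV. y $ i *\<^sub>R axis i 1)"
    by (simp add: basis_expansion[of y, unfolded scalar_mult_eq_scaleR])
  also have "\<dots> = (\<Sum>i\<in>UNIV. ?g (y $ i *\<^sub>R axis i 1))"
    by (rule linear_sum[OF l])
  also have "\<dots> = (\<Sum>i\<in>UNIV. y $ i * ?g (axis i 1))"
    using g[of _ _ 0] g0 by simp
  finally show ?thesis by (simp add: mult.commute)
qed

lemma one_form_expand:
  assumes "one_form A X \<theta>" "c \<in> A" "p \<in> fst c"
  shows "\<theta> p (tvec_of A c p y) = (\<Sum>i\<in>UNIV. \<theta> p (tvec_of A c p (axis i 1)) * y $ i)"
  by (rule linear_expand) (use assms chart_sub[of c] in \<open>auto simp: one_form_def\<close>)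

end

section \<open>Local data of a Randers metric on the manifold\<close>

locale randers_manifold = atlas X A for X :: "'m topology" and A :: "('m, 'n::finite) chart set" +
  fixes g :: "'m \<Rightarrow> ('m, 'n) tvec \<Rightarrow> ('m, 'n) tvec \<Rightarrow> real" and \<beta> :: "'m \<Rightarrow> ('m, 'n) tvec \<Rightarrow> real"
  assumes metric: "riemannian_metric A X g" and form: "one_form A X \<beta>"
    and norm_less: "p \<in> topspace X \<Longrightarrow> dual_norm A g \<beta> p < 1"
begin

definition ca :: "('m, 'n) chart \<Rightarrow> real^'n \<Rightarrow> real^'n^'n" where
  "ca c x = (\<chi> i j. g (chart_inv c x) (tvec_of A c (chart_inv c x) (axis i 1)) (tvec_of A c (chart_inv c
      x) (axis j 1)))"

definition cb :: "('m, 'n) chart \<Rightarrow> real^'n \<Rightarrow> real^'n" where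
  "cb c x = (\<chi> i. \<beta> (chart_inv c x) (tvec_of A c (chart_inv c x) (axis i 1)))"

lemma g_sym: "p \<in> topspace X \<Longrightarrow> u \<in> tangent_space A p \<Longrightarrow> v \<in> tangent_space A p \<Longrightarrow> g p u v = g p v u"
  using metric by (simp add: riemannian_metric_def)

lemma g_expand:
  assumes c: "c \<in> A" "p \<in> fst c"
  shows "g p (tvec_of A c p y) (tvec_of A c p z) = (\<Sum>i\<in>UNIV. \<Sum>j\<in>UNIV. ca c (snd c p) $ i $ j * y $ i * z $ j)"
proof -
  have p: "p \<in> topspace X" using chart_sub[OF c(1)] c(2) by auto
  note i = tvec_in[OF c]
  have L: "g p (\<lambda>c. s *\<^sub>R u c + v c) w = s * g p u w + g p v w"
    if "u \<in> tangent_space A p" "v \<in> tangent_space A p" "w \<in> tangent_space A p" for s u v w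
    using metric p that by (simp add: riemannian_metric_def)
  have 1: "g p (tvec_of A c p y) w = (\<Sum>i\<in>UNIV. g p (tvec_of A c p (axis i 1)) w * y $ i)"
      if "w \<in> tangent_space A p" for w y
    by (rule linear_expand[OF c]) (rule L[OF _ _ that])
  have "g p (tvec_of A c p (axis i 1)) (tvec_of A c p z)
      = (\<Sum>j\<in>UNIV. g p (tvec_of A c p (axis i 1)) (tvec_of A c p (axis j 1)) * z $ j)" for i
    using 1[OF i, of z "axis i 1"] by (simp add: g_sym[OF p i i, of "axis i 1"])
  hence "g p (tvec_of A c p y) (tvec_of A c p z) =
      (\<Sum>i\<in>UNIV. (\<Sum>j\<in>UNIV. g p (tvec_of A c p (axis i 1)) (tvec_of A c p (axis j 1)) * z $ j) * y $ i)"
    using 1[OF i, of y z] by simp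
  thus ?thesis using c by (simp add: ca_def chart_inv_snd sum_distrib_left sum_distrib_right mult_ac)
qed

lemma \<beta>_expand:
  assumes c: "c \<in> A" "p \<in> fst c"
  shows "\<beta> p (tvec_of A c p y) = (\<Sum>i\<in>UNIV. cb c (snd c p) $ i * y $ i)"
  using one_form_expand[OF form c, of y] c by (simp add: cb_def chart_inv_snd)

lemma g_pos:
  assumes c: "c \<in> A" "p \<in> fst c" "y \<noteq> 0"
  shows "g p (tvec_of A c p y) (tvec_of A c p y) > 0"
  using metric chart_sub[OF c(1)] c tvec_in[of c p y] tvec_eq_0[of c p y]
  unfolding riemannian_metric_def by blast

text \<open>A bound on the supremum in \<open>dual_norm\<close> bounds the individual quotients only
  once they are known to be bounded above. They are homogeneous of degree 0, so compactness of the
  coordinate unit sphere provides this.\<close>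

lemma \<beta>_less:
  assumes c: "c \<in> A" "p \<in> fst c" "y \<noteq> 0"
  shows "\<beta> p (tvec_of A c p y) < sqrt (g p (tvec_of A c p y) (tvec_of A c p y))"
proof -
  let ?t = "tvec_of A c p"
  let ?r = "\<lambda>v. \<beta> p v / sqrt (g p v v)"
  have p: "p \<in> topspace X" using chart_sub[OF c(1)] c(2) by auto
  have pos: "g p (?t y) (?t y) > 0" if "y \<noteq> 0" for y
    using g_pos[OF c(1,2) that] .
  have "continuous_on (sphere 0 1) (\<lambda>y. ?r (?t y))"
  proof (intro continuous_on_divide)
    show "continuous_on (sphere 0 1) (\<lambda>y. \<beta> p (?t y))" "continuous_on (sphere 0 1) (\<lambda>y. sqrt (g p (?t y)
        (?t y)))"
      unfolding \<beta>_expand[OF c(1,2)] g_expand[OF c(1,2)] by (intro continuous_intros)+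
    show "\<forall>y\<in>sphere 0 1. sqrt (g p (?t y) (?t y)) \<noteq> 0"
    proof
      fix y :: "real^'n" assume "y \<in> sphere 0 1"
      hence "y \<noteq> 0" by auto
      thus "sqrt (g p (?t y) (?t y)) \<noteq> 0" using pos[of y] by simp
    qed
  qed
  hence "compact ((\<lambda>y. ?r (?t y)) ` sphere 0 1)"
    by (intro compact_continuous_image) auto
  hence "bdd_above ((\<lambda>y. ?r (?t y)) ` sphere 0 1)"
    by (intro bounded_imp_bdd_above compact_imp_bounded)
  then obtain M where M: "\<And>y. y \<in> sphere 0 1 \<Longrightarrow> ?r (?t y) \<le> M"
    unfolding bdd_above_def by blast
  have scale: "?r (?t (s *\<^sub>R y)) = ?r (?t y)" if "s > 0" for s y
  proof -
    have "\<beta> p (?t (s *\<^sub>R y)) = s * \<beta> p (?t y)" "g p (?t (s *\<^sub>R y)) (?t (s *\<^sub>R y)) = s\<^sup>2 * g p (?t y) (?t y)"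
      unfolding \<beta>_expand[OF c(1,2)] g_expand[OF c(1,2)]
          by (simp_all add: sum_distrib_left power2_eq_square mult_ac)
    thus ?thesis using that by (simp add: real_sqrt_mult)
  qed
  have ub: "?r v \<le> M" if "v \<in> tangent_space A p - {\<lambda>_. 0}" for v
  proof -
    have v: "v = ?t (v c)" using tvec_self[OF c(1,2)] that by simp
    have "v c \<noteq> 0" using that v tvec_eq_0[OF c(1,2), of "v c"] by auto
    hence "?r (?t (v c)) = ?r (?t ((1 / norm (v c)) *\<^sub>R v c))" by (simp add: scale)
    also have "\<dots> \<le> M" by (rule M) (use \<open>v c \<noteq> 0\<close> in simp)
    finally show ?thesis using v by simp
  qed
  have "?t y \<in> tangent_space A p - {\<lambda>_. 0}" using c by (simp add: tvec_in tvec_eq_0)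
  hence "?r (?t y) \<le> dual_norm A g \<beta> p"
    unfolding dual_norm_def by (rule cSUP_upper) (use ub in \<open>auto intro!: bdd_aboveI2\<close>)
  also have "\<dots> < 1" by (rule norm_less[OF p])
  finally show ?thesis using pos[OF c(3)] by simp
qed

lemma randers_chart: assumes c: "c \<in> A" shows "randers_chart (snd c ` fst c) (ca c) (cb c)"
proof
  show "open (snd c ` fst c)" by (rule open_chart[OF c])
  show "smooth_on (snd c ` fst c) (\<lambda>x. ca c x $ i $ j)" for i j
    using metric c by (simp add: riemannian_metric_def ca_def)
  show "smooth_on (snd c ` fst c) (\<lambda>x. cb c x $ i)" for i
    using form c by (simp add: one_form_def cb_def)
  fix x assume "x \<in> snd c ` fst c"
  then obtain p where p: "p \<in> fst c" and x: "x = snd c p" by auto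
  have pX: "p \<in> topspace X" using chart_sub[OF c] p by auto
  show "ca c x $ i $ j = ca c x $ j $ i" for i j
    using g_sym[OF pX tvec_in[OF c p] tvec_in[OF c p]] by (simp add: ca_def x chart_inv_snd[OF c p])
  fix y :: "real^'n" assume y: "y \<noteq> 0"
  show "0 < (\<Sum>i\<in>UNIV. \<Sum>j\<in>UNIV. ca c x $ i $ j * y $ i * y $ j)"
    using g_pos[OF c p y] unfolding g_expand[OF c p] x .
  have "(\<Sum>i\<in>UNIV. cb c x $ i * y $ i) < sqrt (\<Sum>i\<in>UNIV. \<Sum>j\<in>UNIV. ca c x $ i $ j * y $ i * y $ j)"
    if "y \<noteq> 0" for y
    using \<beta>_less[OF c p that] unfolding g_expand[OF c p] \<beta>_expand[OF c p] x .
  \<comment> \<open>The one-sided bound at \<open>y\<close> and at \<open>- y\<close> together give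
    the absolute value.\<close>
  from this[OF y] this[of "- y"] y
  show "\<bar>\<Sum>i\<in>UNIV. cb c x $ i * y $ i\<bar> < sqrt (\<Sum>i\<in>UNIV. \<Sum>j\<in>UNIV. ca c x $ i $ j * y $ i * y $ j)"
    by (simp add: sum_negf)
qed

lemma chart_change:
  assumes c: "c \<in> A" and d: "d \<in> A"
  shows "chart_change (snd c ` fst c) (ca c) (cb c) (snd d ` fst d) (ca d) (cb d)
    (snd c ` (fst c \<inter> fst d)) (transition c d)"
proof (intro chart_change.intro chart_change_axioms.intro randers_chart[OF c] randers_chart[OF d]
    open_overlap[OF c d]
    smooth_transition[OF c d])
  show "snd c ` (fst c \<inter> fst d) \<subseteq> snd c ` fst c" by auto
  fix x assume "x \<in> snd c ` (fst c \<inter> fst d)"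
  then obtain p where p: "p \<in> fst c" "p \<in> fst d" and x: "x = snd c p" by auto
  have t: "transition c d x = snd d p" unfolding x by (rule transition_snd[OF c p(1)])
  show "transition c d x \<in> snd d ` fst d" using t p by simp
  have J: "D c d p (axis i 1) $ k = jac (transition c d) i k x" for i k
    unfolding D_eq[OF c d p] x by (simp add: axis_of_bool sum_of_bool)
  note ch = tvec_change[OF c d p]
  show "ca c x $ i $ j = (\<Sum>k\<in>UNIV. \<Sum>l\<in>UNIV. ca d (transition c d x) $ k $ l *
      (jac (transition c d) i k x * jac (transition c d) j l x))" for i j
    using g_expand[OF d p(2), of "D c d p (axis i 1)" "D c d p (axis j 1)"]
    unfolding ch t J by (simp add: ca_def x chart_inv_snd[OF c p(1)] mult.assoc)
  show "cb c x $ i = (\<Sum>k\<in>UNIV. cb d (transition c d x) $ k * jac (transition c d) i k x)" for i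
    using \<beta>_expand[OF d p(2), of "D c d p (axis i 1)"]
    unfolding ch t J by (simp add: cb_def x chart_inv_snd[OF c p(1)])
  fix u :: "'n \<Rightarrow> real"
  \<comment> \<open>The derivative of the reverse transition is a right inverse of the Jacobian,
    which is therefore surjective.\<close>
  have "D c d p (D d c p (\<chi> k. u k)) = (\<chi> k. u k)"
    using D_comp[OF d c d p(2,1,2)] D_id[OF d p(2)] by simp
  thus "\<exists>z :: real^'n. \<forall>k. (\<Sum>i\<in>UNIV. z $ i * jac (transition c d) i k x) = u k"
    unfolding D_eq[OF c d p] x by (auto simp: vec_eq_iff)
qed

end

theorem theorem1p1:
  fixes X :: "'m topology"
    and A :: "('m, 'n::finite) chart set"
    and F :: "'m \<Rightarrow> ('m, 'n) tvec \<Rightarrow> real"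
  assumes "smooth_manifold X A"
    and "randers_metric A X F"
    and "weakly_isotropic_scalar_curvature A X F"
  shows "isotropic_S_curvature A F"
proof -
  obtain g \<beta> where g: "riemannian_metric A X g" and b: "one_form A X \<beta>"
    and n: "\<And>p. p \<in> topspace X \<Longrightarrow> dual_norm A g \<beta> p < 1"
    and F: "\<And>p v. p \<in> topspace X \<Longrightarrow> v \<in> tangent_space A p \<Longrightarrow> F p v = sqrt (g p v v) + \<beta> p v"
    using assms(2) by (auto simp: randers_metric_def)
  obtain \<theta> \<mu> where \<theta>: "one_form A X \<theta>" and r: "\<And>c p v. c \<in> A \<Longrightarrow> p \<in> fst c \<Longrightarrow> v \<in> tangent_space A p - {\<lambda>_. 0} \<Longrightarrow>
        scalar_curv (local_metric A F c) (snd c p) (v c) =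
          real CARD('n) * (real CARD('n) - 1) * (\<theta> p v / F p v + \<mu> p)"
    using assms(3) unfolding weakly_isotropic_scalar_curvature_def by blast
  interpret randers_manifold X A g \<beta>
    using assms(1) g b n by unfold_locales (auto simp: smooth_manifold_def)
  define ee where "ee c = randers_chart.ee (ca c) (cb c)" for c
  define qq where "qq c = randers_chart.qq (ca c) (cb c)" for c
  \<comment> \<open>Any fixed nonzero vector would do. Evaluating at one vector gives the factor
    \<open>kc\<close> as a quotient that is smooth in \<open>x\<close>, and \<open>ee_qq\<close>
    shows that this factor serves all vectors.\<close>
  define e :: "real^'n" where "e = axis undefined 1"
  have e0: "e \<noteq> 0" by (simp add: e_def)
  define kc where "kc c x = ee c x e / (2 * qq c x e)" for c x
  have FL: "local_metric A F c x y = randers_chart.F (ca c) (cb c) x y" if c: "c \<in> A"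
      and x: "x \<in> snd c ` fst c" for c x y
  proof -
    interpret rc: randers_chart "snd c ` fst c" "ca c" "cb c" by (rule randers_chart[OF c])
    obtain p where p: "p \<in> fst c" and x: "x = snd c p" using x by auto
    have "p \<in> topspace X" using chart_sub[OF c] p by auto
    thus ?thesis
      unfolding local_metric_def x chart_inv_snd[OF c p] F[OF _ tvec_in[OF c p]]
        rc.F_def rc.al_def rc.A2_def rc.be_def
      by (simp add: F[OF _ tvec_in[OF c p]] g_expand[OF c p] \<beta>_expand[OF c p])
  qed
  have ee_qq: "ee c x y = 2 * kc c x * qq c x y" if c: "c \<in> A" and x: "x \<in> snd c ` fst c" for c x y
  proof -
    interpret rc: randers_chart "snd c ` fst c" "ca c" "cb c" by (rule randers_chart[OF c])
    have "rc.ee x y * rc.qq x e = rc.ee x e * rc.qq x y"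
    proof (rule rc.ee_proportional[OF _ _ x])
      show "\<forall>x\<in>snd c ` fst c. \<forall>y. local_metric A F c x y = rc.F x y" using FL[OF c] by blast
      fix x and y :: "real^'n" assume x: "x \<in> snd c ` fst c" and y: "y \<noteq> 0"
      let ?p = "chart_inv c x"
      have p: "?p \<in> fst c" and xp: "snd c ?p = x" using x by (simp_all add: chart_inv_in snd_chart_inv)
      have "tvec_of A c ?p y \<in> tangent_space A ?p - {\<lambda>_. 0}"
        using y by (simp add: tvec_in[OF c p] tvec_eq_0[OF c p])
      from r[OF c p this]
      show "scalar_curv (local_metric A F c) x y = real CARD('n) * (real CARD('n) - 1) *
          ((\<Sum>i\<in>UNIV. \<theta> ?p (tvec_of A c ?p (axis i 1)) * y $ i) / rc.F x y + \<mu> ?p)"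
        unfolding tvec_same[OF c p] xp one_form_expand[OF \<theta> c p, of y] using FL[OF c x, of y]
            by (simp add: local_metric_def)
    qed
    moreover have "rc.qq x e > 0" by (rule rc.qq_pos[OF x e0])
    ultimately show ?thesis by (simp add: kc_def ee_def qq_def field_simps)
  qed
  have inv: "kc c (snd c p) = kc d (snd d p)" if c: "c \<in> A" and d: "d \<in> A" and p: "p \<in> fst c" "p \<in> fst d"
      for c d p
  proof -
    interpret cc: chart_change "snd c ` fst c" "ca c" "cb c" "snd d ` fst d" "ca d" "cb d"
      "snd c ` (fst c \<inter> fst d)" "transition c d" by (rule chart_change[OF c d])
    show ?thesis
      by (rule cc.factor_invariant[of "snd c p" e])
         (use p e0 ee_qq[OF c, of "snd c p"] ee_qq[OF d, of "snd d p"] in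
           \<open>auto simp: transition_snd[OF c p(1)] ee_def qq_def\<close>)
  qed
  \<comment> \<open>The choice of a chart around \<open>p\<close> is immaterial by
    \<open>inv\<close>, so in each chart \<open>\<kappa>\<close> coincides with the smooth function
    \<open>kc c\<close>.\<close>
  define \<kappa> where "\<kappa> p = (let c = (SOME c. c \<in> A \<and> p \<in> fst c) in kc c (snd c p))" for p
  have \<kappa>: "\<kappa> p = kc c (snd c p)" if "c \<in> A" "p \<in> fst c" for c p
  proof -
    have "(SOME c. c \<in> A \<and> p \<in> fst c) \<in> A \<and> p \<in> fst (SOME c. c \<in> A \<and> p \<in> fst c)"
      by (rule someI[of "\<lambda>c. c \<in> A \<and> p \<in> fst c" c]) (use that in simp)
    thus ?thesis unfolding \<kappa>_def Let_def using inv that by blast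
  qed
  show ?thesis
    unfolding isotropic_S_curvature_def
  proof (intro exI conjI ballI)
    show "smooth_function A \<kappa>"
      unfolding smooth_function_def
    proof
      fix c assume c: "c \<in> A"
      interpret rc: randers_chart "snd c ` fst c" "ca c" "cb c" by (rule randers_chart[OF c])
      have "smooth_on (snd c ` fst c) (kc c)"
        unfolding kc_def ee_def qq_def
        by (intro smooth_on_divide smooth_on_mult smooth_on_const rc.smooth_ee rc.smooth_qq open_chart[OF c])
           (use rc.qq_pos[OF _ e0] in force)
      thus "smooth_on (snd c ` fst c) (\<kappa> \<circ> chart_inv c)"
        by (rule smooth_on_cong) (auto simp: \<kappa>[OF c] chart_inv_snd[OF c])
    qed
    fix c p v assume c: "c \<in> A" and p: "p \<in> fst c" and v: "v \<in> tangent_space A p - {\<lambda>_. 0}"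
    interpret rc: randers_chart "snd c ` fst c" "ca c" "cb c" by (rule randers_chart[OF c])
    have x: "snd c p \<in> snd c ` fst c" using p by simp
    have vt: "tvec_of A c p (v c) = v" using tvec_self[OF c p] v by simp
    have v0: "v c \<noteq> 0" using tvec_eq_0[OF c p, of "v c"] vt v by auto
    have "S_curv (local_metric A F c) (snd c p) (v c) = (real CARD('n)
        + 1) * kc c (snd c p) * rc.F (snd c p) (v c)"
    proof (rule rc.S_curv_isotropic[OF _ x v0])
      show "\<forall>x\<in>snd c ` fst c. \<forall>y. local_metric A F c x y = rc.F x y" using FL[OF c] by blast
      show "rc.ee (snd c p) y = 2 * kc c (snd c p) * rc.qq (snd c p) y" for y
        using ee_qq[OF c x] by (simp add: ee_def qq_def)
    qed
    also have "rc.F (snd c p) (v c) = F p v"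
      using FL[OF c x, of "v c"] by (simp add: local_metric_def chart_inv_snd[OF c p] vt)
    finally show "S_curv (local_metric A F c) (snd c p) (v c) = (real CARD('n) + 1) * \<kappa> p * F p v"
      by (simp add: \<kappa>[OF c p])
  qed
qed

end
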